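(* Let $a,b,c>0$ with $a<b+c$ and $b<a+c$. Then the matrix operator $B(a,b,c)$ on $\ell^{2}(\mathbb{Z}_{+})$ is unitarily equivalent to the operator of multiplication by the function \[ h(x)=\frac{1}{\Gamma(b+c-a)}\,\Gamma\!\left(\frac{b+c-a}{2}+ix\right)\Gamma\!\left(\frac{b+c-a}{2}-ix\right) \] acting on $L^{2}(\mathcal{M}(a,b,c),\mathrm{d}\mu)$. More precisely, the map $U:e_n\mapsto \hat P_n(x^2)$, $n\in\mathbb{Z}_+$, extends to a unitary operator $U:\ell^2(\mathbb{Z}_+)\to L^{2}(\mathcal{M}(a,b,c),\mathrm{d}\mu)$ and $UB(a,b,c)U^{-1}$ is multiplication by $h$.
   Context: $\mathbb{Z}_{+}=\{0,1,2,\ldots\}$, $\{e_n\}$ is the standard basis of $\ell^2(\mathbb{Z}_+)$, $\Gamma$ is the Gamma function, $(q)_n$ the Pochhammer symbol. $B(a,b,c)$ is the semi-infinite matrix with entries $B_{j,k}=\frac{\Gamma(j+k+a)}{\Gamma(j+k+b+c)}\sqrt{\frac{\Gamma(j+b)\Gamma(j+c)\Gamma(k+b)\Gamma(k+c)}{\Gamma(j+a)\,j!\,\Gamma(k+a)\,k!}}$, $j,k\in\mathbb{Z}_+$. Put $\alpha=\frac{b+c-a}{2}$, $\gamma=\frac{a+b-c}{2}$. Define the polynomials (continuous dual Hahn, normalized) \[ \hat P_n(x^2)=\sqrt{\frac{(b)_n(c)_n}{(a)_n\,n!}}\;{}_3F_2\!\left(-n,\alpha+ix,\alpha-ix;b,c;1\right),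 \] viewed as polynomials in $x^2$ (so they make sense for imaginary $x$ too). Let \[ \rho(x)=\frac{x\sinh(2\pi x)}{\pi^{2}\Gamma(a)\Gamma(b)\Gamma(c)}\left|\Gamma\!\left(\tfrac{b+c-a}{2}+ix\right)\Gamma\!\left(\tfrac{a+c-b}{2}+ix\right)\Gamma\!\left(\tfrac{a+b-c}{2}+ix\right)\right|^{2},\quad x>0. \] Let $N(a,b,c)=\lceil (c-a-b)/2\rceil-1$ and $\lambda_k=i\left(\frac{a+b-c}{2}+k\right)$. Set $\mathcal{M}(a,b,c)=(0,\infty)$ if $c\le a+b$, and $\mathcal{M}(a,b,c)=(0,\infty)\cup\{\lambda_k:k=0,1,\ldots,N(a,b,c)\}$ if $c>a+b$. The measure $\mu$ is $\mathrm{d}\mu=\rho(x)\mathrm{d}x$ on $(0,\infty)$ and, when $c>a+b$, \[ \mu(\{\lambda_k\})=\frac{(-1)^{k}\Gamma(c-a)\Gamma(c-b)}{\Gamma(c)\Gamma(c-a-b)}\left(1+\frac{2k}{a+b-c}\right)\frac{(a+b-c)_{k}(a)_{k}(b)_{k}}{(a-c+1)_{k}(b-c+1)_{k}\,k!}. \] *)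

theory Defs
  imports "HOL-Analysis.Analysis"
begin

definition Bmat :: "real \<Rightarrow> real \<Rightarrow> real \<Rightarrow> nat \<Rightarrow> nat \<Rightarrow> real" where
  "Bmat a b c j k =
     Gamma (real (j + k) + a) / Gamma (real (j + k) + b + c) *
     sqrt (Gamma (real j + b) * Gamma (real j + c) * Gamma (real k + b) * Gamma (real k + c) /
           (Gamma (real j + a) * fact j * Gamma (real k + a) * fact k))"

definition Bop :: "real \<Rightarrow> real \<Rightarrow> real \<Rightarrow> (nat \<Rightarrow> complex) \<Rightarrow> nat \<Rightarrow> complex" where
  "Bop a b c x j = (\<Sum>k. complex_of_real (Bmat a b c j k) * x k)"

definition l2seq :: "(nat \<Rightarrow> complex) \<Rightarrow> bool" where
  "l2seq x \<longleftrightarrow> summable (\<lambda>n. (norm (x n))\<^sup>2)"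

definition ebasis :: "nat \<Rightarrow> nat \<Rightarrow> complex" where
  "ebasis n = (\<lambda>m. if m = n then 1 else 0)"

definition alphap :: "real \<Rightarrow> real \<Rightarrow> real \<Rightarrow> real" where
  "alphap a b c = (b + c - a) / 2"

definition gammap :: "real \<Rightarrow> real \<Rightarrow> real \<Rightarrow> real" where
  "gammap a b c = (a + b - c) / 2"

text \<open>Normalized continuous dual Hahn polynomials \<open>\<hat>P_n(x^2)\<close>, evaluated at a complex
  argument x (the terminating 3F2 is written out as a finite sum; it is a polynomial in x^2).\<close>
definition Phat :: "real \<Rightarrow> real \<Rightarrow> real \<Rightarrow> nat \<Rightarrow> complex \<Rightarrow> complex" where
  "Phat a b c n x =
     complex_of_real (sqrt (pochhammer b n * pochhammer c n / (pochhammer a n * fact n))) *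
     (\<Sum>k\<le>n. pochhammer (- of_nat n) k
              * pochhammer (complex_of_real (alphap a b c) + \<i> * x) k
              * pochhammer (complex_of_real (alphap a b c) - \<i> * x) k
              / (complex_of_real (pochhammer b k * pochhammer c k) * fact k))"

definition hfun :: "real \<Rightarrow> real \<Rightarrow> real \<Rightarrow> complex \<Rightarrow> complex" where
  "hfun a b c x =
     Gamma (complex_of_real (alphap a b c) + \<i> * x) * Gamma (complex_of_real (alphap a b c) - \<i> * x)
     / complex_of_real (Gamma (b + c - a))"

definition rho :: "real \<Rightarrow> real \<Rightarrow> real \<Rightarrow> real \<Rightarrow> real" where
  "rho a b c x =
     x * sinh (2 * pi * x) / (pi\<^sup>2 * Gamma a * Gamma b * Gamma c) *
     (cmod (Gamma (complex_of_real ((b + c - a) / 2) + \<i> * complex_of_real x) *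
            Gamma (complex_of_real ((a + c - b) / 2) + \<i> * complex_of_real x) *
            Gamma (complex_of_real ((a + b - c) / 2) + \<i> * complex_of_real x)))\<^sup>2"

definition Nbound :: "real \<Rightarrow> real \<Rightarrow> real \<Rightarrow> int" where
  "Nbound a b c = \<lceil>(c - a - b) / 2\<rceil> - 1"

definition lam :: "real \<Rightarrow> real \<Rightarrow> real \<Rightarrow> nat \<Rightarrow> complex" where
  "lam a b c k = \<i> * complex_of_real ((a + b - c) / 2 + real k)"

definition wmass :: "real \<Rightarrow> real \<Rightarrow> real \<Rightarrow> nat \<Rightarrow> real" where
  "wmass a b c k =
     (-1) ^ k * Gamma (c - a) * Gamma (c - b) / (Gamma c * Gamma (c - a - b)) *
     (1 + 2 * real k / (a + b - c)) *
     (pochhammer (a + b - c) k * pochhammer a k * pochhammer b k /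
      (pochhammer (a - c + 1) k * pochhammer (b - c + 1) k * fact k))"

definition atoms :: "real \<Rightarrow> real \<Rightarrow> real \<Rightarrow> nat set" where
  "atoms a b c = (if c > a + b then {k. int k \<le> Nbound a b c} else {})"

definition Mset :: "real \<Rightarrow> real \<Rightarrow> real \<Rightarrow> complex set" where
  "Mset a b c = complex_of_real ` {0<..} \<union> lam a b c ` atoms a b c"

definition mu :: "real \<Rightarrow> real \<Rightarrow> real \<Rightarrow> complex measure" where
  "mu a b c = measure_of (Mset a b c) (sets (restrict_space borel (Mset a b c)))
     (\<lambda>A. (\<integral>\<^sup>+ x. ennreal (rho a b c x) * indicator {x. 0 < x \<and> complex_of_real x \<in> A} x \<partial>lborel)
          + (\<Sum>k\<in>{k\<in>atoms a b c. lam a b c k \<in> A}. ennreal (wmass a b c k)))"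

definition L2fun :: "complex measure \<Rightarrow> (complex \<Rightarrow> complex) \<Rightarrow> bool" where
  "L2fun M f \<longleftrightarrow> f \<in> borel_measurable M \<and> integrable M (\<lambda>z. (norm (f z))\<^sup>2)"

end

theory Submission
  imports Defs "HOL-Complex_Analysis.Complex_Analysis" "HOL-Probability.Probability"
begin

text \<open>
  Write \<open>\<alpha> + \<gamma> = b\<close>, \<open>\<alpha> + \<beta> = c\<close>, \<open>\<beta> + \<gamma> = a\<close>. The weight is a constant times
  \<open>|\<Gamma>(\<alpha>+ix) \<Gamma>(\<beta>+ix) \<Gamma>(\<gamma>+ix) / \<Gamma>(2ix)|\<^sup>2\<close>, and multiplying it by \<open>(A+ix)\<^sub>n (A-ix)\<^sub>n\<close> with \<open>A\<close> one of
  the parameters, or by \<open>h\<close>, again gives products of Gamma functions. So every integral that is needed is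
  an instance of the three-parameter integral of the continuous dual Hahn polynomials or of the
  four-parameter de Branges-Wilson integral, with discrete masses if \<open>\<gamma> < 0\<close>.

  For positive parameters a contour shift from \<open>Re u = 0\<close> to \<open>Re u = 1/2\<close>, where the integrand is odd, gives
  a first-order recurrence in each parameter; letting that parameter tend to infinity shows that the
  quotient by the expected value does not depend on it, and at \<open>(1/2,1/2,1/2,1/2)\<close> the integrand has an
  elementary primitive. Parameters \<open>C \<le> 0\<close> are reached by descending from \<open>C + 1\<close> to \<open>C\<close>: the defect \<open>E(A)\<close>
  satisfies \<open>E(A+1) = (A\<^sup>2 - C\<^sup>2) E(A)\<close>, hence \<open>E(A) = \<Gamma>(A+C) \<Gamma>(A-C) E\<^sub>3\<close> with \<open>E\<^sub>3\<close> independent of \<open>A\<close>, and the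
  limit \<open>A \<rightarrow> -C\<close> forces \<open>E\<^sub>3 = 0\<close>.

  Orthonormality and the matrix elements of \<open>h\<close> then follow from one summation formula, a form of
  Chu-Vandermonde. Completeness holds since the weight decays exponentially: a function orthogonal to all
  polynomials has, after removing the atoms by a polynomial factor, a vanishing Fourier transform.
\<close>

section \<open>The modulus of the Gamma function on vertical lines\<close>

text \<open>The obstacle is gamma < 0: poles of Gamma(gamma + u) then lie to the right of the
  imaginary axis, and a direct contour shift would have to collect residues. The contour is
  therefore shifted for positive parameters only, and the masses enter algebraically. The identity
  A^2 + x^2 = (C^2 + x^2) + (A^2 - C^2) expresses raising A through raising C, on the half-line and
  at the atoms x^2 = -(C+k)^2 alike; the factor C^2 + x^2 kills atom 0 of C and turns the others
  into the atoms of C + 1. The limit A -> -C sees precisely atom 0, through the pole of Gamma(A+C).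

  Two polynomial bases in x^2 occur, (al+ix)_n (al-ix)_n and (be+ix)_n (be-ix)_n. A product of one
  from each basis merely shifts two parameters of the three-parameter integral, whereas two from the
  same basis would compete for one Gamma factor; hence the change of basis in the orthogonality
  proof. The multiplier h brings a second factor with parameter al, so for matrix elements both
  polynomials may come from the first basis.\<close>

lemma Gamma_shift_asymp:
  fixes z :: "'a :: Gamma"
  assumes z: "z \<notin> \<int>\<^sub>\<le>\<^sub>0"
  shows "(\<lambda>n. Gamma (z + of_nat (Suc n)) / (fact n * exp (z * of_real (ln (of_nat n))))) \<longlonglongrightarrow> 1"
proof -
  have "(\<lambda>n. Gamma z / Gamma_series z n) \<longlonglongrightarrow> Gamma z / Gamma z"
    by (intro tendsto_intros Gamma_series_LIMSEQ) (use z in \<open>simp add: Gamma_eq_zero_iff\<close>)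
  moreover have "Gamma z / Gamma_series z n
      = Gamma (z + of_nat (Suc n)) / (fact n * exp (z * of_real (ln (of_nat n))))" for n
    using z by (simp add: Gamma_series_def pochhammer_Gamma Gamma_eq_zero_iff del: of_nat_Suc)
  ultimately show ?thesis using z by (simp add: Gamma_eq_zero_iff)
qed

lemma Gamma_real_shift_asymp:
  fixes z :: real
  assumes z: "z \<notin> \<int>\<^sub>\<le>\<^sub>0"
  shows "(\<lambda>n. Gamma (z + real (Suc n)) / (fact n * exp (z * ln (real n)))) \<longlonglongrightarrow> 1"
  using Gamma_shift_asymp[OF z] by simp

text \<open>For real \<open>x\<close> this is Gamma(A + ix) Gamma(A - ix), the shape in which a
  parameter enters the weight. \<open>Gamma\<close> is 0 at its poles, where the recurrence can
  fail; the recurring hypothesis \<open>A > 0 \<or> x \<noteq> 0\<close> keeps away from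
  them.\<close>

definition phi :: "real \<Rightarrow> real \<Rightarrow> real" where
  "phi A x = (cmod (Gamma (Complex A x)))\<^sup>2"

lemma Complex_nonpos_Ints_iff: "Complex A x \<in> \<int>\<^sub>\<le>\<^sub>0 \<longleftrightarrow> x = 0 \<and> A \<in> \<int>\<^sub>\<le>\<^sub>0"
proof -
  have "Complex A x \<in> \<int>\<^sub>\<le>\<^sub>0 \<Longrightarrow> x = 0"
    by (auto elim!: nonpos_Ints_cases simp: complex_eq_iff)
  moreover have "Complex A 0 = of_real A" by (simp add: complex_eq_iff)
  ultimately show ?thesis by (metis of_real_in_nonpos_Ints_iff)
qed

lemma pos_notin_nonpos_Ints: "(A::real) > 0 \<Longrightarrow> A \<notin> \<int>\<^sub>\<le>\<^sub>0"
  by (auto elim!: nonpos_Ints_cases)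

lemma phi_zero_arg: "phi A 0 = (Gamma A)\<^sup>2"
proof -
  have "Complex A 0 = of_real A" by (simp add: complex_eq_iff)
  thus ?thesis by (simp add: phi_def Gamma_complex_of_real)
qed

lemma phi_nonneg [simp]: "phi A x \<ge> 0"
  by (simp add: phi_def)

lemma phi_pos: "A > 0 \<or> x \<noteq> 0 \<Longrightarrow> phi A x > 0"
  using pos_notin_nonpos_Ints[of A]
  by (auto simp: phi_def Gamma_eq_zero_iff Complex_nonpos_Ints_iff)

lemma phi_minus: "phi A (-x) = phi A x"
proof -
  have "Gamma (Complex A (-x)) = cnj (Gamma (Complex A x))"
    by (simp add: cnj_Gamma complex_cnj)
  thus ?thesis by (simp add: phi_def)
qed

lemma phi_plus1: "A > 0 \<or> x \<noteq> 0 \<Longrightarrow> phi (A + 1) x = (A\<^sup>2 + x\<^sup>2) * phi A x"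
proof -
  assume "A > 0 \<or> x \<noteq> 0"
  hence "Complex A x \<notin> \<int>\<^sub>\<le>\<^sub>0" using pos_notin_nonpos_Ints[of A] by (auto simp: Complex_nonpos_Ints_iff)
  hence "Gamma (Complex A x + 1) = Complex A x * Gamma (Complex A x)"
    by (rule Gamma_plus1)
  moreover have "Complex A x + 1 = Complex (A + 1) x" by (simp add: complex_eq_iff)
  ultimately show ?thesis
    by (simp add: phi_def norm_mult power_mult_distrib cmod_power2)
qed

text \<open>In Gamma(z+n+1) ~ n! n^z the factor n^(ix) has modulus 1, so the normaliser is the same
  for every \<open>x\<close>; this lets \<open>phi_ratio_tendsto\<close> divide by the value at
  \<open>x = 0\<close>.\<close>

lemma phi_asymp:
  assumes "A > 0 \<or> x \<noteq> 0"
  shows "(\<lambda>n. phi (A + real (Suc n)) x / (fact n * exp (A * ln (real n)))\<^sup>2) \<longlonglongrightarrow> 1"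
proof -
  have "Complex A x \<notin> \<int>\<^sub>\<le>\<^sub>0"
    using assms pos_notin_nonpos_Ints[of A] by (auto simp: Complex_nonpos_Ints_iff)
  from tendsto_power[OF tendsto_norm[OF Gamma_shift_asymp[OF this]], of 2]
  have "(\<lambda>n. (cmod (Gamma (Complex A x + of_nat (Suc n)) /
     (fact n * exp (Complex A x * of_real (ln (of_nat n))))))\<^sup>2) \<longlonglongrightarrow> 1"
    by simp
  moreover have "Complex A x + of_nat (Suc n) = Complex (A + real (Suc n)) x" for n
    by (simp add: complex_eq_iff)
  ultimately show ?thesis
    by (simp add: phi_def norm_divide norm_mult power_divide norm_fact)
qed

lemma phi_ratio_tendsto:
  assumes "A > 0"
  shows "(\<lambda>n. phi (A + real (Suc n)) x / (Gamma (A + real (Suc n)))\<^sup>2) \<longlonglongrightarrow> 1"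
proof -
  have "(\<lambda>n. (phi (A + real (Suc n)) x / (fact n * exp (A * ln (real n)))\<^sup>2) /
             (phi (A + real (Suc n)) 0 / (fact n * exp (A * ln (real n)))\<^sup>2)) \<longlonglongrightarrow> 1 / 1"
    by (intro tendsto_divide phi_asymp) (use assms in auto)
  thus ?thesis by (simp add: phi_zero_arg)
qed

text \<open>The factorials cancel, and the powers of n cancel exactly when C + D = E. The case E = 0
  serves the atoms, the others the Gamma quotients in \<open>prod4_limit\<close>.\<close>

lemma Gamma_pair_ratio_tendsto:
  fixes A C :: real
  assumes "A > 0" "A + C \<notin> \<int>\<^sub>\<le>\<^sub>0" "A + D \<notin> \<int>\<^sub>\<le>\<^sub>0" "A + E \<notin> \<int>\<^sub>\<le>\<^sub>0" "C + D = E"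
  shows "(\<lambda>n. Gamma (A + real (Suc n) + C) * Gamma (A + real (Suc n) + D) /
              (Gamma (A + real (Suc n)) * Gamma (A + real (Suc n) + E))) \<longlonglongrightarrow> 1"
proof -
  let ?g = "\<lambda>z n. Gamma (z + real (Suc n)) / (fact n * exp (z * ln (real n)))"
  have "(\<lambda>n. (?g (A+C) n * ?g (A+D) n) / (?g A n * ?g (A+E) n)) \<longlonglongrightarrow> 1 * 1 / (1 * 1)"
    by (intro tendsto_divide tendsto_mult Gamma_real_shift_asymp)
       (use assms pos_notin_nonpos_Ints in auto)
  moreover have "(?g (A+C) n * ?g (A+D) n) / (?g A n * ?g (A+E) n) =
     Gamma (A + real (Suc n) + C) * Gamma (A + real (Suc n) + D) /
              (Gamma (A + real (Suc n)) * Gamma (A + real (Suc n) + E))" for n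
  proof -
    have "exp ((A+C) * ln (real n)) * exp ((A+D) * ln (real n)) =
          exp (A * ln (real n)) * exp ((A+E) * ln (real n))"
      unfolding exp_add[symmetric] assms(5)[symmetric] by (simp add: algebra_simps)
    moreover have "z + real (Suc n) = A + real (Suc n) + w" if "z = A + w" for z w
      using that by simp
    ultimately show ?thesis
      by (simp add: field_simps add_ac)
  qed
  ultimately show ?thesis by simp
qed

text \<open>Euler's product: the quotient is the infinite product of (A+j)^2 / ((A+j)^2 + x^2), and
  every factor increases with A. This transfers bounds from half-integers, where \<open>phi\<close>
  is elementary, to all smaller positive parameters.\<close>

lemma phi_ratio_mono:
  assumes "0 < A" "A \<le> B"
  shows "phi A x / (Gamma A)\<^sup>2 \<le> phi B x / (Gamma B)\<^sup>2"
proof -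
  have lim: "(\<lambda>n. \<Prod>j\<le>n. (A + real j)\<^sup>2 / ((A + real j)\<^sup>2 + x\<^sup>2)) \<longlonglongrightarrow> phi A x / (Gamma A)\<^sup>2"
    if A: "A > 0" for A
  proof -
    \<comment> \<open>The finite product telescopes through \<open>phi_plus1\<close>; the remainder
      is the quotient at A + n + 1, which tends to 1.\<close>
    have e: "(\<Prod>j\<le>n. (A + real j)\<^sup>2 / ((A + real j)\<^sup>2 + x\<^sup>2)) =
        (phi A x / (Gamma A)\<^sup>2) / (phi (A + real (Suc n)) x / (Gamma (A + real (Suc n)))\<^sup>2)" for n
    proof (induction n)
      case 0
      have g: "Gamma (A + 1) = A * Gamma A" using A pos_notin_nonpos_Ints by (intro Gamma_plus1) auto
      have f: "phi (A + 1) x = (A\<^sup>2 + x\<^sup>2) * phi A x" using A by (intro phi_plus1) auto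
      have p: "phi A x \<noteq> 0" "Gamma A \<noteq> 0" "A\<^sup>2 + x\<^sup>2 \<noteq> 0"
        using A phi_pos[of A x] Gamma_real_pos[OF A] add_pos_nonneg[of "A\<^sup>2" "x\<^sup>2"] by (auto simp del: Gamma_real_pos)
      show ?case using A p by (simp add: g f power_mult_distrib)
    next
      case (Suc n)
      let ?B = "A + real (Suc n)"
      have B: "?B > 0" using A by simp
      have s: "A + real (Suc (Suc n)) = ?B + 1" by simp
      have p: "phi ?B x > 0" "Gamma ?B > 0" using B by (auto intro: phi_pos)
      have q: "?B\<^sup>2 + x\<^sup>2 > 0" using B by (simp add: add_pos_nonneg)
      have g: "Gamma (?B + 1) = ?B * Gamma ?B" using B pos_notin_nonpos_Ints by (intro Gamma_plus1) auto
      have f: "phi (?B + 1) x = (?B\<^sup>2 + x\<^sup>2) * phi ?B x" using B by (intro phi_plus1) auto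
      have "c / (u / w\<^sup>2) * (v\<^sup>2 / t) = c / (t * u / (v * w)\<^sup>2)" if "u > 0" "w > 0" "t > 0" "v > 0" for c u v w t :: real
        using that by (simp add: power_mult_distrib field_simps)
      thus ?case
        unfolding prod.atMost_Suc Suc s g f using p q B by blast
    qed
    have "(\<lambda>n. (phi A x / (Gamma A)\<^sup>2) / (phi (A + real (Suc n)) x / (Gamma (A + real (Suc n)))\<^sup>2))
       \<longlonglongrightarrow> (phi A x / (Gamma A)\<^sup>2) / 1"
      by (intro tendsto_divide tendsto_const phi_ratio_tendsto) (use A in auto)
    thus ?thesis unfolding e by simp
  qed
  show ?thesis
  proof (rule LIMSEQ_le[OF lim lim])
    show "\<exists>N. \<forall>n\<ge>N. (\<Prod>j\<le>n. (A + real j)\<^sup>2 / ((A + real j)\<^sup>2 + x\<^sup>2)) \<le> (\<Prod>j\<le>n. (B + real j)\<^sup>2 / ((B + real j)\<^sup>2 + x\<^sup>2))"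
    proof (intro exI[of _ 0] allI impI prod_mono conjI)
      fix j :: nat
      have "(A + j)\<^sup>2 \<le> (B + j)\<^sup>2" using assms by (intro power_mono) auto
      moreover have "(A + j)\<^sup>2 > 0" using assms by auto
      ultimately have 1: "(A + j)\<^sup>2 > 0" "(B + j)\<^sup>2 > 0" "(A + j)\<^sup>2 \<le> (B + j)\<^sup>2" by linarith+
      moreover have "u / (u + t) \<le> v / (v + t)" if "u > 0" "u \<le> v" "t \<ge> 0" for u v t :: real
        using that by (simp add: field_simps add_pos_nonneg mult_left_mono)
      ultimately show "(A + real j)\<^sup>2 / ((A + real j)\<^sup>2 + x\<^sup>2) \<le> (B + real j)\<^sup>2 / ((B + real j)\<^sup>2 + x\<^sup>2)"
        by auto
    qed auto
  qed (use assms in auto)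
qed

lemma phi_le: 
  assumes "0 < A"
  shows "phi A x \<le> (Gamma A)\<^sup>2"
proof -
  have "phi A x / (Gamma A)\<^sup>2 \<le> 1"
  proof (rule LIMSEQ_le_const[OF phi_ratio_tendsto[OF assms, of x]])
    show "\<exists>N. \<forall>n\<ge>N. phi A x / (Gamma A)\<^sup>2 \<le> phi (A + real (Suc n)) x / (Gamma (A + real (Suc n)))\<^sup>2"
      by (intro exI[of _ 0] allI impI phi_ratio_mono) (use assms in auto)
  qed
  moreover have "Gamma A > 0" using assms by simp
  ultimately show ?thesis by (simp add: divide_le_eq split: if_splits)
qed

section \<open>Exponential decay along vertical lines\<close>

lemma phi_half: "phi (1/2) x = pi / cosh (pi * x)"
proof -
  let ?z = "Complex (1/2) x"
  \<comment> \<open>On Re z = 1/2 the point 1 - z is the conjugate of z, so the reflection formula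
    evaluates the squared modulus.\<close>
  have "1 - ?z = cnj ?z" by (simp add: complex_eq_iff)
  hence "Gamma ?z * cnj (Gamma ?z) = of_real pi / sin (of_real pi * ?z)"
    using Gamma_reflection_complex[of ?z] by (simp add: cnj_Gamma)
  moreover have "Gamma ?z * cnj (Gamma ?z) = of_real (phi (1/2) x)"
    unfolding phi_def complex_norm_square ..
  moreover have "sin (of_real pi * ?z) = of_real (cosh (pi * x))"
  proof -
    have "of_real pi * ?z = of_real (pi/2) + of_real (pi * x) * \<i>" by (simp add: complex_eq_iff)
    hence "sin (of_real pi * ?z) = sin (of_real (pi/2) + of_real (pi * x) * \<i>)" by simp
    also have "\<dots> = cos (of_real (pi * x) * \<i>)"
      by (subst sin_add) (simp add: sin_of_real cos_of_real del: of_real_divide)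
    also have "\<dots> = of_real (cosh (pi * x))"
      using cosh_conv_cos[of "of_real (pi * x)"]
      by (simp add: mult.commute cosh_def scaleR_conv_of_real exp_of_real flip: of_real_mult of_real_minus)
    finally show ?thesis .
  qed
  ultimately have "of_real (phi (1/2) x) = (of_real (pi / cosh (pi * x)) :: complex)" by simp
  thus ?thesis using of_real_eq_iff by blast
qed

text \<open>Raising the parameter by 1 multiplies by A^2 + x^2. The induction hypothesis is used at
  e/2, and the other e/2 pays for that polynomial factor.\<close>

lemma phi_half_plus_bound:
  assumes e: "e > 0"
  shows "\<exists>K. \<forall>x. phi (1/2 + real n) x \<le> K * exp (-(pi - e) * \<bar>x\<bar>)"
  using e
proof (induction n arbitrary: e)
  case 0
  have "phi (1/2) x \<le> 2 * pi * exp (-(pi - e) * \<bar>x\<bar>)" for x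
  proof -
    have "cosh (pi * x) \<ge> exp (pi * \<bar>x\<bar>) / 2"
      by (cases "x \<ge> 0") (auto simp: cosh_def)
    hence "phi (1/2) x \<le> pi / (exp (pi * \<bar>x\<bar>) / 2)"
      unfolding phi_half by (intro divide_left_mono) (auto simp: cosh_real_pos)
    also have "\<dots> = 2 * pi * exp (- pi * \<bar>x\<bar>)" by (simp add: exp_minus field_simps)
    also have "\<dots> \<le> 2 * pi * exp (-(pi - e) * \<bar>x\<bar>)" using 0 by (simp add: algebra_simps)
    finally show ?thesis .
  qed
  thus ?case by auto
next
  case (Suc n)
  from Suc.IH[of "e/2"] Suc.prems obtain K where K: "phi (1/2 + real n) x \<le> K * exp (-(pi - e/2) * \<bar>x\<bar>)" for x by auto
  have K0: "K \<ge> 0" using order_trans[OF phi_nonneg K[of 0]] by simp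
  let ?A = "1/2 + real n"
  have sq: "x\<^sup>2 \<le> (8 / e\<^sup>2) * exp (e/2 * \<bar>x\<bar>)" for x
  proof -
    have t: "e/2 * \<bar>x\<bar> \<ge> 0" using Suc.prems by simp
    have "(e/2 * \<bar>x\<bar>)\<^sup>2 / 2 \<le> exp (e/2 * \<bar>x\<bar>)"
      using exp_lower_Taylor_quadratic[OF t] t by linarith
    thus ?thesis using Suc.prems by (simp add: power_mult_distrib power_divide field_simps)
  qed
  have one: "1 \<le> exp (e/2 * \<bar>x\<bar>)" for x using Suc.prems by simp
  have "phi (1/2 + real (Suc n)) x \<le> (?A\<^sup>2 + 8 / e\<^sup>2) * K * exp (-(pi - e) * \<bar>x\<bar>)" for x
  proof -
    have "phi (1/2 + real (Suc n)) x = (?A\<^sup>2 + x\<^sup>2) * phi ?A x"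
      using phi_plus1[of ?A x] by (simp add: add_ac)
    also have "\<dots> \<le> (?A\<^sup>2 * exp (e/2 * \<bar>x\<bar>) + (8 / e\<^sup>2) * exp (e/2 * \<bar>x\<bar>)) * (K * exp (-(pi - e/2) * \<bar>x\<bar>))"
    proof (rule mult_mono[OF _ K])
      show "?A\<^sup>2 + x\<^sup>2 \<le> ?A\<^sup>2 * exp (e/2 * \<bar>x\<bar>) + (8 / e\<^sup>2) * exp (e/2 * \<bar>x\<bar>)"
        using sq[of x] mult_left_mono[OF one[of x], of "?A\<^sup>2"] unfolding mult_1_right by (intro add_mono) auto
    qed (use K0 in auto)
    also have "\<dots> = (?A\<^sup>2 + 8 / e\<^sup>2) * K * (exp (e/2 * \<bar>x\<bar>) * exp (-(pi - e/2) * \<bar>x\<bar>))"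
      by (simp add: algebra_simps)
    also have "exp (e/2 * \<bar>x\<bar>) * exp (-(pi - e/2) * \<bar>x\<bar>) = exp (-(pi - e) * \<bar>x\<bar>)"
      by (simp add: exp_add[symmetric] algebra_simps)
    finally show ?thesis .
  qed
  thus ?case by blast
qed

text \<open>Monotonicity compares every A in the interval with a single half-integer above
  \<open>t\<close>; the price Gamma(A)^2 is bounded by compactness. The contour shift needs this
  uniformity across its strip.\<close>

lemma phi_bound_uniform:
  assumes e: "e > 0" and s: "0 < s"
  shows "\<exists>K. \<forall>A\<in>{s..t}. \<forall>x. phi A x \<le> K * exp (-(pi - e) * \<bar>x\<bar>)"
proof -
  obtain n where n: "t \<le> 1/2 + real n" using real_arch_simple[of t] by (metis add_increasing divide_nonneg_pos zero_le_one zero_less_numeral)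
  obtain K where K: "phi (1/2 + real n) x \<le> K * exp (-(pi - e) * \<bar>x\<bar>)" for x
    using phi_half_plus_bound[OF e, of n] by auto
  have K0: "K \<ge> 0" using order_trans[OF phi_nonneg K[of 0]] by simp
  have "compact ((\<lambda>A::real. (Gamma A)\<^sup>2) ` {s..t})"
    by (intro compact_continuous_image continuous_intros) (use s in auto)
  then obtain M where M: "\<And>A. A \<in> {s..t} \<Longrightarrow> (Gamma A)\<^sup>2 \<le> M"
    unfolding compact_eq_bounded_closed bounded_real by (meson abs_le_D1 bounded_real imageI)
  define G where "G = (Gamma (1/2 + real n))\<^sup>2"
  have G: "G > 0" unfolding G_def by (intro zero_less_power Gamma_real_pos) (simp add: add_pos_nonneg)
  have "phi A x \<le> (M / G * K) * exp (-(pi - e) * \<bar>x\<bar>)" if A: "A \<in> {s..t}" for A x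
  proof -
    have A0: "A > 0" "A \<le> 1/2 + real n" using A s n by auto
    have "phi A x \<le> (Gamma A)\<^sup>2 * (phi (1/2 + real n) x / G)"
      using mult_left_mono[OF phi_ratio_mono[OF A0, of x], of "(Gamma A)\<^sup>2"] Gamma_real_pos[OF A0(1)]
      unfolding G_def by (simp del: Gamma_real_pos)
    also have "\<dots> \<le> M * (K * exp (-(pi - e) * \<bar>x\<bar>) / G)"
      using M[OF A] K[of x] G by (intro mult_mono divide_right_mono) (auto intro: order_trans[OF zero_le_power2])
    finally show ?thesis by (simp add: field_simps)
  qed
  thus ?thesis by blast
qed

lemma phi_bound:
  assumes "e > 0" "0 < A"
  obtains K where "K > 0" "\<And>x. phi A x \<le> K * exp (-(pi - e) * \<bar>x\<bar>)"
proof -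
  from phi_bound_uniform[OF assms, of A] obtain K where
    K: "phi A x \<le> K * exp (-(pi - e) * \<bar>x\<bar>)" for x by auto
  have "phi A 0 > 0" using assms by (intro phi_pos) auto
  hence "K > 0" using K[of 0] by simp
  thus ?thesis using that K by blast
qed

text \<open>If C is a nonpositive integer, \<open>phi C x\<close> blows up like 1/x^2 at 0, and x^2
  compensates exactly that. The descent from (0,1] divides by C^2 + x^2 >= C^2; at C = 0 the
  recurrence itself reads x^2 phi 0 x = phi 1 x.\<close>

lemma phi_bound_singular:
  assumes e: "e > 0"
  shows "\<exists>K>0. \<forall>x>0. x\<^sup>2 * phi C x \<le> K * exp (-(pi - e) * x)"
proof -
  have pos: "\<exists>K>0. \<forall>x>0. x\<^sup>2 * phi C x \<le> K * exp (-(pi - e) * x)" if C: "C > 0" for C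
  proof -
    have "C + 1 > 0" using C by simp
    from phi_bound[OF e this] obtain K where K: "K > 0" "\<And>x. phi (C+1) x \<le> K * exp (-(pi - e) * \<bar>x\<bar>)" by blast
    have "x\<^sup>2 * phi C x \<le> K * exp (-(pi - e) * x)" if x: "x > 0" for x
    proof -
      have "x\<^sup>2 * phi C x \<le> (C\<^sup>2 + x\<^sup>2) * phi C x" by (intro mult_right_mono) auto
      thus ?thesis using K(2)[of x] phi_plus1[of C x] C x by simp
    qed
    thus ?thesis using K(1) by blast
  qed
  have "\<exists>K>0. \<forall>x>0. x\<^sup>2 * phi (C0 - real n) x \<le> K * exp (-(pi - e) * x)" if "C0 > 0" "C0 \<le> 1" for C0 n
  proof (induction n)
    case 0
    show ?case using pos[of C0] that by simp
  next
    case (Suc n)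
    define C where "C = C0 - real (Suc n)"
    have C1: "C + 1 = C0 - real n" by (simp add: C_def)
    have p: "phi (C + 1) x = (C\<^sup>2 + x\<^sup>2) * phi C x" if "x > 0" for x using that by (intro phi_plus1) auto
    show ?case
    proof (cases "C = 0")
      case True
      from phi_bound[OF e zero_less_one] obtain K where K: "K > 0" "\<And>x. phi 1 x \<le> K * exp (-(pi - e) * \<bar>x\<bar>)" by blast
      have "\<forall>x>0. x\<^sup>2 * phi C x \<le> K * exp (-(pi - e) * x)"
        using p K(2) True by (metis abs_of_pos add_0 power_zero_numeral)
      thus ?thesis using K(1) unfolding C_def by blast
    next
      case False
      from Suc.IH obtain K where K: "K > 0" "\<And>x. x > 0 \<Longrightarrow> x\<^sup>2 * phi (C+1) x \<le> K * exp (-(pi - e) * x)"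
        unfolding C1 by blast
      have "x\<^sup>2 * phi C x \<le> (K / C\<^sup>2) * exp (-(pi - e) * x)" if x: "x > 0" for x
      proof -
        have "C\<^sup>2 * (x\<^sup>2 * phi C x) \<le> (C\<^sup>2 + x\<^sup>2) * (x\<^sup>2 * phi C x)" by (intro mult_right_mono) auto
        also have "\<dots> = x\<^sup>2 * phi (C+1) x" using p[OF x] by simp
        also have "\<dots> \<le> K * exp (-(pi - e) * x)" using K(2)[OF x] .
        finally show ?thesis using False by (simp add: field_simps)
      qed
      moreover have "K / C\<^sup>2 > 0" using K(1) False by simp
      ultimately show ?thesis unfolding C_def by blast
    qed
  qed
  \<comment> \<open>This integer shift moves a nonpositive C into (0,1].\<close>
  note aux = this[of "C + real (nat \<lfloor>1 - C\<rfloor>) " "nat \<lfloor>1 - C\<rfloor>"]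
  show ?thesis
  proof (cases "C > 0")
    case False
    have "C + real (nat \<lfloor>1 - C\<rfloor>) > 0" "C + real (nat \<lfloor>1 - C\<rfloor>) \<le> 1"
      using False by linarith+
    from aux[OF this] show ?thesis by simp
  qed (use pos in auto)
qed

lemma Complex_measurable [measurable]: "(\<lambda>x. Complex A x) \<in> borel_measurable borel"
  by (intro borel_measurable_continuous_onI) (simp add: Complex_eq continuous_intros)

text \<open>The reciprocal of Gamma is entire, hence measurable by continuity, and inverting it also
  reproduces the value 0 at the poles.\<close>

lemma phi_measurable [measurable]: "phi A \<in> borel_measurable borel"
proof -
  have "(\<lambda>x. rGamma (Complex A x)) \<in> borel_measurable borel"
    by (intro borel_measurable_continuous_onI) (auto simp: Complex_eq intro!: continuous_intros continuous_on_compose2[OF continuous_on_rGamma[of UNIV]])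
  hence "(\<lambda>x. (cmod (inverse (rGamma (Complex A x))))\<^sup>2) \<in> borel_measurable borel" by simp
  thus ?thesis by (simp add: phi_def[abs_def] Gamma_def)
qed

text \<open>This is 1 / (2 pi |Gamma(2ix)|^2) in elementary form.\<close>

definition w0 :: "real \<Rightarrow> real" where "w0 x = x * sinh (2 * pi * x) / pi\<^sup>2"

lemma w0_measurable [measurable]: "w0 \<in> borel_measurable borel"
  unfolding w0_def[abs_def] sinh_def by (simp add: scaleR_conv_of_real)

lemma w0_nonneg: "x \<ge> 0 \<Longrightarrow> w0 x \<ge> 0"
  by (simp add: w0_def)

lemma w0_pos: "x > 0 \<Longrightarrow> w0 x > 0"
  by (simp add: w0_def)

text \<open>The bound keeps the double zero at 0, which absorbs the possible singularity in
  \<open>phi_bound_singular\<close>.\<close>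

lemma w0_bound: "x \<ge> 0 \<Longrightarrow> w0 x \<le> x\<^sup>2 * exp (2 * pi * x)"
proof -
  assume x: "x \<ge> 0"
  have "1 - exp (-(4 * pi * x)) \<le> 4 * pi * x" using exp_ge_add_one_self[of "-(4 * pi * x)"] by linarith
  hence "exp (2 * pi * x) * (1 - exp (-(4 * pi * x))) \<le> exp (2 * pi * x) * (4 * pi * x)"
    by (intro mult_left_mono) auto
  also have "exp (2 * pi * x) * (1 - exp (-(4 * pi * x))) = 2 * sinh (2 * pi * x)"
    by (simp add: sinh_def right_diff_distrib exp_add[symmetric])
  finally have "sinh (2 * pi * x) \<le> exp (2 * pi * x) * (2 * pi * x)" by (simp add: mult_ac)
  hence "w0 x \<le> x * (exp (2 * pi * x) * (2 * pi * x)) / pi\<^sup>2"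
    unfolding w0_def using x by (intro divide_right_mono mult_left_mono) auto
  also have "\<dots> = (2 / pi) * (x\<^sup>2 * exp (2 * pi * x))" by (simp add: power2_eq_square field_simps)
  also have "\<dots> \<le> 1 * (x\<^sup>2 * exp (2 * pi * x))"
    using pi_ge_two by (intro mult_right_mono) auto
  finally show ?thesis by simp
qed

section \<open>The contour shift\<close>

lemma set_integrable_exp_decay:
  fixes f :: "real \<Rightarrow> real"
  assumes [measurable]: "f \<in> borel_measurable borel" and l: "l > 0"
    and b: "\<And>x. x > 0 \<Longrightarrow> \<bar>f x\<bar> \<le> K * exp (- l * x)"
  shows "set_integrable lborel {0<..} f"
proof -
  have "(\<lambda>x. exp (- l * x)) absolutely_integrable_on {0..}"
    by (rule nonnegative_absolutely_integrable_1[OF integrable_on_exp_minus_to_infinity]) (use l in auto)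
  hence "set_integrable lborel {0..} (\<lambda>x. exp (- l * x))"
    unfolding set_integrable_def by (subst (asm) integrable_completion) auto
  hence "set_integrable lborel {0<..} (\<lambda>x. exp (- l * x))"
    by (rule set_integrable_subset) auto
  hence "set_integrable lborel {0<..} (\<lambda>x. K * exp (- l * x))"
    by (rule set_integrable_mult_right)
  thus ?thesis
    by (rule set_integrable_bound) (auto simp: set_borel_measurable_def intro!: order_trans[OF b[simplified] abs_ge_self])
qed

text \<open>The last argument is the distinguished parameter: it is the one allowed to be
  nonpositive, and then it produces the atoms.\<close>

definition om :: "real \<Rightarrow> real \<Rightarrow> real \<Rightarrow> real \<Rightarrow> real" where
  "om B D C x = w0 x * phi B x * phi D x * phi C x"

lemma om_measurable [measurable]: "om B D C \<in> borel_measurable borel"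
  unfolding om_def[abs_def] by measurable

lemma om_nonneg: "x \<ge> 0 \<Longrightarrow> om B D C x \<ge> 0"
  by (simp add: om_def w0_nonneg)

lemma om_pos: "x > 0 \<Longrightarrow> om B D C x > 0"
  by (simp add: om_def w0_pos phi_pos)

lemma om_bound:
  assumes "B > 0" "D > 0"
  obtains K where "K > 0" "\<And>x. x > 0 \<Longrightarrow> om B D C x \<le> K * exp (- 2 * x)"
proof -
  \<comment> \<open>Three factors, each losing 1/3, against the growth 2 pi of \<open>w0\<close>
    leave the rate 3 (pi - 1/3) - 2 pi = pi - 1 > 2. The rate 2 leaves room for a multiplier growing
    like exp x.\<close>
  have e: "(1/3::real) > 0" by simp
  obtain K1 where K1: "K1 > 0" "\<And>x. phi B x \<le> K1 * exp (-(pi - 1/3) * \<bar>x\<bar>)" using phi_bound[OF e assms(1)] by blast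
  obtain K2 where K2: "K2 > 0" "\<And>x. phi D x \<le> K2 * exp (-(pi - 1/3) * \<bar>x\<bar>)" using phi_bound[OF e assms(2)] by blast
  obtain K3 where K3: "K3 > 0" "\<And>x. x > 0 \<Longrightarrow> x\<^sup>2 * phi C x \<le> K3 * exp (-(pi - 1/3) * x)" using phi_bound_singular[OF e] by blast
  have "om B D C x \<le> (K1 * K2 * K3) * exp (- 2 * x)" if x: "x > 0" for x
  proof -
    define E where "E = exp (-(pi - 1/3) * x)"
    have E: "E > 0" by (simp add: E_def)
    have "om B D C x \<le> (x\<^sup>2 * exp (2 * pi * x)) * (phi B x * phi D x * phi C x)"
      unfolding om_def mult.assoc using w0_bound[of x] x
      by (subst mult.assoc[symmetric], subst mult.assoc[symmetric]) (intro mult_right_mono, auto)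
    also have "\<dots> = exp (2 * pi * x) * (phi B x * (phi D x * (x\<^sup>2 * phi C x)))" by (simp add: mult_ac)
    also have "\<dots> \<le> exp (2 * pi * x) * ((K1 * E) * ((K2 * E) * (K3 * E)))"
    proof -
      have "phi B x \<le> K1 * E" "phi D x \<le> K2 * E" "x\<^sup>2 * phi C x \<le> K3 * E"
        using K1(2)[of x] K2(2)[of x] K3(2)[of x] x by (simp_all add: E_def)
      thus ?thesis using K1(1) K2(1) K3(1) E
        by (intro mult_left_mono[OF mult_mono[OF _ mult_mono]] mult_nonneg_nonneg) (simp_all add: less_imp_le)
    qed
    also have "\<dots> = (K1 * K2 * K3) * (exp (2 * pi * x) * E * E * E)" by (simp only: mult_ac)
    also have "exp (2 * pi * x) * E * E * E = exp (- (pi - 1) * x)"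
      unfolding E_def by (simp add: exp_add[symmetric] algebra_simps)
    also have "(K1 * K2 * K3) * exp (- (pi - 1) * x) \<le> (K1 * K2 * K3) * exp (- 2 * x)"
    proof -
      have "- (pi - 1) * x \<le> - 2 * x" by (rule mult_right_mono) (use pi_gt3 x in auto)
      thus ?thesis using K1(1) K2(1) K3(1) by (intro mult_left_mono) auto
    qed
    finally show ?thesis .
  qed
  moreover have "K1 * K2 * K3 > 0" using K1 K2 K3 by simp
  ultimately show ?thesis using that by blast
qed

lemma om_integrable:
  assumes "B > 0" "D > 0" and [measurable]: "g \<in> borel_measurable borel"
    and g: "\<And>x. x > 0 \<Longrightarrow> \<bar>g x\<bar> \<le> M * exp x"
  shows "set_integrable lborel {0<..} (\<lambda>x. g x * om B D C x)"
proof -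
  obtain K where K: "K > 0" "\<And>x. x > 0 \<Longrightarrow> om B D C x \<le> K * exp (- 2 * x)" using om_bound[OF assms(1,2)] by blast
  show ?thesis
  proof (rule set_integrable_exp_decay[of _ 1 "M * K"])
    fix x :: real assume x: "x > 0"
    have M: "M * exp x \<ge> 0" using g[OF x] by linarith
    have "\<bar>g x * om B D C x\<bar> = \<bar>g x\<bar> * om B D C x" using om_nonneg[of x B D C] x by (simp add: abs_mult)
    also have "\<dots> \<le> (M * exp x) * (K * exp (- 2 * x))"
      using g[OF x] K(2)[OF x] om_nonneg[of x B D C] x M by (intro mult_mono) auto
    also have "\<dots> = M * K * exp (- 1 * x)" by (simp add: exp_add[symmetric])
    finally show "\<bar>g x * om B D C x\<bar> \<le> M * K * exp (- 1 * x)" .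
  qed auto
qed

lemma sq_le_exp: "x \<ge> 0 \<Longrightarrow> x\<^sup>2 \<le> 2 * exp (x::real)"
  using exp_lower_Taylor_quadratic[of x] by linarith

lemma om_integrable_quadratic:
  assumes "A > 0" "B > 0" "D > 0"
  shows "set_integrable lborel {0<..} (\<lambda>x. (p + q * x\<^sup>2) * phi A x * om B D C x)"
proof (rule om_integrable[of _ _ _ "(\<bar>p\<bar> + 2 * \<bar>q\<bar>) * (Gamma A)\<^sup>2"])
  fix x :: real assume x: "x > 0"
  have 1: "exp x \<ge> 1" using x by simp
  have "\<bar>p + q * x\<^sup>2\<bar> \<le> \<bar>p\<bar> * 1 + \<bar>q\<bar> * x\<^sup>2"
    using abs_triangle_ineq[of p "q * x\<^sup>2"] by (simp add: abs_mult)
  also have "\<dots> \<le> \<bar>p\<bar> * exp x + \<bar>q\<bar> * (2 * exp x)"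
    by (intro add_mono mult_left_mono sq_le_exp 1) (use x in auto)
  finally have 2: "\<bar>p + q * x\<^sup>2\<bar> \<le> (\<bar>p\<bar> + 2 * \<bar>q\<bar>) * exp x" by (simp add: algebra_simps)
  have "\<bar>(p + q * x\<^sup>2) * phi A x\<bar> = \<bar>p + q * x\<^sup>2\<bar> * phi A x" by (simp add: abs_mult)
  also have "\<dots> \<le> ((\<bar>p\<bar> + 2 * \<bar>q\<bar>) * exp x) * (Gamma A)\<^sup>2"
    by (intro mult_mono 2 phi_le assms) auto
  finally show "\<bar>(p + q * x\<^sup>2) * phi A x\<bar> \<le> (\<bar>p\<bar> + 2 * \<bar>q\<bar>) * (Gamma A)\<^sup>2 * exp x" by (simp add: mult_ac)
qed (use assms in auto)

lemma om_integrable_phi: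
  assumes "A > 0" "B > 0" "D > 0"
  shows "set_integrable lborel {0<..} (\<lambda>x. phi A x * om B D C x)"
  using om_integrable_quadratic[OF assms, of 1 0 C] by (simp only: mult_zero_left add_0_right mult_1)

lemma om_integrable_const:
  assumes "B > 0" "D > 0"
  shows "set_integrable lborel {0<..} (om B D C)"
proof -
  have "set_integrable lborel {0<..} (\<lambda>x. 1 * om B D C x)"
    by (rule om_integrable[of _ _ _ 1]) (use assms in auto)
  thus ?thesis by simp
qed

lemma half_line_dominated_convergence:
  fixes f w :: "real \<Rightarrow> real" and u :: "nat \<Rightarrow> real \<Rightarrow> real"
  assumes [measurable]: "f \<in> borel_measurable borel" "\<And>n. u n \<in> borel_measurable borel"
    and w: "set_integrable lborel {0<..} w"
    and lim: "\<And>x. x > 0 \<Longrightarrow> (\<lambda>n. u n x) \<longlonglongrightarrow> f x"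
    and bd: "\<And>n x. x > 0 \<Longrightarrow> \<bar>u n x\<bar> \<le> w x"
  shows "(\<lambda>n. LINT x:{0<..}|lborel. u n x) \<longlonglongrightarrow> (LINT x:{0<..}|lborel. f x)"
  unfolding set_lebesgue_integral_def
proof (rule integral_dominated_convergence)
  show "integrable lborel (\<lambda>x. indicator {0<..} x *\<^sub>R w x)" using w unfolding set_integrable_def .
qed (auto intro!: AE_I2 simp: indicator_def lim bd)

text \<open>The partner of Gamma(A+u) is Gamma(A+1-u) rather than Gamma(A-u): the product is then
  invariant under u -> 1-u, hence even in y on Re u = 1/2, at the cost of a factor A - iy on the
  imaginary axis.\<close>

definition strip_gamma :: "real \<Rightarrow> complex \<Rightarrow> complex" where
  "strip_gamma A u = Gamma (of_real A + u) * Gamma (of_real (A + 1) - u)"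

lemma strip_gamma_imag: "A > 0 \<Longrightarrow> strip_gamma A (Complex 0 y) = of_real (phi A y) * (Complex A (-y))"
proof -
  assume A: "A > 0"
  have "of_real A + Complex 0 y = Complex A y" by (simp add: complex_eq_iff)
  moreover have "of_real (A+1) - Complex 0 y = Complex A (-y) + 1" by (simp add: complex_eq_iff)
  moreover have "Gamma (Complex A (-y) + 1) = Complex A (-y) * Gamma (Complex A (-y))"
    using A pos_notin_nonpos_Ints[of A] by (intro Gamma_plus1) (auto simp: Complex_nonpos_Ints_iff)
  moreover have "Gamma (Complex A (-y)) = cnj (Gamma (Complex A y))"
    by (simp add: cnj_Gamma complex_cnj)
  ultimately have "strip_gamma A (Complex 0 y) = Gamma (Complex A y) * (Complex A (-y) * cnj (Gamma (Complex A y)))"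
    unfolding strip_gamma_def by (simp only:)
  also have "\<dots> = (Gamma (Complex A y) * cnj (Gamma (Complex A y))) * Complex A (-y)" by (simp only: mult_ac)
  also have "Gamma (Complex A y) * cnj (Gamma (Complex A y)) = of_real (phi A y)"
    unfolding phi_def complex_norm_square ..
  finally show ?thesis .
qed

lemma strip_gamma_half: "strip_gamma A (Complex (1/2) (-y)) = strip_gamma A (Complex (1/2) y)"
proof -
  have "of_real A + Complex (1/2) (-y) = of_real (A+1) - Complex (1/2) y"
       "of_real A + Complex (1/2) y = of_real (A+1) - Complex (1/2) (-y)"
    by (simp_all add: complex_eq_iff)
  thus ?thesis unfolding strip_gamma_def by (simp only: mult.commute)
qed

text \<open>On Re u = s the squared modulus is \<open>phi (A+s) y * phi (A+1-s) y\<close>, and both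
  parameters stay in [m, M+1].\<close>

lemma strip_gamma_bound:
  assumes "m > 0"
  obtains K where "K > 0"
    "\<And>A s y. A \<in> {m..M} \<Longrightarrow> s \<in> {0..1/2} \<Longrightarrow> cmod (strip_gamma A (Complex s y)) \<le> K * exp (-(pi - 1/4) * \<bar>y\<bar>)"
proof -
  have e: "(1/4::real) > 0" by simp
  obtain K0 where K0: "\<And>t x. t \<in> {m..M+1} \<Longrightarrow> phi t x \<le> K0 * exp (-(pi - 1/4) * \<bar>x\<bar>)"
    using phi_bound_uniform[OF e assms, of "M+1"] by blast
  define K where "K = max 1 K0"
  have K: "phi t x \<le> K * exp (-(pi - 1/4) * \<bar>x\<bar>)" if "t \<in> {m..M+1}" for t x
    by (rule order_trans[OF K0[OF that] mult_right_mono]) (auto simp: K_def)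
  have "cmod (strip_gamma A (Complex s y)) \<le> K * exp (-(pi - 1/4) * \<bar>y\<bar>)"
    if A: "A \<in> {m..M}" and s: "s \<in> {0..1/2}" for A s y
  proof -
    let ?E = "K * exp (-(pi - 1/4) * \<bar>y\<bar>)"
    have "of_real A + Complex s y = Complex (A+s) y"
         "of_real (A+1) - Complex s y = Complex (A+1-s) (-y)" by (simp_all add: complex_eq_iff)
    hence "(cmod (strip_gamma A (Complex s y)))\<^sup>2 = phi (A+s) y * phi (A+1-s) y"
      unfolding strip_gamma_def by (simp add: norm_mult power_mult_distrib phi_minus flip: phi_def)
    also have "\<dots> \<le> ?E * ?E"
      using A s by (intro mult_mono K) (auto simp: K_def)
    finally show ?thesis by (simp flip: power2_eq_square add: power2_le_iff_abs_le K_def)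
  qed
  thus ?thesis using that[of K] by (auto simp: K_def)
qed

lemma strip_gamma_holomorphic [holomorphic_intros]:
  assumes "\<And>u. u \<in> S \<Longrightarrow> - A < Re u \<and> Re u < A + 1"
  shows "strip_gamma A holomorphic_on S"
proof -
  have "of_real A + u \<notin> \<int>\<^sub>\<le>\<^sub>0" "of_real (A+1) - u \<notin> \<int>\<^sub>\<le>\<^sub>0" if "u \<in> S" for u
    using assms[OF that] by (auto elim!: nonpos_Ints_cases simp: complex_eq_iff)
  thus ?thesis unfolding strip_gamma_def[abs_def] by (intro holomorphic_intros) auto
qed

lemma cmod_sin_le: "cmod (sin z) \<le> exp \<bar>Im z\<bar>"
proof -
  have "sin z = (exp (\<i> * z) - exp (-(\<i> * z))) / (2 * \<i>)" by (simp add: sin_exp_eq)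
  hence "cmod (sin z) = cmod (exp (\<i> * z) - exp (-(\<i> * z))) / 2" by (simp add: norm_divide norm_mult)
  also have "\<dots> \<le> (cmod (exp (\<i> * z)) + cmod (exp (-(\<i> * z)))) / 2"
    by (intro divide_right_mono norm_triangle_ineq4) auto
  also have "\<dots> \<le> exp \<bar>Im z\<bar>"
    by (simp add: norm_exp_eq_Re) (smt (verit) exp_le_cancel_iff)
  finally show ?thesis .
qed

text \<open>The product of four \<open>strip_gamma\<close> factors with sin(2 pi u) changes sign
  under u -> 1-u, so its integral over Re u = 1/2 vanishes, and with it the one over the imaginary
  axis. There the linear factors of \<open>strip_gamma_imag\<close> remain; symmetrising in y leaves
  e3 - e1 y^2 times the weight.\<close>

lemma four_Gamma_contour_shift:
  assumes pos: "A > 0" "B > 0" "C > 0" "D > 0"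
  defines "e1 \<equiv> A + B + C + D" and "e3 \<equiv> A*B*C + A*B*D + A*C*D + B*C*D"
  shows "(LINT x:{0<..}|lborel. (e3 - e1 * x\<^sup>2) * phi A x * om B D C x) = 0"
proof -
  define G where "G u = strip_gamma A u * strip_gamma B u * strip_gamma C u * strip_gamma D u * sin (2 * of_real pi * u)" for u
  define m where "m = min (min A B) (min C D)"
  \<comment> \<open>The strip avoids all poles: those of Gamma(A+u) have Re u <= -A, those of
    Gamma(A+1-u) have Re u >= A+1, and likewise for the other parameters.\<close>
  define S where "S = {u. - m < Re u} \<inter> {u. Re u < 1}"
  have m: "m > 0" "m \<le> A" "m \<le> B" "m \<le> C" "m \<le> D" using pos by (auto simp: m_def)
  have holG: "G holomorphic_on S"
    unfolding G_def[abs_def] by (intro holomorphic_intros) (use m in \<open>auto simp: S_def\<close>)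
  have openS: "open S" unfolding S_def by (intro open_Int open_halfspace_Re_gt open_halfspace_Re_lt)
  have "convex S" unfolding S_def by (intro convex_Int convex_halfspace_Re_gt convex_halfspace_Re_lt)
  \<comment> \<open>A primitive \<open>F\<close> on the strip replaces contour integrals: the
    integral from -iy to iy is F(iy) - F(-iy).\<close>
  from holomorphic_convex_primitive'[OF this openS holG] obtain F where
    "\<And>u. u \<in> S \<Longrightarrow> (F has_field_derivative G u) (at u within S)" by blast
  hence F: "(F has_field_derivative G u) (at u)" if "u \<in> S" for u
    using that openS by (metis at_within_open)
  have inS: "Complex s y \<in> S" if "s \<in> {0..1/2}" for s y using that m by (auto simp: S_def)
  have Fv: "((\<lambda>y. F (Complex s (c * y))) has_vector_derivative (of_real c * \<i> * G (Complex s (c * y)))) (at y)"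
    if "s \<in> {0..1/2}" for s y c
  proof -
    have "((\<lambda>y. of_real s + \<i> * of_real (c * y)) has_vector_derivative (\<i> * of_real c)) (at y)"
      by (auto intro!: derivative_eq_intros has_vector_derivative_real_field)
    from field_vector_diff_chain_at[OF this F] that inS[OF that, of "c * y"]
    show ?thesis by (simp add: o_def Complex_eq mult_ac)
  qed
  \<comment> \<open>The rate is 4 (pi - 1/4) - 2 pi = 2 pi - 1, where 2 pi is the growth of the
    sine.\<close>
  have bound: "\<exists>K>0. \<forall>s\<in>{0..1/2}. \<forall>y. cmod (G (Complex s y)) \<le> K * exp (- 3 * \<bar>y\<bar>)"
  proof -
    obtain L where L: "L > 0" "\<And>T s y. T \<in> {m..max (max A B) (max C D)} \<Longrightarrow> s \<in> {0..1/2} \<Longrightarrow>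
        cmod (strip_gamma T (Complex s y)) \<le> L * exp (-(pi - 1/4) * \<bar>y\<bar>)"
      using strip_gamma_bound[OF m(1)] by blast
    have "cmod (G (Complex s y)) \<le> L ^ 4 * exp (- 3 * \<bar>y\<bar>)" if s: "s \<in> {0..1/2}" for s y
    proof -
      define E where "E = exp (-(pi - 1/4) * \<bar>y\<bar>)"
      have E: "E > 0" by (simp add: E_def)
      have n: "cmod (strip_gamma A (Complex s y)) \<le> L * E" "cmod (strip_gamma B (Complex s y)) \<le> L * E"
         "cmod (strip_gamma C (Complex s y)) \<le> L * E" "cmod (strip_gamma D (Complex s y)) \<le> L * E"
        unfolding E_def by (intro L s; use m in simp)+
      have "cmod (sin (2 * of_real pi * Complex s y)) \<le> exp (2 * pi * \<bar>y\<bar>)"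
        using cmod_sin_le[of "2 * of_real pi * Complex s y"] by (simp add: abs_mult)
      hence "cmod (G (Complex s y)) \<le> (L * E) * (L * E) * (L * E) * (L * E) * exp (2 * pi * \<bar>y\<bar>)"
        unfolding G_def norm_mult using L(1) n E
        by (intro mult_mono mult_nonneg_nonneg) (simp_all add: less_imp_le)
      also have "\<dots> = L ^ 4 * (E * E * E * E * exp (2 * pi * \<bar>y\<bar>))"
        by (simp add: eval_nat_numeral mult_ac)
      also have "E * E * E * E * exp (2 * pi * \<bar>y\<bar>) = exp (- (2 * pi - 1) * \<bar>y\<bar>)"
        unfolding E_def by (simp add: exp_add[symmetric] algebra_simps)
      also have "L ^ 4 * exp (- (2 * pi - 1) * \<bar>y\<bar>) \<le> L ^ 4 * exp (- 3 * \<bar>y\<bar>)"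
      proof -
        have "- (2 * pi - 1) * \<bar>y\<bar> \<le> - 3 * \<bar>y\<bar>" by (rule mult_right_mono) (use pi_gt3 in auto)
        thus ?thesis using L(1) by (intro mult_left_mono) auto
      qed
      finally show ?thesis .
    qed
    moreover have "L ^ 4 > 0" using L by simp
    ultimately show ?thesis by blast
  qed
  then obtain K where K: "K > 0" "\<And>s y. s \<in> {0..1/2} \<Longrightarrow> cmod (G (Complex s y)) \<le> K * exp (- 3 * \<bar>y\<bar>)" by blast
  have horiz: "cmod (F (Complex (1/2) y) - F (Complex 0 y)) \<le> K * exp (- 3 * \<bar>y\<bar>)" for y
  proof -
    have "cmod (F (Complex (1/2) y) - F (Complex 0 y)) \<le> (K * exp (- 3 * \<bar>y\<bar>)) * cmod (Complex (1/2) y - Complex 0 y)"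
    proof (rule field_differentiable_bound[of "{u. Re u \<in> {0..1/2} \<and> Im u = y}" F G])
      have "{u. Re u \<in> {0..1/2} \<and> Im u = y} = {u. Re u \<ge> 0} \<inter> {u. Re u \<le> 1/2} \<inter> {u. Im u = y}" by auto
      also have "convex \<dots>"
        by (intro convex_Int convex_halfspace_Re_ge convex_halfspace_Re_le) (auto simp: convex_alt algebra_simps)
      finally show "convex {u. Re u \<in> {0..1/2} \<and> Im u = y}" .
    next
      fix z assume z: "z \<in> {u. Re u \<in> {0..1/2} \<and> Im u = y}"
      hence "z = Complex (Re z) y" by (simp add: complex_eq_iff)
      moreover have "Re z \<in> {0..1/2}" using z by simp
      ultimately show "(F has_field_derivative G z) (at z within {u. Re u \<in> {0..1/2} \<and> Im u = y})" "cmod (G z) \<le> K * exp (- 3 * \<bar>y\<bar>)"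
        using F[OF inS] K(2) by (metis has_field_derivative_at_within)+
    qed auto
    also have "cmod (Complex (1/2) y - Complex 0 y) = 1/2" by (simp add: cmod_def)
    finally have "cmod (F (Complex (1/2) y) - F (Complex 0 y)) \<le> (K * exp (- 3 * \<bar>y\<bar>)) * (1/2)" .
    moreover have "K * exp (- 3 * \<bar>y\<bar>) > 0" using K(1) by simp
    ultimately show ?thesis by linarith
  qed
  have half: "F (Complex (1/2) y) = F (Complex (1/2) (-y))" for y
  proof -
    have odd: "G (Complex (1/2) (-y)) = - G (Complex (1/2) y)" for y
    proof -
      have "2 * of_real pi * Complex (1/2) (-y) = - (2 * of_real pi * Complex (1/2) y) + of_real (2 * pi)"
        by (simp add: complex_eq_iff)
      hence "sin (2 * of_real pi * Complex (1/2) (-y)) = - sin (2 * of_real pi * Complex (1/2) y)"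
        by (simp only: sin_add sin_of_real cos_of_real sin_minus cos_two_pi sin_two_pi) simp
      thus ?thesis unfolding G_def strip_gamma_half by simp
    qed
    have h: "(1/2::real) \<in> {0..1/2}" by simp
    have "((\<lambda>y. F (Complex (1/2) y) - F (Complex (1/2) (-y))) has_vector_derivative 0) (at y)" for y
      using has_vector_derivative_diff[OF Fv[OF h, of 1 y] Fv[OF h, of "-1" y]] odd[of y] by simp
    hence "F (Complex (1/2) y) - F (Complex (1/2) (-y)) = F (Complex (1/2) 0) - F (Complex (1/2) (-0))"
      using has_derivative_zero_unique[of UNIV "\<lambda>y. F (Complex (1/2) y) - F (Complex (1/2) (-y))" y 0]
      by (auto simp: has_vector_derivative_def)
    thus ?thesis by simp
  qed
  \<comment> \<open>The symmetrised derivative is purely imaginary, so the imaginary part loses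
    nothing. \<open>T\<close> is 0 at 0, and it tends to 0 at infinity because \<open>F\<close> is
    even on Re u = 1/2 and the horizontal segments contribute exponentially little.\<close>
  define T where "T y = Im (F (Complex 0 y) - F (Complex 0 (-y)))" for y
  have Gre: "\<i> * G (Complex 0 y) + \<i> * G (Complex 0 (-y)) = of_real (2 * pi\<^sup>2 * ((e3 - e1 * y\<^sup>2) * phi A y * om B D C y)) * \<i>" for y
  proof -
    have s: "sin (2 * of_real pi * Complex 0 y) = of_real (sinh (2 * pi * y)) * \<i>" for y
    proof -
      have "2 * of_real pi * Complex 0 y = \<i> * of_real (2 * pi * y)" by (simp add: complex_eq_iff)
      thus ?thesis
        using sinh_conv_sin[of "of_real (2 * pi * y)"]
        by (simp add: sinh_def scaleR_conv_of_real exp_of_real flip: of_real_mult of_real_minus) 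
           (simp add: field_simps)
    qed
    have alg: "Complex A (-y) * Complex B (-y) * Complex C (-y) * Complex D (-y) * \<i> - Complex A y * Complex B y * Complex C y * Complex D y * \<i>
       = of_real (2 * y * (e3 - e1 * y\<^sup>2))"
      unfolding e1_def e3_def by (simp add: complex_eq_iff algebra_simps power2_eq_square)
    have sm: "sinh (2 * pi * - y) = - sinh (2 * pi * y)" by simp
    have "G (Complex 0 y) + G (Complex 0 (-y)) = of_real (phi A y * phi B y * phi C y * phi D y * sinh (2 * pi * y)) *
       (Complex A (-y) * Complex B (-y) * Complex C (-y) * Complex D (-y) * \<i> - Complex A y * Complex B y * Complex C y * Complex D y * \<i>)"
      unfolding G_def strip_gamma_imag[OF pos(1)] strip_gamma_imag[OF pos(2)] strip_gamma_imag[OF pos(3)] strip_gamma_imag[OF pos(4)] s phi_minus sm minus_minus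
      by (simp only: of_real_mult of_real_minus ring_distribs mult_minus_left mult_minus_right diff_conv_add_uminus mult_ac)
    also have "\<dots> = of_real (2 * pi\<^sup>2 * ((e3 - e1 * y\<^sup>2) * phi A y * om B D C y))"
      unfolding alg of_real_mult[symmetric] om_def w0_def by (simp add: mult_ac)
    finally have "G (Complex 0 y) + G (Complex 0 (-y)) = of_real (2 * pi\<^sup>2 * ((e3 - e1 * y\<^sup>2) * phi A y * om B D C y))" .
    thus ?thesis by (metis distrib_left mult.commute)
  qed
  have T': "(T has_vector_derivative (2 * pi\<^sup>2 * ((e3 - e1 * y\<^sup>2) * phi A y * om B D C y))) (at y)" for y
  proof -
    have h: "(0::real) \<in> {0..1/2}" by simp
    have "((\<lambda>y. F (Complex 0 y) - F (Complex 0 (-y))) has_vector_derivative (\<i> * G (Complex 0 y) + \<i> * G (Complex 0 (-y)))) (at y)"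
      using has_vector_derivative_diff[OF Fv[OF h, of 1 y] Fv[OF h, of "-1" y]] by simp
    from bounded_linear.has_vector_derivative[OF bounded_linear_Im this]
    show ?thesis unfolding Gre T_def[abs_def] by simp
  qed
  have lim: "(T \<longlongrightarrow> 0) at_top"
  proof (rule Lim_null_comparison)
    have "norm (T y) \<le> 2 * K * exp (- 3 * \<bar>y\<bar>)" for y
    proof -
      have "norm (T y) \<le> cmod (F (Complex 0 y) - F (Complex 0 (-y)))" unfolding T_def real_norm_def by (rule abs_Im_le_cmod)
      also have "F (Complex 0 y) - F (Complex 0 (-y)) = (F (Complex (1/2) (-y)) - F (Complex 0 (-y))) - (F (Complex (1/2) y) - F (Complex 0 y))"
        using half[of y] by simp
      also have "cmod \<dots> \<le> K * exp (- 3 * \<bar>-y\<bar>) + K * exp (- 3 * \<bar>y\<bar>)"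
        by (intro order_trans[OF norm_triangle_ineq4] add_mono horiz)
      finally show ?thesis by simp
    qed
    thus "\<forall>\<^sub>F y in at_top. norm (T y) \<le> 2 * K * exp (- 3 * \<bar>y\<bar>)" by simp
    show "((\<lambda>y. 2 * K * exp (- 3 * \<bar>y\<bar>)) \<longlongrightarrow> 0) at_top" by real_asymp
  qed
  have cont: "isCont (\<lambda>y. 2 * pi\<^sup>2 * ((e3 - e1 * y\<^sup>2) * phi A y * om B D C y)) y" for y
  proof -
    have "(2 * pi\<^sup>2 * ((e3 - e1 * y\<^sup>2) * phi A y * om B D C y)) = Re (G (Complex 0 y) + G (Complex 0 (-y)))" for y
      using arg_cong[OF Gre[of y], of Im] by simp
    moreover have "isCont (\<lambda>y. Re (G (Complex 0 y) + G (Complex 0 (-y)))) y"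
    proof -
      have c: "isCont (\<lambda>y. G (Complex 0 (c * y))) y" for c
      proof (rule isCont_o2[of y "\<lambda>y. Complex 0 (c * y)" G])
        show "isCont (\<lambda>y. Complex 0 (c * y)) y" by (simp add: Complex_eq continuous_intros)
        show "isCont G (Complex 0 (c * y))"
          using holomorphic_on_imp_continuous_on[OF holG] openS inS[of 0 "c * y"]
          by (simp add: continuous_on_eq_continuous_at)
      qed
      show ?thesis using c[of 1] c[of "-1"] by (auto intro!: continuous_intros)
    qed
    ultimately show ?thesis by simp
  qed
  have int: "set_integrable lborel {0<..} (\<lambda>x. 2 * pi\<^sup>2 * ((e3 - e1 * x\<^sup>2) * phi A x * om B D C x))"
    using om_integrable_quadratic[OF pos(1,2,4), of e3 "-e1" C] by (intro set_integrable_mult_right) simp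
  have "(LBINT x=0..\<infinity>. 2 * pi\<^sup>2 * ((e3 - e1 * x\<^sup>2) * phi A x * om B D C x)) = 0 - 0"
  proof (rule interval_integral_FTC_integrable[where F = T])
    have "einterval 0 \<infinity> = {0<..}" by (auto simp: einterval_def zero_ereal_def)
    thus "set_integrable lborel (einterval 0 \<infinity>) (\<lambda>x. 2 * pi\<^sup>2 * ((e3 - e1 * x\<^sup>2) * phi A x * om B D C x))" using int by simp
    have "isCont T 0" using T'[of 0] has_vector_derivative_continuous by blast
    hence "(T \<longlongrightarrow> T 0) (at_right 0)" by (simp add: continuous_at_imp_continuous_at_within continuous_within isCont_def filterlim_at_split)
    moreover have "T 0 = 0" by (simp add: T_def)
    ultimately show "((T \<circ> real_of_ereal) \<longlongrightarrow> 0) (at_right 0)" unfolding zero_ereal_def ereal_tendsto_simps by simp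
    show "((T \<circ> real_of_ereal) \<longlongrightarrow> 0) (at_left \<infinity>)" unfolding ereal_tendsto_simps using lim .
  qed (use T' cont in auto)
  thus ?thesis by (simp add: interval_lebesgue_integral_0_infty)
qed

section \<open>The integrals with three and four parameters\<close>

definition atomset :: "real \<Rightarrow> nat set" where
  "atomset C = {k. C + real k < 0}"

text \<open>The value of \<open>\<Gamma>(A+ix) \<Gamma>(A-ix)\<close> at \<open>x = i(C+k)\<close>, the position of the atom with index \<open>k\<close>.\<close>

definition psi :: "real \<Rightarrow> nat \<Rightarrow> real \<Rightarrow> real" where
  "psi C k A = Gamma (A - (C + real k)) * Gamma (A + (C + real k))"

text \<open>The mass of that atom without the Gamma factors of the other parameters.\<close>

definition atom_factor :: "real \<Rightarrow> nat \<Rightarrow> real" where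
  "atom_factor C k = - 2 * (C + real k) / (fact k * Gamma (1 - 2 * C - real k))"

definition mass4 :: "real \<Rightarrow> real \<Rightarrow> real \<Rightarrow> real \<Rightarrow> real" where
  "mass4 A B D C = (LINT x:{0<..}|lborel. phi A x * om B D C x)
     + (\<Sum>k\<in>atomset C. atom_factor C k * psi C k A * (psi C k B * psi C k D))"

definition mass3 :: "real \<Rightarrow> real \<Rightarrow> real \<Rightarrow> real" where
  "mass3 B D C = (LINT x:{0<..}|lborel. om B D C x)
     + (\<Sum>k\<in>atomset C. atom_factor C k * (psi C k B * psi C k D))"

text \<open>The right-hand side of the de Branges-Wilson integral.\<close>

definition prod4 :: "real \<Rightarrow> real \<Rightarrow> real \<Rightarrow> real \<Rightarrow> real" where
  "prod4 A B D C = Gamma (A + B) * Gamma (A + D) * Gamma (B + D) * Gamma (A + C) * Gamma (B + C) * Gamma (D + C)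
     / Gamma (A + B + D + C)"

definition prod3 :: "real \<Rightarrow> real \<Rightarrow> real \<Rightarrow> real" where
  "prod3 B D C = Gamma (B + D) * Gamma (B + C) * Gamma (D + C)"

lemma finite_atomset [simp]: "finite (atomset C)"
proof (rule finite_subset)
  show "atomset C \<subseteq> {..nat \<lceil>- C\<rceil>}"
  proof
    fix k assume "k \<in> atomset C"
    hence "real k < - C" by (simp add: atomset_def)
    thus "k \<in> {..nat \<lceil>- C\<rceil>}" by simp linarith
  qed
qed simp

lemma atomset_nonneg [simp]: "C \<ge> 0 \<Longrightarrow> atomset C = {}"
  by (auto simp: atomset_def)

lemma Gamma_real_plus1: "x > 0 \<Longrightarrow> Gamma (x + 1) = x * Gamma (x::real)"
  using pos_notin_nonpos_Ints by (intro Gamma_plus1) auto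

lemma Gamma_real_nz: "x > 0 \<Longrightarrow> Gamma (x::real) \<noteq> 0"
  using Gamma_real_pos[of x] by (simp del: Gamma_real_pos)

text \<open>Sending a parameter to infinity removes its factor from the weight: \<open>phi\<close>
  divided by Gamma^2 is at most 1 and tends to 1, so dominated convergence applies; the finitely
  many atoms converge separately. The limit no longer contains A.\<close>

lemma mass4_limit:
  assumes A: "A > 0" "A + C > 0" and B: "B > 0" "D > 0"
  shows "(\<lambda>n. mass4 (A + real (Suc n)) B D C / (Gamma (A + real (Suc n)))\<^sup>2) \<longlonglongrightarrow> mass3 B D C"
proof -
  let ?a = "\<lambda>n. A + real (Suc n)"
  have apos: "?a n > 0" for n using A by simp
  have Gpos: "(Gamma (?a n))\<^sup>2 > 0" for n using Gamma_real_pos[OF apos[of n]] by (simp del: Gamma_real_pos)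
  have cont: "(\<lambda>n. (LINT x:{0<..}|lborel. phi (?a n) x / (Gamma (?a n))\<^sup>2 * om B D C x)) \<longlonglongrightarrow> (LINT x:{0<..}|lborel. om B D C x)"
  proof (rule half_line_dominated_convergence)
    show "set_integrable lborel {0<..} (om B D C)" by (rule om_integrable_const[OF B])
    fix x :: real assume x: "x > 0"
    have "(\<lambda>n. phi (?a n) x / (Gamma (?a n))\<^sup>2 * om B D C x) \<longlonglongrightarrow> 1 * om B D C x"
      by (intro tendsto_intros phi_ratio_tendsto A)
    thus "(\<lambda>n. phi (?a n) x / (Gamma (?a n))\<^sup>2 * om B D C x) \<longlonglongrightarrow> om B D C x" by simp
    fix n
    have "phi (?a n) x / (Gamma (?a n))\<^sup>2 \<le> 1" using phi_le[OF apos, of n x] Gpos[of n] by simp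
    hence "phi (?a n) x / (Gamma (?a n))\<^sup>2 * om B D C x \<le> 1 * om B D C x"
      using x om_nonneg[of x B D C] by (intro mult_right_mono) auto
    thus "\<bar>phi (?a n) x / (Gamma (?a n))\<^sup>2 * om B D C x\<bar> \<le> om B D C x"
      using x om_nonneg[of x B D C] by (simp add: abs_mult)
  qed measurable
  have atom: "(\<lambda>n. \<Sum>k\<in>atomset C. atom_factor C k * (psi C k (?a n) / (Gamma (?a n))\<^sup>2) * (psi C k B * psi C k D))
     \<longlonglongrightarrow> (\<Sum>k\<in>atomset C. atom_factor C k * 1 * (psi C k B * psi C k D))"
  proof (intro tendsto_intros)
    fix k assume "k \<in> atomset C"
    hence k: "C + real k < 0" by (simp add: atomset_def)
    have "(\<lambda>n. Gamma (A + real (Suc n) + (-(C + real k))) * Gamma (A + real (Suc n) + (C + real k)) /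
              (Gamma (A + real (Suc n)) * Gamma (A + real (Suc n) + 0))) \<longlonglongrightarrow> 1"
      by (intro Gamma_pair_ratio_tendsto pos_notin_nonpos_Ints) (use A k in auto)
    thus "(\<lambda>n. psi C k (?a n) / (Gamma (?a n))\<^sup>2) \<longlonglongrightarrow> 1"
      by (simp only: psi_def power2_eq_square diff_conv_add_uminus add_0_right)
  qed
  have "mass4 (?a n) B D C / (Gamma (?a n))\<^sup>2 =
      (LINT x:{0<..}|lborel. phi (?a n) x / (Gamma (?a n))\<^sup>2 * om B D C x) +
      (\<Sum>k\<in>atomset C. atom_factor C k * (psi C k (?a n) / (Gamma (?a n))\<^sup>2) * (psi C k B * psi C k D))" for n
  proof -
    have "(LINT x:{0<..}|lborel. phi (?a n) x / (Gamma (?a n))\<^sup>2 * om B D C x) =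
          (LINT x:{0<..}|lborel. phi (?a n) x * om B D C x / (Gamma (?a n))\<^sup>2)" by (simp del: of_nat_Suc)
    also have "\<dots> = (LINT x:{0<..}|lborel. phi (?a n) x * om B D C x) / (Gamma (?a n))\<^sup>2"
      by (rule set_integral_divide_zero)
    finally show ?thesis unfolding mass4_def add_divide_distrib sum_divide_distrib by (simp del: of_nat_Suc)
  qed
  thus ?thesis using tendsto_add[OF cont atom] by (simp add: mass3_def del: of_nat_Suc)
qed

lemma prod4_limit:
  assumes A: "A > 0" "A + C > 0" and B: "B > 0" "D > 0" and BC: "B + C > 0" "D + C > 0"
  shows "(\<lambda>n. prod4 (A + real (Suc n)) B D C / (Gamma (A + real (Suc n)))\<^sup>2) \<longlonglongrightarrow> prod3 B D C"
proof -
  let ?a = "\<lambda>n. A + real (Suc n)"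
  have 1: "(\<lambda>n. Gamma (?a n + B) * Gamma (?a n + D) / (Gamma (?a n) * Gamma (?a n + (B + D)))) \<longlonglongrightarrow> 1"
    by (intro Gamma_pair_ratio_tendsto pos_notin_nonpos_Ints) (use assms in auto)
  have 2: "(\<lambda>n. Gamma (?a n + C) * Gamma (?a n + (B + D)) / (Gamma (?a n) * Gamma (?a n + (B + D + C)))) \<longlonglongrightarrow> 1"
    by (intro Gamma_pair_ratio_tendsto pos_notin_nonpos_Ints) (use assms in auto)
  have "(\<lambda>n. prod3 B D C * (Gamma (?a n + B) * Gamma (?a n + D) / (Gamma (?a n) * Gamma (?a n + (B + D)))) *
     (Gamma (?a n + C) * Gamma (?a n + (B + D)) / (Gamma (?a n) * Gamma (?a n + (B + D + C))))) \<longlonglongrightarrow> prod3 B D C * 1 * 1"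
    by (intro tendsto_intros 1 2)
  moreover have "prod3 B D C * (Gamma (?a n + B) * Gamma (?a n + D) / (Gamma (?a n) * Gamma (?a n + (B + D)))) *
     (Gamma (?a n + C) * Gamma (?a n + (B + D)) / (Gamma (?a n) * Gamma (?a n + (B + D + C)))) =
     prod4 (?a n) B D C / (Gamma (?a n))\<^sup>2" for n
  proof -
    have "Gamma (?a n + (B + D)) \<noteq> 0" by (rule Gamma_real_nz) (use assms in auto)
    moreover have "(r * u * v) * (p * q / (g * y)) * (t * y / (g * z)) = p * q * r * t * u * v / z / g\<^sup>2"
      if "y \<noteq> 0" for p q r t u v g y z :: real
      using that by (simp add: power2_eq_square mult_ac)
    ultimately show ?thesis unfolding prod3_def prod4_def add.assoc[of "A + real (Suc n)"] add.assoc[of B] by blast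
  qed
  ultimately show ?thesis by (simp del: of_nat_Suc)
qed

lemma prod3_nz: "B > 0 \<Longrightarrow> D > 0 \<Longrightarrow> B + C > 0 \<Longrightarrow> D + C > 0 \<Longrightarrow> prod3 B D C \<noteq> 0"
  unfolding prod3_def using Gamma_real_nz by (simp add: Gamma_real_nz)

lemma prod4_nz: "A > 0 \<Longrightarrow> B > 0 \<Longrightarrow> D > 0 \<Longrightarrow> A + C > 0 \<Longrightarrow> B + C > 0 \<Longrightarrow> D + C > 0 \<Longrightarrow> prod4 A B D C \<noteq> 0"
  unfolding prod4_def using Gamma_real_nz by (simp add: Gamma_real_nz)

section \<open>Evaluation for positive parameters\<close>

lemma prod4_plus1_aux:
  fixes s :: real
  assumes "s \<noteq> 0"
  shows "s * ((a * p) * (b * q) * r * (c * t) * u * v / (s * g)) = a * b * c * (p * q * r * t * u * v / g)"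
    and "p * q * r * (a * t) * (b * u) * (c * v) / (s * g) = a * b * c * (p * q * r * t * u * v / g) / s"
  using assms by (cases "g = 0"; simp add: field_simps)+

lemma prod4_plus1:
  assumes "A > 0" "B > 0" "D > 0" "A + C > 0" "B + C > 0" "D + C > 0"
  shows "(A + B + D + C) * prod4 (A + 1) B D C = (A + B) * (A + D) * (A + C) * prod4 A B D C"
proof -
  have e: "A + 1 + t = (A + t) + 1" for t by simp
  have s: "A + B + D + C > 0" using assms by linarith
  have "prod4 (A + 1) B D C = ((A + B) * Gamma (A + B)) * ((A + D) * Gamma (A + D)) * Gamma (B + D) * ((A + C) * Gamma (A + C)) * Gamma (B + C) * Gamma (D + C)
     / ((A + B + D + C) * Gamma (A + B + D + C))"
    unfolding prod4_def using Gamma_real_plus1[of "A + B"] Gamma_real_plus1[of "A + D"] Gamma_real_plus1[of "A + C"] Gamma_real_plus1[OF s] assms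
    by (simp add: add_ac)
  thus ?thesis unfolding prod4_def using s prod4_plus1_aux(1)[of "A + B + D + C"] by simp
qed

lemma prod4_swap: "prod4 A B D C = prod4 C B D A" "prod4 A B D C = prod4 B A D C" "prod4 A B D C = prod4 D B A C"
  unfolding prod4_def by (simp_all add: add_ac mult_ac)

text \<open>An exchange with the last argument is restricted to the case where neither of the two
  parameters produces atoms.\<close>

lemma mass4_swap:
  "mass4 A B D C = mass4 B A D C" "mass4 A B D C = mass4 D B A C" 
  "A > 0 \<Longrightarrow> C > 0 \<Longrightarrow> mass4 A B D C = mass4 C B D A"
  unfolding mass4_def om_def by (simp_all add: mult_ac)

text \<open>Write e1 (A^2 + x^2) = (e3 + e1 A^2) - (e3 - e1 x^2): the last term integrates to 0 by
  the contour shift, and e3 + e1 A^2 factors into the three pair sums with A.\<close>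

lemma mass4_plus1_pos:
  assumes pos: "A > 0" "B > 0" "D > 0" "C > 0"
  shows "(A + B + D + C) * mass4 (A + 1) B D C = (A + B) * (A + D) * (A + C) * mass4 A B D C"
proof -
  define e1 where "e1 = A + B + C + D" 
  define e3 where "e3 = A*B*C + A*B*D + A*C*D + B*C*D"
  let ?I = "\<lambda>f. (LINT x:{0<..}|lborel. f x * om B D C x)"
  have int: "set_integrable lborel {0<..} (\<lambda>x. (p + q * x\<^sup>2) * phi A x * om B D C x)" for p q
    by (rule om_integrable_quadratic) (use pos in auto)
  have int': "set_integrable lborel {0<..} (\<lambda>x. (e3 - e1 * x\<^sup>2) * phi A x * om B D C x)"
    using int[of e3 "-e1"] by simp
  have 0: "?I (\<lambda>x. (e3 - e1 * x\<^sup>2) * phi A x) = 0"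
    using four_Gamma_contour_shift[OF pos(1,2,4,3)] unfolding e1_def e3_def .
  have "?I (\<lambda>x. e1 * phi (A+1) x) = ?I (\<lambda>x. (e3 + e1 * A\<^sup>2) * phi A x) - ?I (\<lambda>x. (e3 - e1 * x\<^sup>2) * phi A x)"
    using int[of "e3 + e1 * A\<^sup>2" 0] int'
    by (subst set_integral_diff(2)[symmetric]) 
       (auto intro!: set_lebesgue_integral_cong simp: phi_plus1 pos algebra_simps)
  hence "e1 * ?I (phi (A+1)) = (e3 + e1 * A\<^sup>2) * ?I (phi A)" using 0 by (simp add: mult.assoc)
  moreover have "e3 + e1 * A\<^sup>2 = (A + B) * (A + D) * (A + C)"
    unfolding e1_def e3_def by (simp add: algebra_simps power2_eq_square)
  ultimately show ?thesis using pos by (simp add: mass4_def e1_def add_ac)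
qed

lemma mass4_base: "mass4 (1/2) (1/2) (1/2) (1/2) = 1"
proof -
  let ?f = "\<lambda>x. phi (1/2) x * om (1/2) (1/2) (1/2) x"
  \<comment> \<open>From integration by parts: the integrand 2 pi^2 x sinh(pi x) / cosh(pi x)^3 is
    -pi x times the derivative of 1 / cosh(pi x)^2.\<close>
  define F where "F x = - pi * x / (cosh (pi * x))\<^sup>2 + sinh (pi * x) / cosh (pi * x)" for x
  have ch: "cosh (pi * x) \<noteq> 0" for x by (simp add: cosh_real_nonzero)
  have f: "?f x = 2 * pi\<^sup>2 * x * sinh (pi * x) / cosh (pi * x) ^ 3" for x
  proof -
    have "sinh (2 * pi * x) = 2 * sinh (pi * x) * cosh (pi * x)"
      using sinh_double[of "pi * x"] by (simp add: mult_ac)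
    thus ?thesis unfolding om_def w0_def phi_half using ch[of x]
      by (simp add: field_simps power2_eq_square power3_eq_cube)
  qed
  have "(LBINT x=0..\<infinity>. ?f x) = 1 - 0"
  proof (rule interval_integral_FTC_integrable[where F = F])
    have "einterval 0 \<infinity> = {0<..}" by (auto simp: einterval_def zero_ereal_def)
    thus "set_integrable lborel (einterval 0 \<infinity>) ?f" by (simp add: om_integrable_phi)
    show "(F has_vector_derivative ?f x) (at x)" for x
    proof -
      have "(F has_real_derivative ?f x) (at x)"
      proof -
        define c s where "c = cosh (pi * x)" and "s = sinh (pi * x)"
        have c: "c \<noteq> 0" by (simp add: c_def ch)
        have cs: "c * c - s * s = 1"
          using cosh_square_eq[of "pi * x"] by (simp add: c_def s_def power2_eq_square)
        have "(F has_real_derivative ((- pi * c\<^sup>2 + 2 * pi * pi * x * c * s) / (c\<^sup>2 * c\<^sup>2) + pi * (c * c - s * s) / (c * c))) (at x)"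
          unfolding F_def[abs_def] c_def s_def
          by (rule derivative_eq_intros refl ch | simp add: ch)+ (simp add: field_simps ch)
        also have "(- pi * c\<^sup>2 + 2 * pi * pi * x * c * s) / (c\<^sup>2 * c\<^sup>2) + pi * (c * c - s * s) / (c * c) = ?f x"
          unfolding cs f c_def[symmetric] s_def[symmetric] using c by (simp add: field_simps power2_eq_square power3_eq_cube)
        finally show ?thesis .
      qed
      thus ?thesis by (simp add: has_real_derivative_iff_has_vector_derivative)
    qed
    show "isCont ?f x" for x unfolding f by (intro continuous_intros) (simp add: ch)
    have "isCont F 0" unfolding F_def[abs_def] by (intro continuous_intros) (simp_all add: ch)
    hence "(F \<longlongrightarrow> F 0) (at_right 0)" by (simp add: isCont_def filterlim_at_split)
    thus "((F \<circ> real_of_ereal) \<longlongrightarrow> 0) (at_right 0)" unfolding zero_ereal_def ereal_tendsto_simps by (simp add: F_def)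
    show "((F \<circ> real_of_ereal) \<longlongrightarrow> 1) (at_left \<infinity>)" unfolding ereal_tendsto_simps F_def[abs_def]
      by real_asymp
  qed auto
  thus ?thesis by (simp add: mass4_def interval_lebesgue_integral_0_infty)
qed

text \<open>By the two recurrences the quotient has period 1 in A, so it equals its limit along A +
  n, in which A does not occur.\<close>

lemma mass4_ratio_const:
  assumes pos: "A > 0" "B > 0" "D > 0" "C > 0"
  shows "mass4 A B D C / prod4 A B D C = mass3 B D C / prod3 B D C"
proof -
  have step: "mass4 (A + 1) B D C / prod4 (A + 1) B D C = mass4 A B D C / prod4 A B D C" if A: "A > 0" for A
  proof -
    let ?p = "(A + B) * (A + D) * (A + C)"
    have s: "A + B + D + C > 0" "?p > 0" using A pos by (auto intro!: add_pos_pos mult_pos_pos)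
    have f: "mass4 (A + 1) B D C = ?p * mass4 A B D C / (A + B + D + C)"
      using mass4_plus1_pos[OF A pos(2-4)] s by (simp add: field_simps)
    have x: "prod4 (A + 1) B D C = ?p * prod4 A B D C / (A + B + D + C)"
      using prod4_plus1[of A B D C] s A pos by (simp add: field_simps)
    show ?thesis unfolding f x using s prod4_nz[of A B D C] A pos by simp
  qed
  have "mass4 (A + real n) B D C / prod4 (A + real n) B D C = mass4 A B D C / prod4 A B D C" for n
  proof (induction n)
    case (Suc n)
    thus ?case using step[of "A + real n"] pos by (simp add: add_ac)
  qed simp
  hence e: "(mass4 (A + real (Suc n)) B D C / (Gamma (A + real (Suc n)))\<^sup>2) / (prod4 (A + real (Suc n)) B D C / (Gamma (A + real (Suc n)))\<^sup>2)
     = mass4 A B D C / prod4 A B D C" for n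
    using Gamma_real_nz[of "A + real (Suc n)"] pos by (simp del: of_nat_Suc)
  have "(\<lambda>n. (mass4 (A + real (Suc n)) B D C / (Gamma (A + real (Suc n)))\<^sup>2) / (prod4 (A + real (Suc n)) B D C / (Gamma (A + real (Suc n)))\<^sup>2))
     \<longlonglongrightarrow> mass3 B D C / prod3 B D C"
    by (intro tendsto_divide mass4_limit prod4_limit prod3_nz) (use pos in auto)
  thus ?thesis unfolding e by (simp add: LIMSEQ_const_iff)
qed

text \<open>The quotient does not depend on its first parameter, and the symmetries bring each
  parameter to that position in turn, so all four can be replaced by 1/2.\<close>

lemma mass4_eq_pos:
  assumes pos: "A > 0" "B > 0" "D > 0" "C > 0"
  shows "mass4 A B D C = prod4 A B D C"
proof -
  define V where "V A B D C = mass4 A B D C / prod4 A B D C" for A B D C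
  have h: "(1/2::real) > 0" by simp
  have one: "V A B D C = V (1/2) B D C" if "A > 0" "B > 0" "D > 0" "C > 0" for A B D C
    unfolding V_def using mass4_ratio_const[OF that] mass4_ratio_const[OF h that(2-4)] by simp
  have sw: "V A B D C = V B A D C" "V A B D C = V D B A C" "A > 0 \<Longrightarrow> C > 0 \<Longrightarrow> V A B D C = V C B D A" for A B D C
    unfolding V_def using mass4_swap prod4_swap by metis+
  have "V A B D C = V (1/2) (1/2) (1/2) (1/2)"
  proof -
    have "V A B D C = V (1/2) B D C" using one[OF pos] .
    also have "\<dots> = V B (1/2) D C" by (rule sw)
    also have "\<dots> = V (1/2) (1/2) D C" using one pos h by blast
    also have "\<dots> = V D (1/2) (1/2) C" by (rule sw)
    also have "\<dots> = V (1/2) (1/2) (1/2) C" using one pos h by blast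
    also have "\<dots> = V C (1/2) (1/2) (1/2)" using sw(3) pos h by blast
    also have "\<dots> = V (1/2) (1/2) (1/2) (1/2)" using one pos h by blast
    finally show ?thesis .
  qed
  also have "\<dots> = 1" unfolding V_def mass4_base prod4_def
    using Gamma_fact[of 1, where 'a = real] by (simp add: Gamma_eq_zero_iff)
  finally show ?thesis using prod4_nz[of A B D C] pos by (simp add: V_def)
qed

section \<open>Descent of the distinguished parameter\<close>

lemma mass4_plus1_neg:
  assumes pos: "A > 0" "B > 0" "D > 0" "A + C > 0" "B + C > 0" "D + C > 0" and C: "C \<le> 0"
  shows "mass4 (A + 1) B D C = mass4 A B D (C + 1) + (A\<^sup>2 - C\<^sup>2) * mass4 A B D C"
proof -
  \<comment> \<open>On the half-line this is A^2 + x^2 = (C^2 + x^2) + (A^2 - C^2) under the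
    integral; the first summand raises C.\<close>
  have cont: "(LINT x:{0<..}|lborel. phi (A + 1) x * om B D C x) =
     (LINT x:{0<..}|lborel. phi A x * om B D (C + 1) x) + (A\<^sup>2 - C\<^sup>2) * (LINT x:{0<..}|lborel. phi A x * om B D C x)"
  proof -
    have "(LINT x:{0<..}|lborel. phi (A + 1) x * om B D C x) = 
       (LINT x:{0<..}|lborel. phi A x * om B D (C + 1) x + (A\<^sup>2 - C\<^sup>2) * (phi A x * om B D C x))"
      by (rule set_lebesgue_integral_cong) (auto simp: phi_plus1 pos om_def algebra_simps)
    also have "\<dots> = (LINT x:{0<..}|lborel. phi A x * om B D (C + 1) x) + (LINT x:{0<..}|lborel. (A\<^sup>2 - C\<^sup>2) * (phi A x * om B D C x))"
      by (intro set_integral_add(2) set_integrable_mult_right om_integrable_phi pos)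
    finally show ?thesis by simp
  qed
  let ?t = "\<lambda>C A k. atom_factor C k * psi C k A * (psi C k B * psi C k D)"
  have at: "(\<Sum>k\<in>atomset C. ?t C (A + 1) k) = (\<Sum>k\<in>atomset (C + 1). ?t (C + 1) A k) + (A\<^sup>2 - C\<^sup>2) * (\<Sum>k\<in>atomset C. ?t C A k)"
  proof (cases "C = 0")
    case False
    hence C0: "C < 0" using C by simp
    \<comment> \<open>Atom k+1 of C sits where atom k of C+1 does. Atom 0 has no counterpart; it
      drops out below because its factor C^2 - (C+k)^2 is 0.\<close>
    have set: "atomset C = insert 0 (Suc ` atomset (C + 1))"
    proof (intro set_eqI)
      fix k show "k \<in> atomset C \<longleftrightarrow> k \<in> insert 0 (Suc ` atomset (C + 1))"
        using C0 by (cases k) (auto simp: atomset_def add_ac)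
    qed
    have psi1: "psi C k (A + 1) = (A\<^sup>2 - (C + real k)\<^sup>2) * psi C k A" if "k \<in> atomset C" for k
    proof -
      have k: "A - (C + real k) > 0" "A + (C + real k) > 0" using that pos by (auto simp: atomset_def)
      have "psi C k (A + 1) = Gamma ((A - (C + real k)) + 1) * Gamma ((A + (C + real k)) + 1)"
        unfolding psi_def by (simp add: algebra_simps)
      also have "\<dots> = (A\<^sup>2 - (C + real k)\<^sup>2) * psi C k A"
        unfolding psi_def Gamma_real_plus1[OF k(1)] Gamma_real_plus1[OF k(2)] by (simp add: algebra_simps power2_eq_square)
      finally show ?thesis .
    qed
    have "(\<Sum>k\<in>atomset C. ?t C (A + 1) k) - (A\<^sup>2 - C\<^sup>2) * (\<Sum>k\<in>atomset C. ?t C A k) =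
          (\<Sum>k\<in>atomset C. (C\<^sup>2 - (C + real k)\<^sup>2) * ?t C A k)"
      unfolding sum_distrib_left sum_subtractf[symmetric]
      by (rule sum.cong) (auto simp: psi1 algebra_simps)
    also have "\<dots> = (\<Sum>k\<in>Suc ` atomset (C + 1). (C\<^sup>2 - (C + real k)\<^sup>2) * ?t C A k)"
      unfolding set by (subst sum.insert) auto
    also have "\<dots> = (\<Sum>k\<in>atomset (C + 1). (C\<^sup>2 - (C + real (Suc k))\<^sup>2) * ?t C A (Suc k))"
      by (subst sum.reindex) (auto simp: o_def)
    also have "\<dots> = (\<Sum>k\<in>atomset (C + 1). ?t (C + 1) A k)"
    proof (rule sum.cong)
      fix k assume "k \<in> atomset (C + 1)"
      hence k: "C + 1 + real k < 0" by (simp add: atomset_def)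
      have ps: "psi C (Suc k) T = psi (C + 1) k T" for T unfolding psi_def by (simp add: algebra_simps)
      \<comment> \<open>Chosen so that C^2 - (C+k+1)^2 = (k+1) g, which cancels the extra factors of
        the factorial and of Gamma in \<open>atom_factor C (Suc k)\<close>.\<close>
      define g where "g = -1 - 2 * C - real k"
      have g: "g > 0" using k C0 by (simp add: g_def)
      have e1: "1 - 2 * C - real (Suc k) = g + 1" and e2: "1 - 2 * (C + 1) - real k = g" by (simp_all add: g_def)
      have r: "atom_factor C (Suc k) = - 2 * (C + real (Suc k)) / ((real (Suc k) * fact k) * (g * Gamma g))"
               "atom_factor (C + 1) k = - 2 * (C + real (Suc k)) / (fact k * Gamma g)"
        unfolding atom_factor_def e1 e2 Gamma_real_plus1[OF g] by (simp_all add: add_ac)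
      have "C\<^sup>2 - (C + real (Suc k))\<^sup>2 = real (Suc k) * g"
        by (simp add: g_def algebra_simps power2_eq_square)
      hence "(C\<^sup>2 - (C + real (Suc k))\<^sup>2) * atom_factor C (Suc k) = atom_factor (C + 1) k"
        unfolding r using g by (simp add: mult.assoc del: of_nat_Suc)
      thus "(C\<^sup>2 - (C + real (Suc k))\<^sup>2) * ?t C A (Suc k) = ?t (C + 1) A k"
        unfolding ps mult.assoc[symmetric] by simp
    qed simp
    finally show ?thesis by linarith
  qed simp
  show ?thesis unfolding mass4_def cont at by (simp add: algebra_simps)
qed

text \<open>After division by A + C the identity behind this is (A+B)(A+D) = (B+C)(D+C) +
  (A-C)(A+B+C+D).\<close>

lemma prod4_plus1_neg:
  assumes pos: "A > 0" "B > 0" "D > 0" "A + C > 0" "B + C > 0" "D + C > 0"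
  shows "prod4 (A + 1) B D C = prod4 A B D (C + 1) + (A\<^sup>2 - C\<^sup>2) * prod4 A B D C"
proof -
  define s where "s = A + B + D + C"
  have s: "s > 0" using pos by (simp add: s_def)
  have 1: "prod4 (A + 1) B D C = (A + B) * (A + D) * (A + C) * prod4 A B D C / s"
    using prod4_plus1[OF pos] s by (simp add: s_def field_simps)
  have e: "T + (C + 1) = (T + C) + 1" for T by simp
  have "prod4 A B D (C + 1) = Gamma (A + B) * Gamma (A + D) * Gamma (B + D) * ((A + C) * Gamma (A + C)) * ((B + C) * Gamma (B + C)) * ((D + C) * Gamma (D + C))
     / (s * Gamma s)"
    unfolding prod4_def e Gamma_real_plus1[OF pos(4)] Gamma_real_plus1[OF pos(5)] Gamma_real_plus1[OF pos(6)]
    using Gamma_real_plus1[OF s] by (simp add: s_def)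
  hence 2: "prod4 A B D (C + 1) = (A + C) * (B + C) * (D + C) * prod4 A B D C / s"
    using s prod4_plus1_aux(2)[of s] unfolding prod4_def s_def by simp
  have "(A + B) * (A + D) * (A + C) = (A + C) * (B + C) * (D + C) + (A\<^sup>2 - C\<^sup>2) * s"
    by (simp add: s_def algebra_simps power2_eq_square)
  hence "(A + B) * (A + D) * (A + C) / s = (A + C) * (B + C) * (D + C) / s + (A\<^sup>2 - C\<^sup>2)"
    using s by (simp add: add_divide_distrib)
  from arg_cong[OF this, of "\<lambda>t. t * prod4 A B D C"] show ?thesis unfolding 1 2 by (simp add: distrib_right)
qed

text \<open>Integral and product satisfy the same inhomogeneous recurrence in A, with equal
  inhomogeneities by \<open>IH\<close>. So the defect \<open>E\<close> satisfies a homogeneous one,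
  as does Gamma(A+C) Gamma(A-C); comparing both along A + n, relative to Gamma(A+n)^2, identifies
  their quotient with \<open>E3\<close>.\<close>

lemma mass4_step:
  assumes pos: "A > 0" "B > 0" "D > 0" "A + C > 0" "B + C > 0" "D + C > 0" and C: "C \<le> 0"
    and IH: "\<And>A. A > 0 \<Longrightarrow> A + C > 0 \<Longrightarrow> mass4 A B D (C + 1) = prod4 A B D (C + 1)"
  shows "mass4 A B D C = prod4 A B D C"
proof -
  define E where "E A = mass4 A B D C - prod4 A B D C" for A
  define E3 where "E3 = mass3 B D C - prod3 B D C"
  have rec: "E (A + 1) = (A\<^sup>2 - C\<^sup>2) * E A" if "A > 0" "A + C > 0" for A
    unfolding E_def using mass4_plus1_neg[OF that(1) pos(2,3) that(2) pos(5,6) C] prod4_plus1_neg[OF that(1) pos(2,3) that(2) pos(5,6)]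
      IH[OF that] by (simp add: algebra_simps)
  have key: "E A = Gamma (A + C) * Gamma (A - C) * E3" if A: "A > 0" "A + C > 0" for A
  proof -
    have AC: "A - C > 0" using A C by simp
    have iter: "E (A + real n) * (Gamma (A + C) * Gamma (A - C)) = Gamma (A + C + real n) * Gamma (A - C + real n) * E A" for n
    proof (induction n)
      case (Suc n)
      have r: "E (A + real (Suc n)) = ((A + real n)\<^sup>2 - C\<^sup>2) * E (A + real n)"
        using rec[of "A + real n"] A by (simp add: add_ac)
      have g1: "Gamma (A + C + real (Suc n)) = (A + C + real n) * Gamma (A + C + real n)"
        using Gamma_real_plus1[of "A + C + real n"] A by (simp add: add_ac)
      have g2: "Gamma (A - C + real (Suc n)) = (A - C + real n) * Gamma (A - C + real n)"
        using Gamma_real_plus1[of "A - C + real n"] AC by (simp add: add_ac)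
      have "E (A + real (Suc n)) * (Gamma (A + C) * Gamma (A - C)) = ((A + real n)\<^sup>2 - C\<^sup>2) * (E (A + real n) * (Gamma (A + C) * Gamma (A - C)))"
        unfolding r by (simp only: mult.assoc)
      also have "\<dots> = ((A + real n)\<^sup>2 - C\<^sup>2) * (Gamma (A + C + real n) * Gamma (A - C + real n) * E A)" unfolding Suc ..
      also have "(A + real n)\<^sup>2 - C\<^sup>2 = (A + C + real n) * (A - C + real n)" by (simp add: algebra_simps power2_eq_square)
      finally show ?case unfolding g1 g2 by (simp only: mult_ac)
    qed simp
    have "(\<lambda>n. mass4 (A + real (Suc n)) B D C / (Gamma (A + real (Suc n)))\<^sup>2 - prod4 (A + real (Suc n)) B D C / (Gamma (A + real (Suc n)))\<^sup>2) \<longlonglongrightarrow> E3"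
      unfolding E3_def by (intro tendsto_diff mass4_limit prod4_limit) (use A pos in auto)
    hence l1: "(\<lambda>n. E (A + real (Suc n)) / (Gamma (A + real (Suc n)))\<^sup>2) \<longlonglongrightarrow> E3"
      by (simp add: E_def diff_divide_distrib del: of_nat_Suc)
    have "(\<lambda>n. Gamma (A + real (Suc n) + C) * Gamma (A + real (Suc n) + (-C)) / (Gamma (A + real (Suc n)) * Gamma (A + real (Suc n) + 0))) \<longlonglongrightarrow> 1"
      by (intro Gamma_pair_ratio_tendsto pos_notin_nonpos_Ints) (use A AC in auto)
    hence l2: "(\<lambda>n. (E A / (Gamma (A + C) * Gamma (A - C))) * (Gamma (A + C + real (Suc n)) * Gamma (A - C + real (Suc n)) / (Gamma (A + real (Suc n)))\<^sup>2))
        \<longlonglongrightarrow> (E A / (Gamma (A + C) * Gamma (A - C))) * 1"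
      by (intro tendsto_mult tendsto_const) (simp add: power2_eq_square algebra_simps)
    have nz: "Gamma (A + C) * Gamma (A - C) \<noteq> 0" using Gamma_real_nz A AC by simp
    have "E (A + real (Suc n)) / (Gamma (A + real (Suc n)))\<^sup>2 =
       (E A / (Gamma (A + C) * Gamma (A - C))) * (Gamma (A + C + real (Suc n)) * Gamma (A - C + real (Suc n)) / (Gamma (A + real (Suc n)))\<^sup>2)" for n
      using arg_cong[OF iter[of "Suc n"], of "\<lambda>t. t / (Gamma (A + C) * Gamma (A - C)) / (Gamma (A + real (Suc n)))\<^sup>2"] nz
      by (simp add: mult_ac del: of_nat_Suc)
    with l1 l2 have "E3 = E A / (Gamma (A + C) * Gamma (A - C))"
      using LIMSEQ_unique by force
    thus ?thesis using nz by (simp add: field_simps)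
  qed
  \<comment> \<open>As \<open>A\<close> tends to \<open>-C\<close>, both sides of the claim grow like \<open>\<Gamma>(A+C)\<close> with the same leading coefficient, so
    \<open>(A\<^sup>2 - C\<^sup>2) E A\<close> tends to 0, whereas \<open>key\<close> says that it tends to \<open>\<Gamma>(1 - 2 C) E3\<close>.\<close>
  define d where "d n = inverse (real (Suc n))" for n
  have d: "d n > 0" "d n \<le> 1" for n by (simp_all add: d_def field_simps)
  have dlim: "d \<longlonglongrightarrow> 0" unfolding d_def by (rule LIMSEQ_inverse_real_of_nat)
  define a where "a n = - C + d n" for n
  have a: "a n > 0" "a n + C > 0" "a n + 1 > 0" "a n + 1 \<in> {1 - C..2 - C}" for n using d[of n] C by (auto simp: a_def)
  have alim: "a \<longlonglongrightarrow> - C" unfolding a_def using tendsto_add[OF tendsto_const dlim, of "-C"] by simp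
  have qlim: "(\<lambda>n. (a n)\<^sup>2 - C\<^sup>2) \<longlonglongrightarrow> 0"
    using tendsto_diff[OF tendsto_power[OF alim, of 2] tendsto_const[of "C\<^sup>2"]] by simp
  have q0: "(a n)\<^sup>2 - C\<^sup>2 \<ge> 0" for n
  proof -
    have "(a n)\<^sup>2 - C\<^sup>2 = (a n + C) * (a n - C)" by (simp add: algebra_simps power2_eq_square)
    thus ?thesis using a(1,2)[of n] C by simp
  qed
  have contl: "(\<lambda>n. LINT x:{0<..}|lborel. ((a n)\<^sup>2 - C\<^sup>2) * (phi (a n) x * om B D C x)) \<longlonglongrightarrow> 0"
  proof -
    have "compact ((\<lambda>A::real. (Gamma A)\<^sup>2) ` {1 - C..2 - C})"
      by (intro compact_continuous_image continuous_intros) (use C in auto)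
    then obtain M where M: "\<And>A. A \<in> {1 - C..2 - C} \<Longrightarrow> (Gamma A)\<^sup>2 \<le> M"
      unfolding compact_eq_bounded_closed bounded_real by (meson abs_le_D1 bounded_real imageI)
    \<comment> \<open>If C = 0, \<open>phi (a n)\<close> is not bounded near x = 0 uniformly in n.
      The recurrence isolates the dangerous denominator, and the quotient (a^2 - C^2) / (a^2 + x^2)
      is at most 1 and tends to 0.\<close>
    have bd: "((a n)\<^sup>2 - C\<^sup>2) * phi (a n) x \<le> M * (((a n)\<^sup>2 - C\<^sup>2) / ((a n)\<^sup>2 + x\<^sup>2))" if x: "x > 0" for n x
    proof -
      have "phi (a n) x = phi (a n + 1) x / ((a n)\<^sup>2 + x\<^sup>2)"
        using phi_plus1[of "a n" x] x add_nonneg_pos[of "(a n)\<^sup>2" "x\<^sup>2"] by simp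
      also have "\<dots> \<le> M / ((a n)\<^sup>2 + x\<^sup>2)"
        using order_trans[OF phi_le[OF a(3)] M[OF a(4)]] by (intro divide_right_mono) auto
      finally have "((a n)\<^sup>2 - C\<^sup>2) * phi (a n) x \<le> ((a n)\<^sup>2 - C\<^sup>2) * (M / ((a n)\<^sup>2 + x\<^sup>2))"
        using q0 by (rule mult_left_mono)
      thus ?thesis by (simp add: mult_ac)
    qed
    have M0: "M \<ge> 0" using M[OF a(4)[of 0]] order_trans zero_le_power2 by blast
    have fr: "0 \<le> ((a n)\<^sup>2 - C\<^sup>2) / ((a n)\<^sup>2 + x\<^sup>2)" "((a n)\<^sup>2 - C\<^sup>2) / ((a n)\<^sup>2 + x\<^sup>2) \<le> 1" if x: "x > 0" for n x
      using q0[of n] x add_nonneg_pos[of "(a n)\<^sup>2" "x\<^sup>2"] by (auto simp: divide_le_eq_1 intro: order_trans[of _ 0])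
    have "(\<lambda>n. LINT x:{0<..}|lborel. ((a n)\<^sup>2 - C\<^sup>2) * (phi (a n) x * om B D C x)) \<longlonglongrightarrow> (LINT x:{0<..}|(lborel :: real measure). (0::real))"
    proof (rule half_line_dominated_convergence)
      show "set_integrable lborel {0<..} (\<lambda>x. M * om B D C x)"
        by (intro set_integrable_mult_right om_integrable_const pos)
      fix x :: real assume x: "x > 0"
      have nz: "(- C)\<^sup>2 + x\<^sup>2 \<noteq> 0" using x by (simp add: add_nonneg_eq_0_iff)
      have "(\<lambda>n. M * (((a n)\<^sup>2 - C\<^sup>2) / ((a n)\<^sup>2 + x\<^sup>2))) \<longlonglongrightarrow> M * (0 / ((- C)\<^sup>2 + x\<^sup>2))"
        by (intro tendsto_intros qlim alim nz)
      hence u: "(\<lambda>n. M * (((a n)\<^sup>2 - C\<^sup>2) / ((a n)\<^sup>2 + x\<^sup>2))) \<longlonglongrightarrow> 0" by simp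
      have "(\<lambda>n. ((a n)\<^sup>2 - C\<^sup>2) * phi (a n) x) \<longlonglongrightarrow> 0"
        by (rule tendsto_sandwich[OF _ _ tendsto_const u]) (use bd[OF x] q0 in auto)
      hence "(\<lambda>n. ((a n)\<^sup>2 - C\<^sup>2) * phi (a n) x * om B D C x) \<longlonglongrightarrow> 0 * om B D C x"
        by (intro tendsto_mult tendsto_const)
      thus "(\<lambda>n. ((a n)\<^sup>2 - C\<^sup>2) * (phi (a n) x * om B D C x)) \<longlonglongrightarrow> 0" by (simp add: mult.assoc)
      fix n
      have o: "om B D C x \<ge> 0" using om_nonneg[of x] x by simp
      have "((a n)\<^sup>2 - C\<^sup>2) * phi (a n) x \<le> M * 1"
        using bd[OF x, of n] mult_left_mono[OF fr(2)[OF x, of n] M0] by linarith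
      from mult_right_mono[OF this o]
      show "\<bar>((a n)\<^sup>2 - C\<^sup>2) * (phi (a n) x * om B D C x)\<bar> \<le> M * om B D C x"
        using q0[of n] o by (simp add: abs_mult mult.assoc)
    qed measurable
    thus ?thesis by (simp only: set_lebesgue_integral_def scaleR_zero_right integral_zero)
  qed
  have gam2: "((a n)\<^sup>2 - C\<^sup>2) * (Gamma (a n + C) * Gamma (a n - C)) = Gamma (a n + C + 1) * Gamma (a n - C + 1)" for n
  proof -
    have "a n - C > 0" using a(1)[of n] C by simp
    from Gamma_real_plus1[OF this] Gamma_real_plus1[OF a(2), of n]
    have "Gamma (a n + C + 1) * Gamma (a n - C + 1) = ((a n + C) * (a n - C)) * (Gamma (a n + C) * Gamma (a n - C))"
      by (simp only: mult_ac)
    thus ?thesis by (simp add: algebra_simps power2_eq_square)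
  qed
  \<comment> \<open>The common limit. (A^2 - C^2) \<open>psi C 0 A\<close> tends to Gamma(1 - 2C),
    which cancels the same Gamma in \<open>atom_factor C 0\<close>; the other atoms stay finite and
    are killed by the prefactor. For C = 0 there are no atoms and \<open>L\<close> is 0.\<close>
  define L where "L = - 2 * C * (psi C 0 B * psi C 0 D)"
  have atl: "(\<lambda>n. \<Sum>k\<in>atomset C. ((a n)\<^sup>2 - C\<^sup>2) * (atom_factor C k * psi C k (a n) * (psi C k B * psi C k D))) \<longlonglongrightarrow> L"
  proof (cases "C = 0")
    case False
    hence C0: "C < 0" using C by simp
    have "(\<lambda>n. \<Sum>k\<in>atomset C. (atom_factor C k * (((a n)\<^sup>2 - C\<^sup>2) * psi C k (a n)) * (psi C k B * psi C k D)))
       \<longlonglongrightarrow> (\<Sum>k\<in>atomset C. atom_factor C k * (if k = 0 then Gamma (1 - 2 * C) else 0) * (psi C k B * psi C k D))"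
    proof (intro tendsto_intros)
      fix k assume "k \<in> atomset C"
      hence k: "C + real k < 0" by (simp add: atomset_def)
      show "(\<lambda>n. ((a n)\<^sup>2 - C\<^sup>2) * psi C k (a n)) \<longlonglongrightarrow> (if k = 0 then Gamma (1 - 2 * C) else 0)"
      proof (cases "k = 0")
        case True
        have "((a n)\<^sup>2 - C\<^sup>2) * psi C k (a n) = Gamma (a n + C + 1) * Gamma (a n - C + 1)" for n
          using gam2[of n] True by (simp add: psi_def mult_ac)
        moreover have "(\<lambda>n. Gamma (a n + C + 1) * Gamma (a n - C + 1)) \<longlonglongrightarrow> Gamma (- C + C + 1) * Gamma (- C - C + 1)"
          by (intro tendsto_intros alim pos_notin_nonpos_Ints) (use C in auto)
        ultimately show ?thesis using True by simp
      next
        case False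
        have "(\<lambda>n. ((a n)\<^sup>2 - C\<^sup>2) * psi C k (a n)) \<longlonglongrightarrow> 0 * (Gamma (- C - (C + real k)) * Gamma (- C + (C + real k)))"
          unfolding psi_def by (intro tendsto_intros alim qlim pos_notin_nonpos_Ints) (use False k C0 in auto)
        thus ?thesis using False by simp
      qed
    qed
    moreover have "(\<Sum>k\<in>atomset C. atom_factor C k * (if k = 0 then Gamma (1 - 2 * C) else 0) * (psi C k B * psi C k D)) = L"
    proof -
      have "(\<Sum>k\<in>atomset C. atom_factor C k * (if k = 0 then Gamma (1 - 2 * C) else 0) * (psi C k B * psi C k D)) =
        (\<Sum>k\<in>{0}. atom_factor C k * (if k = 0 then Gamma (1 - 2 * C) else 0) * (psi C k B * psi C k D))"
        by (rule sum.mono_neutral_right[OF finite_atomset]) (use C0 in \<open>auto simp: atomset_def\<close>)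
      also have "\<dots> = L" unfolding L_def atom_factor_def using Gamma_real_nz[of "1 - 2 * C"] C by simp
      finally show ?thesis .
    qed
    ultimately show ?thesis by (simp add: mult_ac)
  qed (simp add: L_def)
  have Xl: "(\<lambda>n. ((a n)\<^sup>2 - C\<^sup>2) * prod4 (a n) B D C) \<longlonglongrightarrow> L"
  proof -
    let ?f = "\<lambda>t. (t - C) * Gamma (t + C + 1) * Gamma (t + B) * Gamma (t + D) * Gamma (B + D) * Gamma (B + C) * Gamma (D + C) / Gamma (t + B + D + C)"
    have "((a n)\<^sup>2 - C\<^sup>2) * prod4 (a n) B D C = ?f (a n)" for n
    proof -
      have "(a n)\<^sup>2 - C\<^sup>2 = (a n - C) * (a n + C)" by (simp add: algebra_simps power2_eq_square)
      thus ?thesis unfolding prod4_def Gamma_real_plus1[OF a(2)] by (simp only: mult_ac times_divide_eq_right)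
    qed
    moreover have "(\<lambda>n. ?f (a n)) \<longlonglongrightarrow> ?f (- C)"
      by (intro tendsto_intros alim pos_notin_nonpos_Ints Gamma_real_nz) (use pos C in auto)
    moreover have "?f (- C) = L"
      using Gamma_real_nz[of "B + D"] pos unfolding L_def psi_def by (simp add: algebra_simps)
    ultimately show ?thesis by simp
  qed
  have "(\<lambda>n. (LINT x:{0<..}|lborel. ((a n)\<^sup>2 - C\<^sup>2) * (phi (a n) x * om B D C x)) +
     (\<Sum>k\<in>atomset C. ((a n)\<^sup>2 - C\<^sup>2) * (atom_factor C k * psi C k (a n) * (psi C k B * psi C k D))) - ((a n)\<^sup>2 - C\<^sup>2) * prod4 (a n) B D C) \<longlonglongrightarrow>
     0 + L - L"
    by (intro tendsto_add tendsto_diff contl atl Xl)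
  hence "(\<lambda>n. ((a n)\<^sup>2 - C\<^sup>2) * E (a n)) \<longlonglongrightarrow> 0"
    unfolding E_def mass4_def right_diff_distrib distrib_left sum_distrib_left set_integral_mult_right by simp
  moreover have "((a n)\<^sup>2 - C\<^sup>2) * E (a n) = Gamma (a n + C + 1) * Gamma (a n - C + 1) * E3" for n
    unfolding key[OF a(1,2)] gam2[symmetric] by (simp only: mult_ac)
  moreover have "(\<lambda>n. Gamma (a n + C + 1) * Gamma (a n - C + 1) * E3) \<longlonglongrightarrow> Gamma (- C + C + 1) * Gamma (- C - C + 1) * E3"
    by (intro tendsto_intros alim pos_notin_nonpos_Ints) (use C in auto)
  ultimately have "Gamma (- C + C + 1) * Gamma (- C - C + 1) * E3 = 0"
    using LIMSEQ_unique by fastforce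
  hence "E3 = 0" using Gamma_real_nz[of "- C - C + 1"] C by simp
  with key[OF pos(1,4)] show ?thesis by (simp add: E_def)
qed

text \<open>Induction on a number of unit steps that makes C positive. The step consumes the
  evaluation at C + 1 for all A, so the parameters are generalised.\<close>

theorem mass4_eq:
  assumes "A > 0" "B > 0" "D > 0" "A + C > 0" "B + C > 0" "D + C > 0"
  shows "mass4 A B D C = prod4 A B D C"
proof -
  have "mass4 A B D C = prod4 A B D C"
    if "C + real n > 0" "A > 0" "B > 0" "D > 0" "A + C > 0" "B + C > 0" "D + C > 0" for n A B D C
    using that
  proof (induction n arbitrary: A B D C)
    case (Suc n)
    show ?case
    proof (cases "C > 0")
      case False
      show ?thesis
        by (rule mass4_step) (use Suc False in auto)
    qed (use Suc mass4_eq_pos in auto)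
  qed (use mass4_eq_pos in auto)
  moreover have "C + real (nat \<lceil>1 - C\<rceil>) > 0" by linarith
  ultimately show ?thesis using assms by blast
qed

text \<open>Both sides of \<open>mass4_eq\<close>, divided by Gamma(A)^2, in the limit of large
  A.\<close>

theorem mass3_eq:
  assumes "B > 0" "D > 0" "B + C > 0" "D + C > 0"
  shows "mass3 B D C = prod3 B D C"
proof -
  define A where "A = 1 + \<bar>C\<bar>"
  have A: "A > 0" "A + C > 0" by (auto simp: A_def)
  have "(\<lambda>n. mass4 (A + real (Suc n)) B D C / (Gamma (A + real (Suc n)))\<^sup>2) \<longlonglongrightarrow> mass3 B D C"
    by (rule mass4_limit) (use A assms in auto)
  moreover have "mass4 (A + real (Suc n)) B D C = prod4 (A + real (Suc n)) B D C" for n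
    by (rule mass4_eq) (use A assms in auto)
  moreover have "(\<lambda>n. prod4 (A + real (Suc n)) B D C / (Gamma (A + real (Suc n)))\<^sup>2) \<longlonglongrightarrow> prod3 B D C"
    by (rule prod4_limit) (use A assms in auto)
  ultimately show ?thesis using LIMSEQ_unique by (simp del: of_nat_Suc)
qed

section \<open>Diagonalisation in an orthonormal basis of a finite measure\<close>

abbreviation L2sq :: "complex measure \<Rightarrow> (complex \<Rightarrow> complex) \<Rightarrow> real" where
  "L2sq M f \<equiv> (\<integral>z. (norm (f z))\<^sup>2 \<partial>M)"

lemma L2fun_norm_integrable: "L2fun M f \<Longrightarrow> integrable M (\<lambda>z. (norm (f z))\<^sup>2)"
  and L2fun_measurable: "L2fun M f \<Longrightarrow> f \<in> borel_measurable M"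
  by (simp_all add: L2fun_def)

lemma L2fun_mult_integrable:
  assumes "L2fun M f" "L2fun M g"
  shows "integrable M (\<lambda>z. f z * g z)"
proof (rule Bochner_Integration.integrable_bound)
  show "integrable M (\<lambda>z. (norm (f z))\<^sup>2 + (norm (g z))\<^sup>2)"
    using assms by (auto simp: L2fun_def)
  have "cmod (f z) * cmod (g z) \<le> (cmod (f z))\<^sup>2 + (cmod (g z))\<^sup>2" for z
    using sum_squares_bound[of "cmod (f z)" "cmod (g z)"] mult_nonneg_nonneg[OF norm_ge_zero[of "f z"] norm_ge_zero[of "g z"]] by linarith
  thus "AE z in M. norm (f z * g z) \<le> norm ((norm (f z))\<^sup>2 + (norm (g z))\<^sup>2)"
    by (auto simp: norm_mult)
qed (use assms in \<open>auto simp: L2fun_def\<close>)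

lemma L2fun_add:
  assumes "L2fun M f" "L2fun M g"
  shows "L2fun M (\<lambda>z. f z + g z)"
proof -
  have [measurable]: "f \<in> borel_measurable M" "g \<in> borel_measurable M" using assms by (auto simp: L2fun_def)
  have "integrable M (\<lambda>z. (norm (f z + g z))\<^sup>2)"
  proof (rule Bochner_Integration.integrable_bound)
    show "integrable M (\<lambda>z. 2 * (norm (f z))\<^sup>2 + 2 * (norm (g z))\<^sup>2)"
      using assms by (auto simp: L2fun_def)
    have "(cmod (f z + g z))\<^sup>2 \<le> 2 * (norm (f z))\<^sup>2 + 2 * (norm (g z))\<^sup>2" for z
    proof -
      have "(cmod (f z + g z))\<^sup>2 \<le> (cmod (f z) + cmod (g z))\<^sup>2" by (intro power_mono norm_triangle_ineq) auto
      also have "\<dots> \<le> 2 * (norm (f z))\<^sup>2 + 2 * (norm (g z))\<^sup>2"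
        using sum_squares_bound[of "cmod (f z)" "cmod (g z)"] by (simp add: power2_sum)
      finally show ?thesis .
    qed
    thus "AE z in M. norm ((norm (f z + g z))\<^sup>2) \<le> norm (2 * (norm (f z))\<^sup>2 + 2 * (norm (g z))\<^sup>2)"
      by auto
  qed measurable
  thus ?thesis by (simp add: L2fun_def)
qed

lemma L2fun_scale: "L2fun M f \<Longrightarrow> L2fun M (\<lambda>z. s * f z)"
  by (auto simp: L2fun_def norm_mult power_mult_distrib)

lemma L2fun_diff: "L2fun M f \<Longrightarrow> L2fun M g \<Longrightarrow> L2fun M (\<lambda>z. f z - g z)"
  using L2fun_add[of M f "\<lambda>z. (-1) * g z"] L2fun_scale[of M g "-1"] by simp

lemma L2fun_zero: "L2fun M (\<lambda>z. 0)"
  by (simp add: L2fun_def)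

lemma L2fun_sum: "(\<And>i. i \<in> F \<Longrightarrow> L2fun M (f i)) \<Longrightarrow> L2fun M (\<lambda>z. \<Sum>i\<in>F. f i z)"
  by (induction F rule: infinite_finite_induct) (auto intro: L2fun_add L2fun_zero)

text \<open>A weighted arithmetic-geometric inequality in place of Cauchy-Schwarz; the free
  \<open>t\<close> is adapted to the required accuracy in
  \<open>tendsto_integral_mult_L2\<close>.\<close>

lemma norm_integral_mult_le:
  assumes "L2fun M f" "L2fun M g" "t > 0"
  shows "norm (\<integral>z. f z * g z \<partial>M) \<le> t * (L2sq M f) + (L2sq M g) / t"
proof -
  have "norm (\<integral>z. f z * g z \<partial>M) \<le> (\<integral>z. t * (norm (f z))\<^sup>2 + (norm (g z))\<^sup>2 / t \<partial>M)"
  proof (rule Bochner_Integration.integral_norm_bound_integral)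
    show "integrable M (\<lambda>z. f z * g z)" by (rule L2fun_mult_integrable assms)+
    show "integrable M (\<lambda>z. t * (norm (f z))\<^sup>2 + (norm (g z))\<^sup>2 / t)"
      using assms by (auto simp: L2fun_def)
    fix z
    define u v where "u = cmod (f z)" and "v = cmod (g z)"
    have "u * v \<ge> 0" by (simp add: u_def v_def)
    have "0 \<le> (t * u - v)\<^sup>2 + t * (u * v)" using assms(3) \<open>u * v \<ge> 0\<close> by simp
    hence "t * (u * v) \<le> t * (t * u\<^sup>2 + v\<^sup>2 / t)" using assms(3)
      by (simp add: power2_diff power_mult_distrib algebra_simps power2_eq_square)
    hence "u * v \<le> t * u\<^sup>2 + v\<^sup>2 / t" using assms(3) by (metis mult_le_cancel_left_pos)
    thus "norm (f z * g z) \<le> t * (norm (f z))\<^sup>2 + (norm (g z))\<^sup>2 / t"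
      by (simp add: norm_mult u_def v_def)
  qed
  also have "\<dots> = t * (L2sq M f) + (L2sq M g) / t"
    using assms by (simp add: L2fun_def)
  finally show ?thesis .
qed

lemma tendsto_integral_mult_L2:
  assumes f: "L2fun M f" and S: "\<And>N. L2fun M (S N)" and g: "L2fun M g"
    and lim: "(\<lambda>N. L2sq M (\<lambda>z. f z - S N z)) \<longlonglongrightarrow> 0"
  shows "(\<lambda>N. \<integral>z. S N z * g z \<partial>M) \<longlonglongrightarrow> (\<integral>z. f z * g z \<partial>M)"
proof (rule LIMSEQ_I)
  fix e :: real assume e: "e > 0"
  define G where "G = (L2sq M g)"
  have G: "G \<ge> 0" by (simp add: G_def)
  \<comment> \<open>Makes G / t at most e / 2; adding 1 to G keeps \<open>t\<close> positive if G =
    0.\<close>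
  define t where "t = 2 * (G + 1) / e"
  have t: "t > 0" using e G by (simp add: t_def)
  have "e / (2 * t) > 0" using e t by simp
  from LIMSEQ_D[OF lim this] obtain N0 where N0: "\<And>N. N \<ge> N0 \<Longrightarrow> (L2sq M (\<lambda>z. f z - S N z)) < e / (2 * t)"
    by auto
  have "norm ((\<integral>z. S N z * g z \<partial>M) - (\<integral>z. f z * g z \<partial>M)) < e" if N: "N \<ge> N0" for N
  proof -
    have "(\<integral>z. (f z - S N z) * g z \<partial>M) = (\<integral>z. f z * g z \<partial>M) - (\<integral>z. S N z * g z \<partial>M)"
      using L2fun_mult_integrable[OF f g] L2fun_mult_integrable[OF S g] by (simp add: left_diff_distrib)
    hence "norm ((\<integral>z. S N z * g z \<partial>M) - (\<integral>z. f z * g z \<partial>M)) = norm (\<integral>z. (f z - S N z) * g z \<partial>M)"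
      by (simp add: norm_minus_commute)
    also have "\<dots> \<le> t * (L2sq M (\<lambda>z. f z - S N z)) + G / t"
      unfolding G_def by (rule norm_integral_mult_le[OF L2fun_diff[OF f S] g t])
    also have "\<dots> < t * (e / (2 * t)) + e / 2"
    proof (rule add_less_le_mono)
      show "t * (L2sq M (\<lambda>z. f z - S N z)) < t * (e / (2 * t))"
        using N0[OF N] t by (rule mult_strict_left_mono)
      show "G / t \<le> e / 2" using e G unfolding t_def by (simp add: field_simps)
    qed
    also have "\<dots> = e" using t by simp
    finally show ?thesis .
  qed
  thus "\<exists>no. \<forall>n\<ge>no. norm ((\<integral>z. S n z * g z \<partial>M) - (\<integral>z. f z * g z \<partial>M)) < e" by blast
qed

text \<open>The Riesz-Fischer argument: along a subsequence with T <= (1/4)^k the increments are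
  summable in L1, hence pointwise almost everywhere, which yields the limit; Fatou then bounds its
  squared distance to every \<open>S N\<close> by \<open>T N\<close>.\<close>

lemma L2_Cauchy_limit:
  assumes "finite_measure M" and S: "\<And>N. L2fun M (S N)" and T: "T \<longlonglongrightarrow> 0"
    and bd: "\<And>N K. N \<le> K \<Longrightarrow> (L2sq M (\<lambda>z. S K z - S N z)) \<le> T N"
  shows "\<exists>f. L2fun M f \<and> (\<lambda>N. L2sq M (\<lambda>z. f z - S N z)) \<longlonglongrightarrow> 0"
proof -
  interpret finite_measure M by fact
  have [measurable]: "S N \<in> borel_measurable M" for N using S L2fun_measurable by blast
  have "\<exists>r. \<forall>k. T (r k) \<le> (1/4) ^ k \<and> r k < r (Suc k)"
  proof (rule dependent_nat_choice)
    have ev: "\<forall>\<^sub>F n in sequentially. T n \<le> (1/4) ^ k" for k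
    proof -
      have "\<forall>\<^sub>F n in sequentially. T n < (1/4) ^ k" by (rule order_tendstoD(2)[OF T]) simp
      thus ?thesis by eventually_elim simp
    qed
    show "\<exists>x. T x \<le> (1/4) ^ 0" using ev[of 0] by (auto simp: eventually_sequentially)
    show "\<exists>y. T y \<le> (1/4) ^ Suc n \<and> x < y" for x n
    proof -
      from ev[of "Suc n"] obtain N where N: "\<And>m. m \<ge> N \<Longrightarrow> T m \<le> (1/4) ^ Suc n" by (auto simp: eventually_sequentially)
      thus ?thesis by (intro exI[of _ "max N (Suc x)"]) auto
    qed
  qed
  then obtain r where r: "\<And>k. T (r k) \<le> (1/4) ^ k" "\<And>k. r k < r (Suc k)" by blast
  define g where "g k z = S (r (Suc k)) z - S (r k) z" for k z
  have gL: "L2fun M (g k)" for k unfolding g_def[abs_def] by (intro L2fun_diff S)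
  have [measurable]: "g k \<in> borel_measurable M" for k using gL L2fun_measurable by blast
  define m where "m = measure M (space M)"
  have g1: "integrable M (\<lambda>z. norm (g k z)) \<and> (\<integral>z. norm (g k z) \<partial>M) \<le> (1/2) ^ k * (1 + m)" for k
  proof -
    have i: "integrable M (\<lambda>z. 2 ^ k * (norm (g k z))\<^sup>2 + (1/2) ^ k)"
      using gL[of k] by (auto simp: L2fun_def)
    \<comment> \<open>Follows from (2^k u - 1)^2 + 2^k u >= 0. It bounds the L1 norm by the squared
      L2 norm on a finite measure, with weights matched to (1/4)^k.\<close>
    have le: "u \<le> 2 ^ k * u\<^sup>2 + (1/2) ^ k" if "u \<ge> 0" for u :: real
    proof -
      have "0 \<le> (2 ^ k * u - 1)\<^sup>2 + 2 ^ k * u" using that by simp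
      hence "2 ^ k * u \<le> 2 ^ k * (2 ^ k * u\<^sup>2 + (1/2) ^ k)"
        by (simp add: power2_diff power_mult_distrib algebra_simps power2_eq_square power_one_over)
      thus ?thesis by simp
    qed
    have int: "integrable M (\<lambda>z. norm (g k z))"
      by (rule Bochner_Integration.integrable_bound[OF i]) (auto intro!: AE_I2 intro: order_trans[OF le abs_ge_self] le)
    have "(\<integral>z. norm (g k z) \<partial>M) \<le> (\<integral>z. 2 ^ k * (norm (g k z))\<^sup>2 + (1/2) ^ k \<partial>M)"
      by (rule integral_mono[OF int i]) (use le in auto)
    also have "\<dots> = 2 ^ k * (L2sq M (\<lambda>z. g k z)) + (1/2) ^ k * m"
      using gL[of k] by (simp add: L2fun_def m_def)
    also have "\<dots> \<le> 2 ^ k * (1/4) ^ k + (1/2) ^ k * m"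
      using order_trans[OF bd[OF less_imp_le[OF r(2)[of k]]] r(1)] by (simp add: g_def)
    also have "2 ^ k * (1/4) ^ k = (1/2 :: real) ^ k" by (simp add: power_mult_distrib[symmetric])
    finally show ?thesis using int by (simp add: algebra_simps)
  qed
  have sumg: "AE z in M. summable (\<lambda>k. norm (g k z))"
  proof -
    have "(\<integral>\<^sup>+z. (\<Sum>k. ennreal (norm (g k z))) \<partial>M) = (\<Sum>k. \<integral>\<^sup>+z. ennreal (norm (g k z)) \<partial>M)"
      by (rule nn_integral_suminf) measurable
    also have "\<dots> \<le> (\<Sum>k. ennreal ((1/2) ^ k * (1 + m)))"
    proof (intro suminf_le allI)
      fix k
      show "(\<integral>\<^sup>+z. ennreal (norm (g k z)) \<partial>M) \<le> ennreal ((1/2) ^ k * (1 + m))"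
        using g1[of k] by (subst nn_integral_eq_integral) (auto intro: ennreal_leI)
    qed auto
    also have "\<dots> < top"
    proof -
      have "summable (\<lambda>k. (1/2::real) ^ k * (1 + m))" by (intro summable_mult2 summable_geometric) auto
      thus ?thesis by (subst suminf_ennreal2) (auto simp: m_def)
    qed
    finally have "AE z in M. (\<Sum>k. ennreal (norm (g k z))) \<noteq> \<infinity>"
      by (intro nn_integral_PInf_AE) auto
    thus ?thesis
      by eventually_elim (auto intro: summable_suminf_not_top)
  qed
  define f where "f z = lim (\<lambda>k. S (r k) z)" for z
  have [measurable]: "f \<in> borel_measurable M" unfolding f_def[abs_def] by measurable
  have conv: "AE z in M. (\<lambda>k. S (r k) z) \<longlonglongrightarrow> f z"
    using sumg
  proof eventually_elim
    fix z assume "summable (\<lambda>k. norm (g k z))"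
    hence "summable (\<lambda>k. g k z)" by (rule summable_norm_cancel)
    hence "convergent (\<lambda>k. S (r k) z - S (r 0) z)"
      using sum_lessThan_telescope[of "\<lambda>k. S (r k) z"] unfolding summable_iff_convergent g_def by simp
    hence "convergent (\<lambda>k. S (r k) z)" by (simp add: convergent_diff_const_right_iff)
    thus "(\<lambda>k. S (r k) z) \<longlonglongrightarrow> f z" by (simp add: f_def convergent_LIMSEQ_iff)
  qed
  have fatou: "(\<integral>\<^sup>+z. ennreal ((norm (f z - S N z))\<^sup>2) \<partial>M) \<le> ennreal (T N)" for N
  proof -
    have "(\<integral>\<^sup>+z. ennreal ((norm (f z - S N z))\<^sup>2) \<partial>M) = (\<integral>\<^sup>+z. liminf (\<lambda>k. ennreal ((norm (S (r k) z - S N z))\<^sup>2)) \<partial>M)"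
    proof (rule nn_integral_cong_AE)
      show "AE z in M. ennreal ((norm (f z - S N z))\<^sup>2) = liminf (\<lambda>k. ennreal ((norm (S (r k) z - S N z))\<^sup>2))"
        using conv
      proof eventually_elim
        fix z assume c: "(\<lambda>k. S (r k) z) \<longlonglongrightarrow> f z"
        have "(\<lambda>k. ennreal ((norm (S (r k) z - S N z))\<^sup>2)) \<longlonglongrightarrow> ennreal ((norm (f z - S N z))\<^sup>2)"
          by (intro tendsto_intros c)
        thus "ennreal ((norm (f z - S N z))\<^sup>2) = liminf (\<lambda>k. ennreal ((norm (S (r k) z - S N z))\<^sup>2))"
          by (intro lim_imp_Liminf[symmetric]) auto
      qed
    qed
    also have "\<dots> \<le> liminf (\<lambda>k. \<integral>\<^sup>+z. ennreal ((norm (S (r k) z - S N z))\<^sup>2) \<partial>M)"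
      by (rule nn_integral_liminf) measurable
    also have "\<dots> \<le> ennreal (T N)"
    proof (rule Liminf_le)
      have "r k \<ge> k" for k using r(2) by (simp add: seq_suble strict_mono_Suc_iff)
      hence "(\<integral>\<^sup>+z. ennreal ((norm (S (r k) z - S N z))\<^sup>2) \<partial>M) \<le> ennreal (T N)" if "k \<ge> N" for k
        using bd[of N "r k"] L2fun_norm_integrable[OF L2fun_diff[OF S S]] order_trans[OF that]
        by (subst nn_integral_eq_integral) (auto intro!: ennreal_leI)
      thus "\<forall>\<^sub>F k in sequentially. (\<integral>\<^sup>+z. ennreal ((norm (S (r k) z - S N z))\<^sup>2) \<partial>M) \<le> ennreal (T N)"
        by (auto simp: eventually_sequentially)
    qed simp
    finally show ?thesis .
  qed
  have T0: "T N \<ge> 0" for N using order_trans[OF _ bd[of N N]] by simp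
  have diffL: "L2fun M (\<lambda>z. f z - S N z)" for N
    unfolding L2fun_def using fatou[of N] by (auto simp: integrable_iff_bounded intro: le_less_trans)
  have "L2fun M f" using L2fun_add[OF diffL[of 0] S[of 0]] by simp
  moreover have "(L2sq M (\<lambda>z. f z - S N z)) \<le> T N" for N
    using fatou[of N] L2fun_norm_integrable[OF diffL[of N]] T0[of N]
    by (subst (asm) nn_integral_eq_integral) auto
  hence "(\<lambda>N. L2sq M (\<lambda>z. f z - S N z)) \<longlonglongrightarrow> 0"
    by (intro tendsto_sandwich[OF _ _ tendsto_const T]) auto
  ultimately show ?thesis by blast
qed

text \<open>The basis is real-valued and completeness is asked for real functions, which is what the
  moment argument supplies; \<open>coef_unique\<close> treats complex functions through real and
  imaginary parts.\<close>

locale real_orthonormal_basis = finite_measure M for M :: "complex measure" +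
  fixes p :: "nat \<Rightarrow> complex \<Rightarrow> real"
  assumes p_measurable [measurable]: "\<And>n. p n \<in> borel_measurable M"
    and p_square_integrable: "\<And>n. integrable M (\<lambda>z. (p n z)\<^sup>2)"
    and p_orthonormal: "\<And>m n. (\<integral>z. p m z * p n z \<partial>M) = (if m = n then 1 else 0)"
    and p_complete: "\<And>g. g \<in> borel_measurable M \<Longrightarrow> integrable M (\<lambda>z. (g z)\<^sup>2) \<Longrightarrow>
         (\<And>n. (\<integral>z. g z * p n z \<partial>M) = 0) \<Longrightarrow> AE z in M. g z = (0::real)"
begin

abbreviation cp :: "nat \<Rightarrow> complex \<Rightarrow> complex" where "cp n z \<equiv> complex_of_real (p n z)"

lemma cp_L2: "L2fun M (cp n)"
  using p_square_integrable[of n] by (simp add: L2fun_def)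

lemma cp_orthonormal: "(\<integral>z. cp m z * cp n z \<partial>M) = (if m = n then 1 else 0)"
  unfolding of_real_mult[symmetric] integral_complex_of_real p_orthonormal by simp

definition partial :: "(nat \<Rightarrow> complex) \<Rightarrow> nat \<Rightarrow> complex \<Rightarrow> complex" where
  "partial x N z = (\<Sum>n<N. x n * cp n z)"

text \<open>No conjugation appears because the basis is real.\<close>

definition coef :: "(complex \<Rightarrow> complex) \<Rightarrow> nat \<Rightarrow> complex" where
  "coef f n = (\<integral>z. f z * cp n z \<partial>M)"

lemma partial_L2: "L2fun M (partial x N)"
  unfolding partial_def[abs_def] by (intro L2fun_sum L2fun_scale cp_L2)

lemma integral_sum_cp:
  assumes f: "L2fun M f" and F: "finite F"
  shows "(\<integral>z. f z * (\<Sum>n\<in>F. y n * cp n z) \<partial>M) = (\<Sum>n\<in>F. y n * coef f n)"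
proof -
  have "(\<integral>z. f z * (\<Sum>n\<in>F. y n * cp n z) \<partial>M) = (\<integral>z. (\<Sum>n\<in>F. y n * (f z * cp n z)) \<partial>M)"
    by (simp add: sum_distrib_left mult_ac)
  also have "\<dots> = (\<Sum>n\<in>F. \<integral>z. y n * (f z * cp n z) \<partial>M)"
    by (intro Bochner_Integration.integral_sum integrable_mult_right L2fun_mult_integrable f cp_L2)
  finally show ?thesis by (simp add: coef_def)
qed

lemma coef_sum_cp:
  assumes F: "finite F"
  shows "coef (\<lambda>z. \<Sum>n\<in>F. x n * cp n z) j = (if j \<in> F then x j else 0)"
proof -
  have "coef (\<lambda>z. \<Sum>n\<in>F. x n * cp n z) j = (\<integral>z. cp j z * (\<Sum>n\<in>F. x n * cp n z) \<partial>M)"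
    unfolding coef_def by (simp add: mult.commute)
  also have "\<dots> = (\<Sum>n\<in>F. x n * coef (cp j) n)" by (rule integral_sum_cp[OF cp_L2 F])
  also have "\<dots> = (\<Sum>n\<in>F. if n = j then x n else 0)"
    by (rule sum.cong) (auto simp: coef_def cp_orthonormal)
  finally show ?thesis using F by simp
qed

lemma parseval_defect:
  assumes f: "L2fun M f" and F: "finite F"
  shows "(L2sq M (\<lambda>z. f z - (\<Sum>n\<in>F. coef f n * cp n z))) = (L2sq M f) - (\<Sum>n\<in>F. (norm (coef f n))\<^sup>2)"
proof -
  define S where "S z = (\<Sum>n\<in>F. coef f n * cp n z)" for z
  have S: "L2fun M S" unfolding S_def[abs_def] by (intro L2fun_sum L2fun_scale cp_L2)
  have cS: "cnj (S z) = (\<Sum>n\<in>F. cnj (coef f n) * cp n z)" for z by (simp add: S_def)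
  have cSL: "L2fun M (\<lambda>z. cnj (S z))" unfolding cS by (intro L2fun_sum L2fun_scale cp_L2)
  have 1: "(\<integral>z. f z * cnj (S z) \<partial>M) = of_real (\<Sum>n\<in>F. (norm (coef f n))\<^sup>2)"
    unfolding cS integral_sum_cp[OF f F] by (simp add: complex_norm_square mult.commute flip: of_real_power)
  have 2: "(\<integral>z. S z * cnj (S z) \<partial>M) = of_real (\<Sum>n\<in>F. (norm (coef f n))\<^sup>2)"
  proof -
    have "(\<integral>z. S z * cnj (S z) \<partial>M) = (\<Sum>n\<in>F. cnj (coef f n) * coef S n)"
      unfolding cS by (rule integral_sum_cp[OF S F])
    also have "\<dots> = (\<Sum>n\<in>F. cnj (coef f n) * coef f n)"
      using coef_sum_cp[OF F, of "coef f"] unfolding S_def[abs_def] by (intro sum.cong) auto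
    finally show ?thesis by (simp add: complex_norm_square mult.commute flip: of_real_power)
  qed
  have re: "(norm (f z - S z))\<^sup>2 = (norm (f z))\<^sup>2 - 2 * Re (f z * cnj (S z)) + Re (S z * cnj (S z))" for z
    unfolding cmod_power2 by (simp add: power2_eq_square algebra_simps)
  have i: "integrable M (\<lambda>z. f z * cnj (S z))" "integrable M (\<lambda>z. S z * cnj (S z))"
    by (intro L2fun_mult_integrable f S cSL)+
  have "(L2sq M (\<lambda>z. f z - S z)) = (L2sq M f) - 2 * (\<integral>z. Re (f z * cnj (S z)) \<partial>M) + (\<integral>z. Re (S z * cnj (S z)) \<partial>M)"
    unfolding re using L2fun_norm_integrable[OF f] integrable_Re[OF i(1)] integrable_Re[OF i(2)] by (simp del: times_complex.sel)
  also have "(\<integral>z. Re (f z * cnj (S z)) \<partial>M) = Re (\<integral>z. f z * cnj (S z) \<partial>M)" using i(1) by (rule integral_Re)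
  also have "(\<integral>z. Re (S z * cnj (S z)) \<partial>M) = Re (\<integral>z. S z * cnj (S z) \<partial>M)" using i(2) by (rule integral_Re)
  finally show ?thesis unfolding 1 2 by (simp add: S_def)
qed

lemma bessel: "L2fun M f \<Longrightarrow> l2seq (coef f)"
  unfolding l2seq_def
proof (rule summableI_nonneg_bounded)
  fix N assume f: "L2fun M f"
  show "(\<Sum>n<N. (norm (coef f n))\<^sup>2) \<le> (L2sq M f)"
    using parseval_defect[OF f, of "{..<N}"] by (smt (verit) Bochner_Integration.integral_nonneg finite_lessThan zero_le_power2)
qed simp

text \<open>The tail sums of \<open>x\<close> bound the distances between partial sums, so
  \<open>L2_Cauchy_limit\<close> applies. Coefficients pass to the limit by continuity, and the
  Parseval defect tending to 0 gives the norm.\<close>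

lemma L2_expansion:
  assumes x: "l2seq x"
  shows "\<exists>f. L2fun M f \<and> coef f = x \<and> (L2sq M f) = (\<Sum>n. (norm (x n))\<^sup>2)
     \<and> (\<lambda>N. L2sq M (\<lambda>z. f z - partial x N z)) \<longlonglongrightarrow> 0"
proof -
  have sm: "summable (\<lambda>n. (norm (x n))\<^sup>2)" using x by (simp add: l2seq_def)
  define T where "T N = (\<Sum>n. (norm (x (n + N)))\<^sup>2)" for N
  have "T \<longlonglongrightarrow> 0" unfolding T_def[abs_def] by (rule suminf_exist_split2[OF sm])
  moreover have "(L2sq M (\<lambda>z. partial x K z - partial x N z)) \<le> T N" if NK: "N \<le> K" for N K
  proof -
    define S where "S z = (\<Sum>n\<in>{N..<K}. x n * cp n z)" for z
    have S: "partial x K z - partial x N z = S z" for z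
      unfolding partial_def S_def using NK sum_diff_nat_ivl[of 0 N K "\<lambda>n. x n * cp n z"] by (simp add: atLeast0LessThan)
    have SL: "L2fun M S" unfolding S_def[abs_def] by (intro L2fun_sum L2fun_scale cp_L2)
    have cS: "coef S n = (if n \<in> {N..<K} then x n else 0)" for n
      unfolding S_def[abs_def] by (rule coef_sum_cp) simp
    have "(L2sq M (\<lambda>z. S z - (\<Sum>n\<in>{N..<K}. coef S n * cp n z))) = 0"
      unfolding cS by (simp add: S_def)
    hence "(L2sq M S) = (\<Sum>n\<in>{N..<K}. (norm (x n))\<^sup>2)"
      using parseval_defect[OF SL, of "{N..<K}"] by (simp add: cS)
    also have "\<dots> = (\<Sum>n<K - N. (norm (x (n + N)))\<^sup>2)"
      using NK sum.shift_bounds_nat_ivl[of "\<lambda>n. (norm (x n))\<^sup>2" 0 N "K - N"] by (simp add: atLeast0LessThan)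
    also have "\<dots> \<le> T N" unfolding T_def
      by (rule sum_le_suminf) (use sm summable_iff_shift[of "\<lambda>n. (norm (x n))\<^sup>2" N] in auto)
    finally show ?thesis unfolding S .
  qed
  ultimately obtain f where f: "L2fun M f" and lim: "(\<lambda>N. L2sq M (\<lambda>z. f z - partial x N z)) \<longlonglongrightarrow> 0"
    using L2_Cauchy_limit[OF finite_measure_axioms, of "partial x" T] partial_L2 by blast
  have cf: "coef f = x"
  proof
    fix j
    have "(\<lambda>N. \<integral>z. partial x N z * cp j z \<partial>M) \<longlonglongrightarrow> coef f j"
      unfolding coef_def by (rule tendsto_integral_mult_L2[OF f partial_L2 cp_L2 lim])
    moreover have "\<forall>\<^sub>F N in sequentially. (\<integral>z. partial x N z * cp j z \<partial>M) = x j"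
      using eventually_gt_at_top[of j]
    proof eventually_elim
      fix N assume "j < N"
      thus "(\<integral>z. partial x N z * cp j z \<partial>M) = x j"
        using coef_sum_cp[of "{..<N}" x j] by (simp add: coef_def partial_def)
    qed
    ultimately show "coef f j = x j" using LIMSEQ_unique[OF _ tendsto_eventually] by blast
  qed
  have "(\<lambda>N. (L2sq M f) - (\<Sum>n<N. (norm (x n))\<^sup>2)) \<longlonglongrightarrow> 0"
    using lim parseval_defect[OF f, of "{..<_}"] unfolding cf partial_def by simp
  hence "(\<lambda>N. (L2sq M f) - ((L2sq M f) - (\<Sum>n<N. (norm (x n))\<^sup>2))) \<longlonglongrightarrow> (L2sq M f) - 0"
    by (intro tendsto_intros)
  hence "(\<lambda>n. (norm (x n))\<^sup>2) sums (L2sq M f)" by (simp add: sums_def)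
  thus ?thesis using f cf lim sums_unique by blast
qed

lemma coef_unique:
  assumes f: "L2fun M f" and g: "L2fun M g" and e: "coef f = coef g"
  shows "AE z in M. f z = g z"
proof -
  define d where "d z = f z - g z" for z
  have d: "L2fun M d" unfolding d_def[abs_def] by (intro L2fun_diff f g)
  have [measurable]: "d \<in> borel_measurable M" using d by (rule L2fun_measurable)
  have i: "integrable M (\<lambda>z. d z * cp n z)" for n by (intro L2fun_mult_integrable d cp_L2)
  have z: "(\<integral>z. d z * cp n z \<partial>M) = 0" for n
    using L2fun_mult_integrable[OF f cp_L2[of n]] L2fun_mult_integrable[OF g cp_L2[of n]] fun_cong[OF e, of n]
    by (simp add: d_def left_diff_distrib coef_def)
  have sq: "integrable M (\<lambda>z. (Re (d z))\<^sup>2)" "integrable M (\<lambda>z. (Im (d z))\<^sup>2)"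
    by (rule Bochner_Integration.integrable_bound[OF L2fun_norm_integrable[OF d]]; simp add: cmod_power2)+
  have "AE z in M. Re (d z) = 0"
  proof (rule p_complete)
    show "(\<integral>z. Re (d z) * p n z \<partial>M) = 0" for n
      using integral_Re[OF i[of n]] z[of n] by simp
  qed (use sq in auto)
  moreover have "AE z in M. Im (d z) = 0"
  proof (rule p_complete)
    show "(\<integral>z. Im (d z) * p n z \<partial>M) = 0" for n
      using integral_Im[OF i[of n]] z[of n] by simp
  qed (use sq in auto)
  ultimately show ?thesis by eventually_elim (simp add: d_def complex_eq_iff)
qed

text \<open>The j-th coefficient of h * U x is the integral of U x against h * p_j. Inserting the
  partial sums of U x turns it into the limit of the partial row sums of \<open>H\<close>, so
  convergence of the rows, square summability (by Bessel) and the intertwining relation come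
  together.\<close>

theorem diagonalisation:
  fixes h :: "complex \<Rightarrow> real" and H :: "nat \<Rightarrow> nat \<Rightarrow> real"
  assumes h_meas [measurable]: "h \<in> borel_measurable M" and h_bound: "\<And>z. z \<in> space M \<Longrightarrow> \<bar>h z\<bar> \<le> Q"
    and H: "\<And>j k. (\<integral>z. h z * p j z * p k z \<partial>M) = H j k"
  shows "\<exists>U :: (nat \<Rightarrow> complex) \<Rightarrow> complex \<Rightarrow> complex.
     (\<forall>x. l2seq x \<longrightarrow> L2fun M (U x))
   \<and> (\<forall>x y. l2seq x \<longrightarrow> l2seq y \<longrightarrow> (AE z in M. U (\<lambda>n. x n + y n) z = U x z + U y z))
   \<and> (\<forall>x s. l2seq x \<longrightarrow> (AE z in M. U (\<lambda>n. s * x n) z = s * U x z))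
   \<and> (\<forall>x. l2seq x \<longrightarrow> (\<integral>z. (norm (U x z))\<^sup>2 \<partial>M) = (\<Sum>n. (norm (x n))\<^sup>2))
   \<and> (\<forall>f. L2fun M f \<longrightarrow> (\<exists>x. l2seq x \<and> (AE z in M. U x z = f z)))
   \<and> (\<forall>n. AE z in M. U (ebasis n) z = cp n z)
   \<and> (\<forall>x. l2seq x \<longrightarrow>
          (\<forall>j. summable (\<lambda>k. complex_of_real (H j k) * x k))
        \<and> l2seq (\<lambda>j. \<Sum>k. complex_of_real (H j k) * x k)
        \<and> (AE z in M. U (\<lambda>j. \<Sum>k. complex_of_real (H j k) * x k) z = complex_of_real (h z) * U x z))"
proof -
  \<comment> \<open>The limit function is determined only almost everywhere, so one is chosen for
    each sequence; linearity accordingly holds almost everywhere.\<close>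
  define U where "U x = (SOME f. L2fun M f \<and> coef f = x \<and> (L2sq M f) = (\<Sum>n. (norm (x n))\<^sup>2)
     \<and> (\<lambda>N. L2sq M (\<lambda>z. f z - partial x N z)) \<longlonglongrightarrow> 0)" for x
  have U: "L2fun M (U x)" "coef (U x) = x" "(L2sq M (\<lambda>z. U x z)) = (\<Sum>n. (norm (x n))\<^sup>2)"
     "(\<lambda>N. L2sq M (\<lambda>z. U x z - partial x N z)) \<longlonglongrightarrow> 0" if "l2seq x" for x
    using someI_ex[OF L2_expansion[OF that]] unfolding U_def by blast+
  have Ueq: "AE z in M. U x z = f z" if "L2fun M f" "coef f = x" for f x
  proof -
    have "l2seq x" using bessel[OF that(1)] that(2) by simp
    thus ?thesis using coef_unique[OF U(1) that(1)] U(2) that(2) by simp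
  qed
  have add: "AE z in M. U (\<lambda>n. x n + y n) z = U x z + U y z" if "l2seq x" "l2seq y" for x y
  proof (rule Ueq)
    show "L2fun M (\<lambda>z. U x z + U y z)" by (intro L2fun_add U that)
    have "coef (\<lambda>z. U x z + U y z) n = coef (U x) n + coef (U y) n" for n
      using L2fun_mult_integrable[OF U(1)[OF that(1)] cp_L2[of n]] L2fun_mult_integrable[OF U(1)[OF that(2)] cp_L2[of n]]
      by (simp add: coef_def distrib_right)
    thus "coef (\<lambda>z. U x z + U y z) = (\<lambda>n. x n + y n)" using U(2) that by auto
  qed
  have scale: "AE z in M. U (\<lambda>n. s * x n) z = s * U x z" if "l2seq x" for x s
  proof (rule Ueq)
    show "L2fun M (\<lambda>z. s * U x z)" by (intro L2fun_scale U that)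
    have "coef (\<lambda>z. s * U x z) n = s * coef (U x) n" for n
      by (simp add: coef_def mult.assoc)
    thus "coef (\<lambda>z. s * U x z) = (\<lambda>n. s * x n)" using U(2) that by auto
  qed
  have surj: "\<exists>x. l2seq x \<and> (AE z in M. U x z = f z)" if "L2fun M f" for f
    using bessel[OF that] Ueq[OF that refl] by blast
  have basis: "AE z in M. U (ebasis n) z = cp n z" for n
    by (rule Ueq[OF cp_L2]) (auto simp: coef_def cp_orthonormal ebasis_def fun_eq_iff)
  have op: "(\<forall>j. summable (\<lambda>k. complex_of_real (H j k) * x k))
        \<and> l2seq (\<lambda>j. \<Sum>k. complex_of_real (H j k) * x k)
        \<and> (AE z in M. U (\<lambda>j. \<Sum>k. complex_of_real (H j k) * x k) z = complex_of_real (h z) * U x z)" if x: "l2seq x" for x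
  proof -
    have hL: "L2fun M (\<lambda>z. complex_of_real (h z) * f z)" if f: "L2fun M f" for f
    proof -
      have [measurable]: "f \<in> borel_measurable M" using f by (rule L2fun_measurable)
      have "integrable M (\<lambda>z. (norm (complex_of_real (h z) * f z))\<^sup>2)"
      proof (rule Bochner_Integration.integrable_bound)
        show "integrable M (\<lambda>z. Q\<^sup>2 * (norm (f z))\<^sup>2)" using f by (simp add: L2fun_def)
        show "AE z in M. norm ((norm (complex_of_real (h z) * f z))\<^sup>2) \<le> norm (Q\<^sup>2 * (norm (f z))\<^sup>2)"
        proof (rule AE_I2)
          fix z assume "z \<in> space M"
          from power_mono[OF h_bound[OF this], of 2]
          show "norm ((norm (complex_of_real (h z) * f z))\<^sup>2) \<le> norm (Q\<^sup>2 * (norm (f z))\<^sup>2)"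
            by (simp add: norm_mult power_mult_distrib mult_right_mono)
        qed
      qed measurable
      thus ?thesis by (simp add: L2fun_def)
    qed
    define g where "g z = complex_of_real (h z) * U x z" for z
    have gL: "L2fun M g" unfolding g_def[abs_def] by (intro hL U x)
    have "(\<lambda>k. complex_of_real (H j k) * x k) sums coef g j" for j
    proof -
      have "(\<lambda>N. \<integral>z. partial x N z * (complex_of_real (h z) * cp j z) \<partial>M) \<longlonglongrightarrow> (\<integral>z. U x z * (complex_of_real (h z) * cp j z) \<partial>M)"
        by (intro tendsto_integral_mult_L2 U partial_L2 hL cp_L2 x)
      moreover have "(\<integral>z. U x z * (complex_of_real (h z) * cp j z) \<partial>M) = coef g j"
        by (simp add: coef_def g_def mult_ac)
      moreover have "(\<integral>z. partial x N z * (complex_of_real (h z) * cp j z) \<partial>M) = (\<Sum>k<N. complex_of_real (H j k) * x k)" for N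
      proof -
        have "(\<integral>z. partial x N z * (complex_of_real (h z) * cp j z) \<partial>M) =
              (\<integral>z. (complex_of_real (h z) * cp j z) * (\<Sum>k<N. x k * cp k z) \<partial>M)"
          by (simp add: partial_def mult.commute)
        also have "\<dots> = (\<Sum>k<N. x k * coef (\<lambda>z. complex_of_real (h z) * cp j z) k)"
          by (rule integral_sum_cp[OF hL[OF cp_L2]]) simp
        also have "\<dots> = (\<Sum>k<N. complex_of_real (H j k) * x k)"
          unfolding coef_def of_real_mult[symmetric] integral_complex_of_real H by (simp add: mult.commute)
        finally show ?thesis .
      qed
      ultimately show ?thesis by (simp add: sums_def)
    qed
    hence s: "summable (\<lambda>k. complex_of_real (H j k) * x k)" "(\<Sum>k. complex_of_real (H j k) * x k) = coef g j" for j
      using sums_summable sums_unique by (blast, metis)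
    show ?thesis unfolding s(2) using s(1) bessel[OF gL] Ueq[OF gL refl] by (simp add: g_def eta_contract_eq)
  qed
  show ?thesis
    by (rule exI[of _ U]) (use U add scale surj basis op in blast)
qed

end

section \<open>The orthogonality measure\<close>

text \<open>The product (t-1)...(t-k) in the sign convention of \<open>wmass\<close>, where a
  Pochhammer symbol starts at a - c + 1 = 1 - (c - a).\<close>

lemma Gamma_shift_down:
  fixes t :: real
  assumes "t - real k > 0"
  shows "Gamma t = (-1) ^ k * pochhammer (1 - t) k * Gamma (t - real k)"
proof -
  have "pochhammer (t - real k) k = Gamma t / Gamma (t - real k)"
    using pochhammer_Gamma[of "t - real k" k] pos_notin_nonpos_Ints[OF assms] by simp
  hence "Gamma t = pochhammer (t - real k) k * Gamma (t - real k)"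
    using Gamma_real_nz[OF assms] by simp
  moreover have "pochhammer (1 - t) k = (-1) ^ k * pochhammer (t - real k) k"
    using pochhammer_minus'[of "t - 1" k] by simp
  hence "(-1) ^ k * pochhammer (1 - t) k = pochhammer (t - real k) k"
    by (simp add: mult.assoc[symmetric] power_mult_distrib[symmetric])
  ultimately show ?thesis by simp
qed

lemma Gamma_shift_up: "t > 0 \<Longrightarrow> Gamma (t + real k) = pochhammer t k * Gamma (t::real)"
  using pochhammer_Gamma[of t k] pos_notin_nonpos_Ints[of t] Gamma_real_nz[of t] by simp

text \<open>This is (A+ix)_n (A-ix)_n at y = x^2. As a polynomial in y it also applies at the atoms,
  where y = -(C+k)^2.\<close>

definition rp :: "real \<Rightarrow> nat \<Rightarrow> real \<Rightarrow> real" where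
  "rp A n y = (\<Prod>j<n. (A + real j)\<^sup>2 + y)"

lemma phi_plus_nat: "A > 0 \<or> x \<noteq> 0 \<Longrightarrow> phi (A + real n) x = rp A n (x\<^sup>2) * phi A x"
proof (induction n)
  case (Suc n)
  have "phi (A + real (Suc n)) x = phi ((A + real n) + 1) x" by (simp add: add_ac)
  also have "\<dots> = ((A + real n)\<^sup>2 + x\<^sup>2) * phi (A + real n) x" using Suc.prems by (intro phi_plus1) auto
  finally show ?case using Suc by (simp add: rp_def)
qed (simp add: rp_def)

lemma psi_plus_nat:
  assumes "A - (C + real k) > 0" "A + (C + real k) > 0"
  shows "psi C k (A + real n) = rp A n (- ((C + real k)\<^sup>2)) * psi C k A"
proof (induction n)
  case (Suc n)
  let ?s = "C + real k"
  have "psi C k (A + real (Suc n)) = Gamma ((A + real n - ?s) + 1) * Gamma ((A + real n + ?s) + 1)"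
    unfolding psi_def by (simp add: algebra_simps)
  also have "\<dots> = ((A + real n - ?s) * (A + real n + ?s)) * psi C k (A + real n)"
    using Gamma_real_plus1[of "A + real n - ?s"] Gamma_real_plus1[of "A + real n + ?s"] assms
    unfolding psi_def by simp
  also have "(A + real n - ?s) * (A + real n + ?s) = (A + real n)\<^sup>2 + - (?s\<^sup>2)"
    by (simp add: algebra_simps power2_eq_square)
  finally show ?case using Suc by (simp add: rp_def)
qed (simp add: rp_def)

text \<open>On the support z^2 is real (\<open>Mset_square\<close>); taking the real part gives a
  real measurable function on the whole plane.\<close>

definition ysq :: "complex \<Rightarrow> real" where "ysq z = Re (z\<^sup>2)"

lemma ysq_measurable [measurable]: "ysq \<in> borel_measurable borel"
  unfolding ysq_def[abs_def] by measurable

lemma rp_measurable [measurable]: "rp A n \<in> borel_measurable borel"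
  unfolding rp_def[abs_def] by measurable

locale hahn_params =
  fixes a b c :: real
  assumes a: "a > 0" and b: "b > 0" and c: "c > 0" and abc: "a < b + c" and bac: "b < a + c"
begin

definition al :: real where "al = (b + c - a) / 2"
definition be :: real where "be = (a + c - b) / 2"
definition ga :: real where "ga = (a + b - c) / 2"
definition kap :: real where "kap = 1 / (Gamma a * Gamma b * Gamma c)"

lemma al_pos: "al > 0" and be_pos: "be > 0"
  using abc bac by (simp_all add: al_def be_def)

lemma sums: "al + be = c" "al + ga = b" "be + ga = a" "al + al = b + c - a"
  by (simp_all add: al_def be_def ga_def field_simps)

lemma kap_pos: "kap > 0"
  using a b c by (simp add: kap_def)

text \<open>For an integer k, k <= ceiling s - 1 means k < s strictly, so ga + k = 0 gives no
  atom.\<close>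

lemma atoms_eq: "atoms a b c = atomset ga"
proof -
  have "int k \<le> \<lceil>(c - a - b) / 2\<rceil> - 1 \<longleftrightarrow> ga + real k < 0" for k
  proof -
    have "int k \<le> \<lceil>(c - a - b) / 2\<rceil> - 1 \<longleftrightarrow> int k < \<lceil>(c - a - b) / 2\<rceil>" by linarith
    also have "\<dots> \<longleftrightarrow> real k < (c - a - b) / 2" by (simp add: less_ceiling_iff)
    finally show ?thesis by (simp add: ga_def field_simps)
  qed
  moreover have "ga + real k \<ge> 0" if "\<not> c > a + b" for k using that by (simp add: ga_def)
  ultimately show ?thesis by (auto simp: atoms_def Nbound_def atomset_def not_less)
qed

lemma lam_eq: "lam a b c k = \<i> * complex_of_real (ga + real k)"
  by (simp add: lam_def ga_def)

lemma rho_eq: "rho a b c x = kap * om al be ga x"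
proof -
  have H: "(cmod (Gamma (complex_of_real ((b + c - a) / 2) + \<i> * complex_of_real x) *
            Gamma (complex_of_real ((a + c - b) / 2) + \<i> * complex_of_real x) *
            Gamma (complex_of_real ((a + b - c) / 2) + \<i> * complex_of_real x)))\<^sup>2 = phi al x * phi be x * phi ga x"
    unfolding phi_def al_def be_def ga_def norm_mult power_mult_distrib Complex_eq ..
  show ?thesis unfolding rho_def H om_def w0_def kap_def by (simp add: mult_ac)
qed

lemma atom_pos:
  assumes "k \<in> atomset ga"
  shows "al - (ga + real k) > 0" "al + (ga + real k) > 0" "be - (ga + real k) > 0" "be + (ga + real k) > 0"
  using assms al_pos be_pos sums a b by (auto simp: atomset_def)

text \<open>Rewrites the given mass in the Gamma form of \<open>mass3\<close> and
  \<open>mass4\<close>, using c - a = al - ga, c - b = be - ga, b = al + ga and a = be + ga. Each of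
  the three downward shifts contributes a sign (-1)^k.\<close>

lemma wmass_eq:
  assumes k: "k \<in> atomset ga"
  shows "wmass a b c k = kap * (atom_factor ga k * (psi ga k al * psi ga k be))"
proof -
  have gk: "ga + real k < 0" using k by (simp add: atomset_def)
  have g0: "ga < 0" using gk by simp
  define s :: real where "s = (-1) ^ k"
  have ss: "s * s = 1" "s \<noteq> 0" by (simp_all add: s_def power_mult_distrib[symmetric])
  have p1: "Gamma (c - a) = s * pochhammer (a - c + 1) k * Gamma (c - a - real k)"
    using Gamma_shift_down[of "c - a" k] atom_pos(1)[OF k] by (simp add: s_def al_def ga_def field_simps)
  have p2: "Gamma (c - b) = s * pochhammer (b - c + 1) k * Gamma (c - b - real k)"
    using Gamma_shift_down[of "c - b" k] atom_pos(3)[OF k] by (simp add: s_def be_def ga_def field_simps)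
  have p3: "Gamma (1 - 2 * ga) = s * pochhammer (a + b - c) k * Gamma (1 - 2 * ga - real k)"
  proof -
    have e: "1 - (1 - 2 * ga) = a + b - c" by (simp add: ga_def field_simps)
    have "1 - 2 * ga - real k > 0" using gk g0 by linarith
    from Gamma_shift_down[OF this] show ?thesis unfolding s_def e .
  qed
  \<comment> \<open>Expanding Gamma(1 - 2 ga) in two ways, by k steps and by one step, yields the
    reciprocal Gamma in \<open>atom_factor\<close>.\<close>
  have p4: "Gamma (1 - 2 * ga) = (- 2 * ga) * Gamma (c - a - b)"
  proof -
    have e: "1 - 2 * ga = (c - a - b) + 1" "- 2 * ga = c - a - b" by (simp_all add: ga_def field_simps)
    have "c - a - b > 0" using g0 by (simp add: ga_def)
    from Gamma_real_plus1[OF this] show ?thesis unfolding e .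
  qed
  have nz: "Gamma (c - a) \<noteq> 0" "Gamma (c - b) \<noteq> 0" "Gamma (c - a - b) \<noteq> 0" "Gamma (1 - 2 * ga - real k) \<noteq> 0"
  proof -
    have "c - a > 0" "c - b > 0" "c - a - b > 0" using g0 a b by (auto simp: ga_def)
    moreover have "1 - 2 * ga - real k > 0" using gk g0 by linarith
    ultimately show "Gamma (c - a) \<noteq> 0" "Gamma (c - b) \<noteq> 0" "Gamma (c - a - b) \<noteq> 0" "Gamma (1 - 2 * ga - real k) \<noteq> 0"
      using Gamma_real_nz by blast+
  qed
  have nzp: "pochhammer (a - c + 1) k \<noteq> 0" "pochhammer (b - c + 1) k \<noteq> 0" using p1 p2 nz by auto
  have r: "atom_factor ga k = (1 + 2 * real k / (a + b - c)) * s * pochhammer (a + b - c) k / (fact k * Gamma (c - a - b))"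
  proof -
    have i: "1 / Gamma (1 - 2 * ga - real k) = s * pochhammer (a + b - c) k / ((- 2 * ga) * Gamma (c - a - b))"
    proof -
      have e: "(- 2 * ga) * Gamma (c - a - b) = s * pochhammer (a + b - c) k * Gamma (1 - 2 * ga - real k)"
        using p3 p4 by simp
      have "(- 2 * ga) * Gamma (c - a - b) \<noteq> 0" using nz g0 by simp
      thus ?thesis unfolding e by simp
    qed
    have "atom_factor ga k = (- 2 * (ga + real k)) / fact k * (1 / Gamma (1 - 2 * ga - real k))"
      by (simp add: atom_factor_def)
    also have "\<dots> = ((ga + real k) / ga) * s * pochhammer (a + b - c) k / (fact k * Gamma (c - a - b))"
    proof -
      have "(- 2 * u) / f * (t * p / ((- 2 * g) * q)) = (u / g) * t * p / (f * q)" if "g \<noteq> 0" for u f t p g q :: real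
        using that by (cases "f = 0"; cases "q = 0") (auto simp: field_simps)
      moreover have "ga \<noteq> 0" using g0 by simp
      ultimately show ?thesis unfolding i by blast
    qed
    also have "(ga + real k) / ga = 1 + 2 * real k / (a + b - c)"
      using g0 by (simp add: ga_def field_simps)
    finally show ?thesis .
  qed
  have ps1: "psi ga k al = Gamma (c - a - real k) * (pochhammer b k * Gamma b)"
  proof -
    have e: "al - (ga + real k) = c - a - real k" "al + (ga + real k) = b + real k" by (simp_all add: al_def ga_def field_simps)
    show ?thesis unfolding psi_def e Gamma_shift_up[OF b] ..
  qed
  have ps2: "psi ga k be = Gamma (c - b - real k) * (pochhammer a k * Gamma a)"
  proof -
    have e: "be - (ga + real k) = c - b - real k" "be + (ga + real k) = a + real k" by (simp_all add: be_def ga_def field_simps)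
    show ?thesis unfolding psi_def e Gamma_shift_up[OF a] ..
  qed
  have "kap * (atom_factor ga k * (psi ga k al * psi ga k be)) =
     (1 + 2 * real k / (a + b - c)) * s * pochhammer (a + b - c) k * Gamma (c - a - real k) * pochhammer b k * Gamma (c - b - real k) * pochhammer a k / (Gamma c * fact k * Gamma (c - a - b))"
    unfolding r ps1 ps2 kap_def using Gamma_real_nz[OF a] Gamma_real_nz[OF b] by simp
  also have "\<dots> = wmass a b c k"
  proof -
    have "wmass a b c k = s * (s * pochhammer (a - c + 1) k * Gamma (c - a - real k)) * (s * pochhammer (b - c + 1) k * Gamma (c - b - real k)) / (Gamma c * Gamma (c - a - b)) *
     (1 + 2 * real k / (a + b - c)) *
     (pochhammer (a + b - c) k * pochhammer a k * pochhammer b k /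
      (pochhammer (a - c + 1) k * pochhammer (b - c + 1) k * fact k))"
      unfolding wmass_def s_def[symmetric] p1 p2 ..
    also have "\<dots> = (s * s) * s * Gamma (c - a - real k) * Gamma (c - b - real k) / (Gamma c * Gamma (c - a - b)) *
     (1 + 2 * real k / (a + b - c)) * (pochhammer (a + b - c) k * pochhammer a k * pochhammer b k / fact k)"
      using nzp by (simp add: mult_ac)
    finally show ?thesis unfolding ss by (simp add: mult_ac)
  qed
  finally show ?thesis ..
qed

lemma wmass_pos:
  assumes k: "k \<in> atomset ga"
  shows "wmass a b c k > 0"
proof -
  have gk: "ga + real k < 0" using k by (simp add: atomset_def)
  have "1 - 2 * ga - real k > 0" using gk by simp
  from Gamma_real_pos[OF this] have "fact k * Gamma (1 - 2 * ga - real k) > 0" by (intro mult_pos_pos fact_gt_zero)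
  moreover have "- 2 * (ga + real k) > 0" by (rule mult_neg_neg) (use gk in auto)
  ultimately have "atom_factor ga k > 0" unfolding atom_factor_def by (rule divide_pos_pos[rotated])
  moreover have "psi ga k al > 0" "psi ga k be > 0" unfolding psi_def using atom_pos[OF k] by auto
  ultimately show ?thesis unfolding wmass_eq[OF k] using kap_pos by simp
qed

lemma rho_nonneg: "x \<ge> 0 \<Longrightarrow> rho a b c x \<ge> 0"
  unfolding rho_eq using kap_pos om_nonneg by (simp add: less_imp_le)

lemma rho_measurable [measurable]: "rho a b c \<in> borel_measurable borel"
  unfolding rho_eq[abs_def] by measurable

subsection \<open>The measure as a push-forward from the real line\<close>

text \<open>The atom with index \<open>k\<close> is the image of the unit interval \<open>(-k-1, -k]\<close>.\<close>

definition cell :: "nat \<Rightarrow> real set" where "cell k = {- (real k + 1) <.. - real k}"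

text \<open>The default 1 is an arbitrary point of the support, so that the map stays inside it;
  \<open>line_density\<close> is 0 where the default is taken.\<close>

definition line_map :: "real \<Rightarrow> complex" where
  "line_map x = (if x > 0 then of_real x else if nat \<lfloor>-x\<rfloor> \<in> atomset ga then lam a b c (nat \<lfloor>-x\<rfloor>) else 1)"

definition line_density :: "real \<Rightarrow> real" where
  "line_density x = (if x > 0 then rho a b c x else if nat \<lfloor>-x\<rfloor> \<in> atomset ga then wmass a b c (nat \<lfloor>-x\<rfloor>) else 0)"

lemma cell_iff: "x \<le> 0 \<Longrightarrow> x \<in> cell k \<longleftrightarrow> nat \<lfloor>-x\<rfloor> = k"
  unfolding cell_def by (simp add: nat_eq_iff floor_eq_iff) linarith

lemma cell_pos: "x > 0 \<Longrightarrow> x \<notin> cell k"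
  unfolding cell_def by auto

lemma cell_measurable [measurable]: "cell k \<in> sets borel"
  unfolding cell_def by simp

lemma line_map_measurable [measurable]: "line_map \<in> borel_measurable borel"
  unfolding line_map_def[abs_def] by measurable

lemma line_density_measurable [measurable]: "line_density \<in> borel_measurable borel"
  unfolding line_density_def[abs_def] by measurable

lemma line_density_nonneg: "line_density x \<ge> 0"
  unfolding line_density_def using rho_nonneg wmass_pos by (auto simp: less_imp_le)

lemma sum_cells:
  fixes v :: "nat \<Rightarrow> 'b :: semiring_1"
  shows "x \<le> 0 \<Longrightarrow> (\<Sum>k\<in>atomset ga. indicator (cell k) x * v k) = (if nat \<lfloor>-x\<rfloor> \<in> atomset ga then v (nat \<lfloor>-x\<rfloor>) else 0)"
proof -
  assume x: "x \<le> 0"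
  have "(\<Sum>k\<in>atomset ga. indicator (cell k) x * v k) = (\<Sum>k\<in>atomset ga. if nat \<lfloor>-x\<rfloor> = k then v k else 0)"
    by (rule sum.cong) (auto simp: indicator_def cell_iff[OF x])
  thus ?thesis by simp
qed

text \<open>Used with \<open>u = ennreal\<close> for the measure and with the identity for real
  integrals; \<open>u 0 = 0\<close> covers the part of the line that carries no mass.\<close>

lemma line_density_split:
  fixes u :: "real \<Rightarrow> 'b :: semiring_1"
  assumes u: "u 0 = 0"
  shows "u (line_density x) * f (line_map x) = indicator {0<..} x * (u (rho a b c x) * f (of_real x))
     + (\<Sum>k\<in>atomset ga. indicator (cell k) x * (u (wmass a b c k) * f (lam a b c k)))"
proof (cases "x > 0")
  case True
  thus ?thesis by (simp add: line_density_def line_map_def cell_pos)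
next
  case False
  hence "x \<le> 0" by simp
  show ?thesis unfolding sum_cells[OF \<open>x \<le> 0\<close>] using False u by (simp add: line_density_def line_map_def)
qed

lemma emeasure_cell: "emeasure lborel (cell k) = 1"
  unfolding cell_def by simp

lemma measure_cell: "measure lborel (cell k) = 1"
  unfolding cell_def by simp

lemma TT_Mset: "line_map x \<in> Mset a b c"
proof -
  have "(1::complex) = of_real 1" by simp
  hence "(1::complex) \<in> complex_of_real ` {0<..}" by (rule image_eqI) simp
  thus ?thesis by (auto simp: line_map_def Mset_def atoms_eq)
qed

lemma line_map_measurable_restrict [measurable]: "line_map \<in> measurable borel (restrict_space borel (Mset a b c))"
  by (rule measurable_restrict_space2) (auto simp: TT_Mset)

text \<open>It is enough to compare set functions: countable additivity of the explicit formula is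
  inherited from the push-forward, and integrals against \<open>mu\<close> become Lebesgue
  integrals.\<close>

lemma mu_eq: "mu a b c = distr (density lborel (\<lambda>x. ennreal (line_density x))) (restrict_space borel (Mset a b c)) line_map"
proof -
  let ?R = "restrict_space borel (Mset a b c)"
  let ?N = "distr (density lborel (\<lambda>x. ennreal (line_density x))) ?R line_map"
  have sp: "space ?R = Mset a b c" by (simp add: space_restrict_space)
  have "mu a b c = measure_of (space ?R) (sets ?R) (emeasure ?N)"
    unfolding mu_def sp
  proof (rule measure_of_eq)
    show sub: "sets ?R \<subseteq> Pow (Mset a b c)" using sets.sets_into_space[of _ ?R] unfolding sp by auto
    fix A assume "A \<in> sigma_sets (Mset a b c) (sets ?R)"
    hence A: "A \<in> sets ?R" using sets.sigma_sets_eq[of ?R] unfolding sp by simp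
    hence [measurable]: "A \<in> sets ?R" .
    obtain B where B: "B \<in> sets borel" "A = B \<inter> Mset a b c" using A by (auto simp: sets_restrict_space)
    have [measurable]: "{x. 0 < x \<and> complex_of_real x \<in> A} \<in> sets borel"
    proof -
      have "{x. 0 < x \<and> complex_of_real x \<in> A} = {x. 0 < x \<and> complex_of_real x \<in> B}"
        unfolding B by (auto simp: Mset_def)
      also have "\<dots> \<in> sets borel" using B(1) by measurable
      finally show ?thesis .
    qed
    have "emeasure ?N A = emeasure (density lborel (\<lambda>x. ennreal (line_density x))) (line_map -` A)"
      by (subst emeasure_distr) auto
    also have "\<dots> = (\<integral>\<^sup>+x. ennreal (line_density x) * indicator A (line_map x) \<partial>lborel)"
    proof (subst emeasure_density)
      have "line_map -` A \<inter> space borel \<in> sets borel" by (rule measurable_sets[OF line_map_measurable_restrict A])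
      thus "line_map -` A \<in> sets lborel" by simp
      show "(\<integral>\<^sup>+x. ennreal (line_density x) * indicator (line_map -` A) x \<partial>lborel) = (\<integral>\<^sup>+x. ennreal (line_density x) * indicator A (line_map x) \<partial>lborel)"
        by (simp add: indicator_def)
    qed measurable
    also have "\<dots> = (\<integral>\<^sup>+x. ennreal (rho a b c x) * indicator {x. 0 < x \<and> complex_of_real x \<in> A} x
         + (\<Sum>k\<in>atomset ga. indicator (cell k) x * (ennreal (wmass a b c k) * indicator A (lam a b c k))) \<partial>lborel)"
      unfolding line_density_split[where u = ennreal, OF ennreal_0] by (intro nn_integral_cong arg_cong2[where f = "(+)"]) (auto simp: indicator_def)
    also have "\<dots> = (\<integral>\<^sup>+x. ennreal (rho a b c x) * indicator {x. 0 < x \<and> complex_of_real x \<in> A} x \<partial>lborel)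
         + (\<Sum>k\<in>atomset ga. \<integral>\<^sup>+x. indicator (cell k) x * (ennreal (wmass a b c k) * indicator A (lam a b c k)) \<partial>lborel)"
    proof -
      have [measurable]: "(\<lambda>x. ennreal (rho a b c x) * indicator {x. 0 < x \<and> complex_of_real x \<in> A} x) \<in> borel_measurable lborel"
        by measurable
      have [measurable]: "(\<lambda>x. indicator (cell k) x * (ennreal (wmass a b c k) * indicator A (lam a b c k))) \<in> borel_measurable lborel" for k
        by measurable
      have m: "(\<lambda>x. \<Sum>k\<in>atomset ga. indicator (cell k) x * (ennreal (wmass a b c k) * indicator A (lam a b c k))) \<in> borel_measurable lborel"
        by (rule borel_measurable_sum) measurable
      have "(\<integral>\<^sup>+x. (\<Sum>k\<in>atomset ga. indicator (cell k) x * (ennreal (wmass a b c k) * indicator A (lam a b c k))) \<partial>lborel) =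
            (\<Sum>k\<in>atomset ga. \<integral>\<^sup>+x. indicator (cell k) x * (ennreal (wmass a b c k) * indicator A (lam a b c k)) \<partial>lborel)"
        by (rule nn_integral_sum) measurable
      thus ?thesis by (subst nn_integral_add[OF _ m]) simp_all
    qed
    also have "(\<Sum>k\<in>atomset ga. \<integral>\<^sup>+x. indicator (cell k) x * (ennreal (wmass a b c k) * indicator A (lam a b c k)) \<partial>lborel)
        = (\<Sum>k\<in>atomset ga. ennreal (wmass a b c k) * indicator A (lam a b c k))"
      by (rule sum.cong) (auto simp: nn_integral_multc emeasure_cell)
    also have "\<dots> = (\<Sum>k\<in>{k\<in>atoms a b c. lam a b c k \<in> A}. ennreal (wmass a b c k))"
      unfolding atoms_eq by (rule sum.mono_neutral_cong_right) auto
    finally show "(\<integral>\<^sup>+x. ennreal (rho a b c x) * indicator {x. 0 < x \<and> complex_of_real x \<in> A} x \<partial>lborel)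
          + (\<Sum>k\<in>{k\<in>atoms a b c. lam a b c k \<in> A}. ennreal (wmass a b c k)) = emeasure ?N A" ..
  qed
  also have "\<dots> = ?N" using measure_of_of_measure[of ?N] by simp
  finally show ?thesis .
qed

lemma space_mu: "space (mu a b c) = Mset a b c"
  by (simp add: mu_eq space_restrict_space)

lemma sets_mu: "sets (mu a b c) = sets (restrict_space borel (Mset a b c))"
  by (simp add: mu_eq)

lemma borel_measurable_mu: "f \<in> borel_measurable borel \<Longrightarrow> f \<in> borel_measurable (mu a b c)"
  using measurable_restrict_space1[of f borel borel "Mset a b c"] sets_mu measurable_cong_sets by blast

lemma line_map_compose:
  assumes "f \<in> borel_measurable (mu a b c)"
  shows "(\<lambda>x. f (line_map x)) \<in> borel_measurable borel"
proof -
  have "f \<in> borel_measurable (restrict_space borel (Mset a b c))"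
    using assms measurable_cong_sets[OF sets_mu refl] by blast
  from measurable_compose[OF line_map_measurable_restrict this] show ?thesis .
qed

lemma integrable_mu_iff:
  fixes f :: "complex \<Rightarrow> real"
  assumes [measurable]: "f \<in> borel_measurable (mu a b c)"
  shows "integrable (mu a b c) f \<longleftrightarrow> integrable lborel (\<lambda>x. line_density x * f (line_map x))"
    and "(\<integral>z. f z \<partial>mu a b c) = (\<integral>x. line_density x * f (line_map x) \<partial>lborel)"
proof -
  have [measurable]: "f \<in> borel_measurable (restrict_space borel (Mset a b c))"
    using assms measurable_cong_sets[OF sets_mu refl] by blast
  have [measurable]: "(\<lambda>x. f (line_map x)) \<in> borel_measurable borel" using line_map_compose assms by blast
  show "integrable (mu a b c) f \<longleftrightarrow> integrable lborel (\<lambda>x. line_density x * f (line_map x))"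
    unfolding mu_eq by (subst integrable_distr_eq) (auto simp: integrable_density line_density_nonneg)
  show "(\<integral>z. f z \<partial>mu a b c) = (\<integral>x. line_density x * f (line_map x) \<partial>lborel)"
    unfolding mu_eq by (subst integral_distr) (auto simp: integral_density line_density_nonneg)
qed

lemma integrable_cells: "integrable lborel (\<lambda>x. \<Sum>k\<in>atomset ga. indicator (cell k) x * (v k :: real))"
  by (intro Bochner_Integration.integrable_sum integrable_mult_left) (simp add: integrable_indicator_iff emeasure_cell)

lemma integral_cells: "(\<integral>x. (\<Sum>k\<in>atomset ga. indicator (cell k) x * (v k :: real)) \<partial>lborel) = (\<Sum>k\<in>atomset ga. v k)"
proof -
  have "(\<integral>x. (\<Sum>k\<in>atomset ga. indicator (cell k) x * v k) \<partial>lborel) = (\<Sum>k\<in>atomset ga. \<integral>x. indicator (cell k) x * v k \<partial>lborel)"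
    by (intro Bochner_Integration.integral_sum integrable_mult_left) (simp add: integrable_indicator_iff emeasure_cell)
  thus ?thesis by (simp add: measure_cell)
qed

lemma mu_integral:
  fixes f :: "complex \<Rightarrow> real"
  assumes f: "f \<in> borel_measurable (mu a b c)"
  shows "integrable (mu a b c) f \<longleftrightarrow> set_integrable lborel {0<..} (\<lambda>x. rho a b c x * f (of_real x))"
    and "integrable (mu a b c) f \<Longrightarrow> (\<integral>z. f z \<partial>mu a b c) =
       (LINT x:{0<..}|lborel. rho a b c x * f (of_real x)) + (\<Sum>k\<in>atomset ga. wmass a b c k * f (lam a b c k))"
proof -
  have e: "(\<lambda>x. line_density x * f (line_map x)) = (\<lambda>x. indicator {0<..} x *\<^sub>R (rho a b c x * f (of_real x)) +
     (\<Sum>k\<in>atomset ga. indicator (cell k) x * (wmass a b c k * f (lam a b c k))))"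
    using line_density_split[of "\<lambda>t. t" _ f] by (simp add: fun_eq_iff)
  show 1: "integrable (mu a b c) f \<longleftrightarrow> set_integrable lborel {0<..} (\<lambda>x. rho a b c x * f (of_real x))"
    unfolding integrable_mu_iff(1)[OF f] e set_integrable_def
  proof
    assume "integrable lborel (\<lambda>x. indicator {0<..} x *\<^sub>R (rho a b c x * f (of_real x)) +
       (\<Sum>k\<in>atomset ga. indicator (cell k) x * (wmass a b c k * f (lam a b c k))))"
    from Bochner_Integration.integrable_diff[OF this integrable_cells[of "\<lambda>k. wmass a b c k * f (lam a b c k)"]]
    show "integrable lborel (\<lambda>x. indicator {0<..} x *\<^sub>R (rho a b c x * f (of_real x)))"
      unfolding add_diff_cancel_right' .
  qed (intro Bochner_Integration.integrable_add integrable_cells)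
  assume "integrable (mu a b c) f"
  hence "set_integrable lborel {0<..} (\<lambda>x. rho a b c x * f (of_real x))" using 1 by simp
  thus "(\<integral>z. f z \<partial>mu a b c) =
       (LINT x:{0<..}|lborel. rho a b c x * f (of_real x)) + (\<Sum>k\<in>atomset ga. wmass a b c k * f (lam a b c k))"
    unfolding integrable_mu_iff(2)[OF f] e set_lebesgue_integral_def set_integrable_def
    by (subst Bochner_Integration.integral_add[OF _ integrable_cells]) (simp_all only: integral_cells)
qed

lemma AE_mu_zero:
  fixes f :: "complex \<Rightarrow> real"
  assumes [measurable]: "f \<in> borel_measurable (mu a b c)"
    and "AE x in lborel. x > 0 \<longrightarrow> f (of_real x) = 0" and at: "\<And>k. k \<in> atomset ga \<Longrightarrow> f (lam a b c k) = 0"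
  shows "AE z in mu a b c. f z = 0"
proof -
  have fm [measurable]: "f \<in> borel_measurable (restrict_space borel (Mset a b c))"
    using assms(1) measurable_cong_sets[OF sets_mu refl] by blast
  have "AE x in lborel. line_density x > 0 \<longrightarrow> f (line_map x) = 0"
    using assms(2) by eventually_elim (auto simp: line_density_def line_map_def at)
  thus ?thesis unfolding mu_eq
    by (subst AE_distr_iff) (auto simp: AE_density)
qed

end

section \<open>Orthonormality and matrix elements\<close>

text \<open>Pascal's rule; up to sign the alternating sum is the n-th finite difference of
  \<open>f\<close> at 0.\<close>

lemma alternating_binomial_Suc:
  fixes f :: "nat \<Rightarrow> real"
  shows "(\<Sum>k\<le>Suc n. (-1) ^ k * real (Suc n choose k) * f k) =
     (\<Sum>k\<le>n. (-1) ^ k * real (n choose k) * f k) - (\<Sum>k\<le>n. (-1) ^ k * real (n choose k) * f (Suc k))"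
proof -
  have "(\<Sum>k\<le>Suc n. (-1) ^ k * real (Suc n choose k) * f k) =
     f 0 + (\<Sum>k\<le>n. (-1) ^ Suc k * real (Suc n choose Suc k) * f (Suc k))"
    by (subst sum.atMost_Suc_shift) simp
  also have "(\<Sum>k\<le>n. (-1) ^ Suc k * real (Suc n choose Suc k) * f (Suc k)) =
     (\<Sum>k\<le>n. (-1) ^ Suc k * real (n choose Suc k) * f (Suc k) - (-1) ^ k * real (n choose k) * f (Suc k))"
    by (rule sum.cong) (auto simp: algebra_simps)
  also have "f 0 + \<dots> = (f 0 + (\<Sum>k\<le>n. (-1) ^ Suc k * real (n choose Suc k) * f (Suc k))) - (\<Sum>k\<le>n. (-1) ^ k * real (n choose k) * f (Suc k))"
    unfolding sum_subtractf by simp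
  also have "f 0 + (\<Sum>k\<le>n. (-1) ^ Suc k * real (n choose Suc k) * f (Suc k)) = (\<Sum>k\<le>Suc n. (-1) ^ k * real (n choose k) * f k)"
    by (subst sum.atMost_Suc_shift) simp
  finally show ?thesis by simp
qed

text \<open>The family of quotients is closed under differences, since k -> k+1 amounts to s -> s+1.
  Negative t is included: for t = -m the factor (-m)_n vanishes when m < n.\<close>

lemma Gamma_Vandermonde:
  fixes s t :: real
  assumes "s > 0" "s + t > 0"
  shows "(\<Sum>k\<le>n. (-1) ^ k * real (n choose k) * (Gamma (s + real k) / Gamma (s + t + real k))) =
     pochhammer t n * Gamma s / Gamma (s + t + real n)"
  using assms
proof (induction n arbitrary: s)
  case (Suc n)
  let ?f = "\<lambda>s k. Gamma (s + real k) / Gamma (s + t + real k)"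
  have sh: "?f s (Suc k) = ?f (s + 1) k" for k by (simp add: add_ac)
  have p: "s + t + real n > 0" using Suc.prems by simp
  have "(\<Sum>k\<le>Suc n. (-1) ^ k * real (Suc n choose k) * ?f s k) =
      (\<Sum>k\<le>n. (-1) ^ k * real (n choose k) * ?f s k) - (\<Sum>k\<le>n. (-1) ^ k * real (n choose k) * ?f (s + 1) k)"
    unfolding alternating_binomial_Suc sh ..
  also have "\<dots> = pochhammer t n * Gamma s / Gamma (s + t + real n) - pochhammer t n * Gamma (s + 1) / Gamma (s + 1 + t + real n)"
    using Suc.IH[of s] Suc.IH[of "s + 1"] Suc.prems by simp
  also have "s + 1 + t + real n = (s + t + real n) + 1" by simp
  also have "pochhammer t n * Gamma s / Gamma (s + t + real n) - pochhammer t n * Gamma (s + 1) / Gamma ((s + t + real n) + 1)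
     = pochhammer t (Suc n) * Gamma s / Gamma ((s + t + real n) + 1)"
    unfolding Gamma_real_plus1[OF p] Gamma_real_plus1[OF Suc.prems(1)]
    using p Gamma_real_nz[OF p] by (simp add: pochhammer_Suc divide_simps) (simp add: algebra_simps)
  finally show ?case by (simp add: add_ac)
qed simp

text \<open>Since (A+n)^2 + y = ((B+i)^2 + y) + ((A+n)^2 - (B+i)^2), the change between the two
  bases is unitriangular, which preserves the leading coefficient.\<close>

lemma rp_rebase:
  fixes C :: "nat \<Rightarrow> real"
  shows "\<exists>q. q n = C n \<and> (\<forall>y. (\<Sum>k\<le>n. C k * rp A k y) = (\<Sum>i\<le>n. q i * rp B i y))"
proof -
  have single: "\<exists>d. d n = (1::real) \<and> (\<forall>y. rp A n y = (\<Sum>i\<le>n. d i * rp B i y))" for n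
  proof (induction n)
    case 0
    show ?case by (rule exI[of _ "\<lambda>_. 1"]) (simp add: rp_def)
  next
    case (Suc n)
    then obtain d where d: "d n = 1" "\<And>y. rp A n y = (\<Sum>i\<le>n. d i * rp B i y)" by blast
    define e where "e i = (A + real n)\<^sup>2 - (B + real i)\<^sup>2" for i
    define d' where "d' i = (if i = 0 then 0 else d (i - 1)) + (if i \<le> n then d i * e i else 0)" for i
    have "d' (Suc n) = 1" by (simp add: d'_def d)
    moreover have "rp A (Suc n) y = (\<Sum>i\<le>Suc n. d' i * rp B i y)" for y
    proof -
      have "rp A (Suc n) y = (\<Sum>i\<le>n. d i * rp B i y) * ((A + real n)\<^sup>2 + y)"
        using d(2)[of y] by (simp add: rp_def)
      also have "\<dots> = (\<Sum>i\<le>n. d i * rp B (Suc i) y + d i * e i * rp B i y)"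
        unfolding sum_distrib_right by (rule sum.cong) (auto simp: rp_def e_def algebra_simps)
      also have "\<dots> = (\<Sum>i\<le>n. d i * rp B (Suc i) y) + (\<Sum>i\<le>n. d i * e i * rp B i y)"
        by (rule sum.distrib)
      also have "(\<Sum>i\<le>n. d i * rp B (Suc i) y) = (\<Sum>i\<le>Suc n. (if i = 0 then 0 else d (i - 1)) * rp B i y)"
        by (subst sum.atMost_Suc_shift) simp
      also have "(\<Sum>i\<le>n. d i * e i * rp B i y) = (\<Sum>i\<le>Suc n. (if i \<le> n then d i * e i else 0) * rp B i y)"
        by simp
      finally show ?thesis unfolding d'_def distrib_right sum.distrib .
    qed
    ultimately show ?case by blast
  qed
  show ?thesis
  proof (induction n)
    case 0
    show ?case by (rule exI[of _ C]) (simp add: rp_def)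
  next
    case (Suc n)
    then obtain q where q: "\<And>y. (\<Sum>k\<le>n. C k * rp A k y) = (\<Sum>i\<le>n. q i * rp B i y)" by blast
    obtain d where d: "d (Suc n) = 1" "\<And>y. rp A (Suc n) y = (\<Sum>i\<le>Suc n. d i * rp B i y)" using single[of "Suc n"] by blast
    define q' where "q' i = (if i \<le> n then q i else 0) + C (Suc n) * d i" for i
    have "(\<Sum>k\<le>Suc n. C k * rp A k y) = (\<Sum>i\<le>Suc n. q' i * rp B i y)" for y
    proof -
      have "(\<Sum>k\<le>Suc n. C k * rp A k y) = (\<Sum>i\<le>n. q i * rp B i y) + C (Suc n) * (\<Sum>i\<le>Suc n. d i * rp B i y)"
        using q d(2) by simp
      also have "(\<Sum>i\<le>n. q i * rp B i y) = (\<Sum>i\<le>Suc n. (if i \<le> n then q i else 0) * rp B i y)" by simp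
      finally show ?thesis unfolding q'_def distrib_right sum.distrib sum_distrib_left by (simp only: mult.assoc)
    qed
    moreover have "q' (Suc n) = C (Suc n)" by (simp add: q'_def d)
    ultimately show ?case by blast
  qed
qed

section \<open>The polynomials and the multiplier on the support\<close>

context hahn_params
begin

definition nrm :: "nat \<Rightarrow> real" where
  "nrm n = sqrt (pochhammer b n * pochhammer c n / (pochhammer a n * fact n))"

text \<open>(-n)_k / k! is written as a signed binomial coefficient, to match
  \<open>Gamma_Vandermonde\<close>.\<close>

definition pc :: "nat \<Rightarrow> nat \<Rightarrow> real" where
  "pc n k = nrm n * ((-1) ^ k * real (n choose k) / (pochhammer b k * pochhammer c k))"

definition pn :: "nat \<Rightarrow> real \<Rightarrow> real" where
  "pn n y = (\<Sum>k\<le>n. pc n k * rp al k y)"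

lemma pn_measurable [measurable]: "pn n \<in> borel_measurable borel"
  unfolding pn_def[abs_def]
  by (intro borel_measurable_sum borel_measurable_times borel_measurable_const rp_measurable)

lemma ysq_of_real [simp]: "ysq (complex_of_real x) = x\<^sup>2"
  by (simp add: ysq_def flip: of_real_power)

lemma ysq_lam: "ysq (lam a b c k) = - ((ga + real k)\<^sup>2)"
proof -
  have "(lam a b c k)\<^sup>2 = of_real (- ((ga + real k)\<^sup>2))"
    unfolding lam_eq power_mult_distrib of_real_power[symmetric] by simp
  thus ?thesis unfolding ysq_def by (simp only: Re_complex_of_real)
qed

lemma Mset_cases:
  assumes "z \<in> Mset a b c"
  obtains (cont) x where "x > 0" "z = of_real x" | (atom) k where "k \<in> atomset ga" "z = lam a b c k"
proof -
  have "(\<exists>x>0. z = of_real x) \<or> (\<exists>k\<in>atomset ga. z = lam a b c k)"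
    using assms unfolding Mset_def atoms_eq by blast
  thus ?thesis using cont atom by blast
qed

lemma Mset_square: "z \<in> Mset a b c \<Longrightarrow> z\<^sup>2 = of_real (ysq z)"
  by (erule Mset_cases, simp, simp only: ysq_lam) (simp add: lam_eq power_mult_distrib)

lemma Phat_eq: "z \<in> Mset a b c \<Longrightarrow> Phat a b c n z = of_real (pn n (ysq z))"
proof -
  assume z: "z \<in> Mset a b c"
  have pr: "pochhammer (complex_of_real (alphap a b c) + \<i> * z) k * pochhammer (complex_of_real (alphap a b c) - \<i> * z) k
      = of_real (rp al k (ysq z))" for k
  proof -
    have "pochhammer (complex_of_real (alphap a b c) + \<i> * z) k * pochhammer (complex_of_real (alphap a b c) - \<i> * z) k
       = (\<Prod>j<k. (of_real al + \<i> * z + of_nat j) * (of_real al - \<i> * z + of_nat j))"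
      unfolding pochhammer_prod prod.distrib[symmetric] by (simp add: atLeast0LessThan alphap_def al_def)
    also have "\<dots> = (\<Prod>j<k. of_real ((al + real j)\<^sup>2 + ysq z))"
    proof (rule prod.cong)
      fix j
      have "(of_real al + \<i> * z + of_nat j) * (of_real al - \<i> * z + of_nat j) = (of_real al + of_nat j)\<^sup>2 + z\<^sup>2"
        by (simp add: power2_eq_square algebra_simps)
      thus "(of_real al + \<i> * z + of_nat j) * (of_real al - \<i> * z + of_nat j) = of_real ((al + real j)\<^sup>2 + ysq z)"
        unfolding Mset_square[OF z] by simp
    qed simp
    finally show ?thesis by (simp add: rp_def)
  qed
  have bin: "pochhammer (- of_nat n) k / (fact k :: complex) = of_real ((-1) ^ k * real (n choose k))" for k
  proof -
    have "(of_nat (n choose k) :: complex) = (-1) ^ k * pochhammer (- of_nat n) k / fact k"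
      by (simp add: binomial_gbinomial gbinomial_pochhammer)
    hence "(-1) ^ k * (of_nat (n choose k) :: complex) = ((-1) ^ k * (-1) ^ k) * (pochhammer (- of_nat n) k / fact k)"
      by simp
    also have "(-1) ^ k * (-1) ^ k = (1::complex)" by (simp add: power_mult_distrib[symmetric])
    finally show ?thesis by simp
  qed
  have "pochhammer (- of_nat n) k * pochhammer (complex_of_real (alphap a b c) + \<i> * z) k
              * pochhammer (complex_of_real (alphap a b c) - \<i> * z) k
              / (complex_of_real (pochhammer b k * pochhammer c k) * fact k) =
        of_real ((-1) ^ k * real (n choose k) / (pochhammer b k * pochhammer c k) * rp al k (ysq z))" for k
  proof -
    have "pochhammer (- of_nat n) k * pochhammer (complex_of_real (alphap a b c) + \<i> * z) k
              * pochhammer (complex_of_real (alphap a b c) - \<i> * z) k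
              / (complex_of_real (pochhammer b k * pochhammer c k) * fact k) =
        (pochhammer (- of_nat n) k / fact k) * (pochhammer (complex_of_real (alphap a b c) + \<i> * z) k * pochhammer (complex_of_real (alphap a b c) - \<i> * z) k)
          / complex_of_real (pochhammer b k * pochhammer c k)"
      by (simp add: mult_ac)
    thus ?thesis unfolding pr bin by simp
  qed
  thus ?thesis unfolding Phat_def pn_def pc_def nrm_def
    by (simp add: sum_distrib_left mult.assoc)
qed

definition hfun_re :: "complex \<Rightarrow> real" where "hfun_re z = Re (hfun a b c z)"

lemma hfun_re_of_real: "hfun a b c (of_real x) = of_real (phi al x / Gamma (b + c - a))"
proof -
  have "complex_of_real (alphap a b c) + \<i> * of_real x = Complex al x"
       "complex_of_real (alphap a b c) - \<i> * of_real x = cnj (Complex al x)"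
    by (simp_all add: complex_eq_iff alphap_def al_def)
  hence "hfun a b c (of_real x) = (Gamma (Complex al x) * cnj (Gamma (Complex al x))) / of_real (Gamma (b + c - a))"
    unfolding hfun_def by (simp only: cnj_Gamma)
  also have "Gamma (Complex al x) * cnj (Gamma (Complex al x)) = of_real (phi al x)"
    unfolding phi_def complex_norm_square ..
  finally show ?thesis by simp
qed

lemma hfun_re_lam: "hfun a b c (lam a b c k) = of_real (psi ga k al / Gamma (b + c - a))"
proof -
  have "complex_of_real (alphap a b c) + \<i> * lam a b c k = of_real (al - (ga + real k))"
       "complex_of_real (alphap a b c) - \<i> * lam a b c k = of_real (al + (ga + real k))"
    unfolding lam_eq by (simp_all add: complex_eq_iff alphap_def al_def)
  thus ?thesis unfolding hfun_def psi_def by (simp only: Gamma_complex_of_real of_real_mult of_real_divide)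
qed

lemma hfun_eq: "z \<in> Mset a b c \<Longrightarrow> hfun a b c z = of_real (hfun_re z)"
  by (erule Mset_cases) (simp_all add: hfun_re_def hfun_re_of_real hfun_re_lam)

lemma hfun_re_measurable: "hfun_re \<in> borel_measurable borel"
proof -
  have "(\<lambda>z. rGamma (complex_of_real (alphap a b c) + \<i> * z)) \<in> borel_measurable borel"
       "(\<lambda>z. rGamma (complex_of_real (alphap a b c) - \<i> * z)) \<in> borel_measurable borel"
    by (intro borel_measurable_continuous_onI continuous_on_compose2[OF continuous_on_rGamma[of UNIV]] continuous_intros; simp)+
  hence "(\<lambda>z. Re (inverse (rGamma (complex_of_real (alphap a b c) + \<i> * z)) * inverse (rGamma (complex_of_real (alphap a b c) - \<i> * z)) /
      complex_of_real (Gamma (b + c - a)))) \<in> borel_measurable borel"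
    by measurable
  thus ?thesis by (simp add: hfun_re_def[abs_def] hfun_def Gamma_def)
qed

lemma hfun_re_bounded: "\<exists>Q. \<forall>z\<in>Mset a b c. \<bar>hfun_re z\<bar> \<le> Q"
proof -
  define g where "g = Gamma (b + c - a)"
  have g: "g > 0" unfolding g_def using abc by simp
  define Q where "Q = (Gamma al)\<^sup>2 / g + (\<Sum>k\<in>atomset ga. \<bar>psi ga k al / g\<bar>)"
  have "\<bar>hfun_re z\<bar> \<le> Q" if "z \<in> Mset a b c" for z
    using that
  proof (cases rule: Mset_cases)
    case (cont x)
    have "\<bar>hfun_re z\<bar> = phi al x / g" using cont g by (simp add: hfun_re_def hfun_re_of_real flip: g_def)
    also have "\<dots> \<le> (Gamma al)\<^sup>2 / g" using phi_le[OF al_pos] g by (intro divide_right_mono) auto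
    also have "\<dots> \<le> Q" unfolding Q_def by (simp add: sum_nonneg)
    finally show ?thesis .
  next
    case (atom k)
    have "\<bar>hfun_re z\<bar> = \<bar>psi ga k al / g\<bar>" using atom by (simp add: hfun_re_def hfun_re_lam flip: g_def)
    also have "\<dots> \<le> (\<Sum>k\<in>atomset ga. \<bar>psi ga k al / g\<bar>)"
      by (rule member_le_sum) (use atom in auto)
    also have "\<dots> \<le> Q" unfolding Q_def using g by simp
    finally show ?thesis .
  qed
  thus ?thesis by blast
qed

section \<open>Moments, orthonormality and matrix elements\<close>

lemma shift_pos: "al + real k > 0" "be + real k > 0" "al + real k + ga > 0" "be + real k + ga > 0"
proof -
  have "al + ga > 0" "be + ga > 0" using sums a b by auto
  thus "al + real k > 0" "be + real k > 0" "al + real k + ga > 0" "be + real k + ga > 0"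
    using al_pos be_pos by linarith+
qed

lemma om_shift: "x > 0 \<Longrightarrow> om (al + real k) (be + real m) ga x = rp al k (x\<^sup>2) * rp be m (x\<^sup>2) * om al be ga x"
  by (simp add: om_def phi_plus_nat)

lemma ysq_measurable_mu [measurable]: "ysq \<in> borel_measurable (mu a b c)"
  by (rule borel_measurable_mu) measurable

lemma hfun_re_measurable_mu [measurable]: "hfun_re \<in> borel_measurable (mu a b c)"
  by (rule borel_measurable_mu[OF hfun_re_measurable])

text \<open>The two polynomials raise al to al + k and be to be + m, in the density and at the atoms
  alike, so \<open>mass3_eq\<close> evaluates the integral.\<close>

lemma moment3:
  shows "integrable (mu a b c) (\<lambda>z. rp al k (ysq z) * rp be m (ysq z))"
    and "(\<integral>z. rp al k (ysq z) * rp be m (ysq z) \<partial>mu a b c) =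
       pochhammer b k * pochhammer a m * Gamma (c + real m + real k) / Gamma c"
proof -
  let ?f = "\<lambda>z. rp al k (ysq z) * rp be m (ysq z)"
  have fm: "?f \<in> borel_measurable (mu a b c)" by measurable
  have e: "rho a b c x * ?f (of_real x) = kap * om (al + real k) (be + real m) ga x" if "x \<in> {0<..}" for x
    using om_shift[of x k m] that by (simp add: rho_eq mult_ac)
  have "set_integrable lborel {0<..} (\<lambda>x. kap * om (al + real k) (be + real m) ga x)"
    by (intro set_integrable_mult_right om_integrable_const shift_pos)
  hence "set_integrable lborel {0<..} (\<lambda>x. rho a b c x * ?f (of_real x))"
    by (subst set_integrable_cong[OF refl refl e]) auto
  thus i: "integrable (mu a b c) ?f" using mu_integral(1)[OF fm] by simp
  have "(LINT x:{0<..}|lborel. rho a b c x * ?f (of_real x)) = (LINT x:{0<..}|lborel. kap * om (al + real k) (be + real m) ga x)"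
    by (rule set_lebesgue_integral_cong) (use e in auto)
  moreover have "(\<Sum>j\<in>atomset ga. wmass a b c j * ?f (lam a b c j)) = kap * (\<Sum>j\<in>atomset ga. atom_factor ga j * (psi ga j (al + real k) * psi ga j (be + real m)))"
    unfolding sum_distrib_left
  proof (rule sum.cong)
    fix j assume j: "j \<in> atomset ga"
    show "wmass a b c j * ?f (lam a b c j) = kap * (atom_factor ga j * (psi ga j (al + real k) * psi ga j (be + real m)))"
      unfolding wmass_eq[OF j] ysq_lam psi_plus_nat[OF atom_pos(1,2)[OF j]] psi_plus_nat[OF atom_pos(3,4)[OF j]]
      by (simp only: mult_ac)
  qed simp
  ultimately have "(\<integral>z. ?f z \<partial>mu a b c) = kap * mass3 (al + real k) (be + real m) ga"
    using mu_integral(2)[OF fm i] by (simp add: mass3_def distrib_left)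
  also have "mass3 (al + real k) (be + real m) ga = prod3 (al + real k) (be + real m) ga"
    by (rule mass3_eq) (rule shift_pos)+
  also have "prod3 (al + real k) (be + real m) ga = Gamma (c + real m + real k) * (pochhammer b k * Gamma b) * (pochhammer a m * Gamma a)"
  proof -
    have e: "al + real k + (be + real m) = c + real m + real k" "al + real k + ga = b + real k" "be + real m + ga = a + real m"
      using sums by simp_all
    show ?thesis unfolding prod3_def e Gamma_shift_up[OF a] Gamma_shift_up[OF b] ..
  qed
  finally show "(\<integral>z. ?f z \<partial>mu a b c) = pochhammer b k * pochhammer a m * Gamma (c + real m + real k) / Gamma c"
    unfolding kap_def using Gamma_real_nz[OF a] Gamma_real_nz[OF b] by simp
qed

text \<open>\<open>hfun_re\<close> supplies a second Gamma(al+ix) Gamma(al-ix), so each polynomial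
  has its own factor to raise: the parameters become al + k, al + m, be, ga.\<close>

lemma moment4:
  shows "integrable (mu a b c) (\<lambda>z. hfun_re z * (rp al k (ysq z) * rp al m (ysq z)))"
    and "(\<integral>z. hfun_re z * (rp al k (ysq z) * rp al m (ysq z)) \<partial>mu a b c) =
       (Gamma b * Gamma c / Gamma (b + c - a)) * (pochhammer b k * pochhammer c k) * (pochhammer b m * pochhammer c m)
         * (Gamma (b + c - a + real k + real m) / Gamma (b + c - a + real k + a + real m))"
proof -
  let ?g = "Gamma (b + c - a)"
  let ?f = "\<lambda>z. hfun_re z * (rp al k (ysq z) * rp al m (ysq z))"
  have fm: "?f \<in> borel_measurable (mu a b c)" by measurable
  have e: "rho a b c x * ?f (of_real x) = (kap / ?g) * (phi (al + real k) x * om (al + real m) be ga x)" if "x \<in> {0<..}" for x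
  proof -
    have x: "x > 0" using that by simp
    have h: "hfun_re (of_real x) = phi al x / ?g" by (simp add: hfun_re_def hfun_re_of_real)
    show ?thesis unfolding rho_eq h ysq_of_real using x by (simp add: om_def phi_plus_nat)
  qed
  have "set_integrable lborel {0<..} (\<lambda>x. (kap / ?g) * (phi (al + real k) x * om (al + real m) be ga x))"
    by (intro set_integrable_mult_right om_integrable_phi shift_pos be_pos)
  hence "set_integrable lborel {0<..} (\<lambda>x. rho a b c x * ?f (of_real x))"
    by (subst set_integrable_cong[OF refl refl e]) auto
  thus i: "integrable (mu a b c) ?f" using mu_integral(1)[OF fm] by simp
  have "(LINT x:{0<..}|lborel. rho a b c x * ?f (of_real x)) = (LINT x:{0<..}|lborel. (kap / ?g) * (phi (al + real k) x * om (al + real m) be ga x))"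
    by (rule set_lebesgue_integral_cong) (use e in auto)
  moreover have "(\<Sum>j\<in>atomset ga. wmass a b c j * ?f (lam a b c j)) = (kap / ?g) * (\<Sum>j\<in>atomset ga. atom_factor ga j * psi ga j (al + real k) * (psi ga j (al + real m) * psi ga j be))"
    unfolding sum_distrib_left
  proof (rule sum.cong)
    fix j assume j: "j \<in> atomset ga"
    have h: "hfun_re (lam a b c j) = psi ga j al / ?g" by (simp add: hfun_re_def hfun_re_lam)
    show "wmass a b c j * ?f (lam a b c j) = (kap / ?g) * (atom_factor ga j * psi ga j (al + real k) * (psi ga j (al + real m) * psi ga j be))"
      unfolding wmass_eq[OF j] ysq_lam psi_plus_nat[OF atom_pos(1,2)[OF j]] h by simp
  qed simp
  ultimately have "(\<integral>z. ?f z \<partial>mu a b c) = (kap / ?g) * mass4 (al + real k) (al + real m) be ga"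
    using mu_integral(2)[OF fm i] by (simp only: mass4_def distrib_left set_integral_mult_right)
  also have "mass4 (al + real k) (al + real m) be ga = prod4 (al + real k) (al + real m) be ga"
    by (rule mass4_eq) (use shift_pos[of k] shift_pos[of m] be_pos shift_pos(4)[of 0] in auto)
  also have "prod4 (al + real k) (al + real m) be ga = Gamma (b + c - a + real k + real m) * (pochhammer c k * Gamma c) * (pochhammer c m * Gamma c)
      * (pochhammer b k * Gamma b) * (pochhammer b m * Gamma b) * Gamma a / Gamma (b + c - a + real k + a + real m)"
  proof -
    have e: "al + real k + (al + real m) = b + c - a + real k + real m" "al + real k + be = c + real k"
      "al + real m + be = c + real m" "al + real k + ga = b + real k" "al + real m + ga = b + real m" "be + ga = a"
      "b + c - a + real k + real m + be + ga = b + c - a + real k + a + real m"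
      using sums by simp_all
    show ?thesis unfolding prod4_def e Gamma_shift_up[OF c] Gamma_shift_up[OF b] ..
  qed
  also have "(kap / ?g) * \<dots> = (Gamma b * Gamma c / ?g) * (pochhammer b k * pochhammer c k) * (pochhammer b m * pochhammer c m)
         * (Gamma (b + c - a + real k + real m) / Gamma (b + c - a + real k + a + real m))"
  proof -
    have gen: "(1 / (A * B * C) / g) * (N * (ck * C) * (cm * C) * (bk * B) * (bm * B) * A / D) =
        (B * C / g) * (bk * ck) * (bm * cm) * (N / D)" if "A \<noteq> 0" "B \<noteq> 0" "C \<noteq> 0" for A B C g N ck cm bk bm D :: real
      using that by simp
    show ?thesis
      unfolding kap_def by (rule gen[OF Gamma_real_nz[OF a] Gamma_real_nz[OF b] Gamma_real_nz[OF c]])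
  qed
  finally show "(\<integral>z. ?f z \<partial>mu a b c) = (Gamma b * Gamma c / ?g) * (pochhammer b k * pochhammer c k) * (pochhammer b m * pochhammer c m)
         * (Gamma (b + c - a + real k + real m) / Gamma (b + c - a + real k + a + real m))" .
qed

lemma poch_nz: "pochhammer a n \<noteq> 0" "pochhammer b n \<noteq> 0" "pochhammer c n \<noteq> 0"
  using pochhammer_pos[OF a, of n] pochhammer_pos[OF b, of n] pochhammer_pos[OF c, of n] by auto

lemma nrm_square: "nrm n * nrm n = pochhammer b n * pochhammer c n / (pochhammer a n * fact n)"
proof -
  have "pochhammer b n * pochhammer c n / (pochhammer a n * fact n) \<ge> 0"
    using pochhammer_pos[OF a, of n] pochhammer_pos[OF b, of n] pochhammer_pos[OF c, of n] by simp
  thus ?thesis by (simp only: nrm_def real_sqrt_mult_self abs_of_nonneg)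
qed

text \<open>By \<open>moment3\<close> the dependence on k reduces to Gamma(c+m+k) / (c)_k, a
  Vandermonde sum with t = -m; hence the value vanishes for m < n.\<close>

lemma pn_rp_be:
  shows "integrable (mu a b c) (\<lambda>z. pn n (ysq z) * rp be m (ysq z))"
    and "(\<integral>z. pn n (ysq z) * rp be m (ysq z) \<partial>mu a b c) =
       nrm n * pochhammer a m * pochhammer (- real m) n * Gamma (c + real m) / Gamma (c + real n)"
proof -
  have e: "(\<lambda>z. pn n (ysq z) * rp be m (ysq z)) = (\<lambda>z. \<Sum>k\<le>n. pc n k * (rp al k (ysq z) * rp be m (ysq z)))"
    by (simp add: pn_def sum_distrib_right mult.assoc fun_eq_iff)
  show "integrable (mu a b c) (\<lambda>z. pn n (ysq z) * rp be m (ysq z))"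
    unfolding e by (intro Bochner_Integration.integrable_sum integrable_mult_right moment3)
  have "(\<integral>z. pn n (ysq z) * rp be m (ysq z) \<partial>mu a b c) = (\<Sum>k\<le>n. pc n k * (pochhammer b k * pochhammer a m * Gamma (c + real m + real k) / Gamma c))"
    unfolding e by (subst Bochner_Integration.integral_sum) (auto simp: moment3)
  also have "\<dots> = nrm n * pochhammer a m * (\<Sum>k\<le>n. (-1) ^ k * real (n choose k) * (Gamma (c + real m + real k) / Gamma (c + real m + (- real m) + real k)))"
    unfolding sum_distrib_left
  proof (rule sum.cong)
    fix k
    have g: "Gamma (c + real m + (- real m) + real k) = pochhammer c k * Gamma c" using Gamma_shift_up[OF c, of k] by simp
    show "pc n k * (pochhammer b k * pochhammer a m * Gamma (c + real m + real k) / Gamma c) =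
       nrm n * pochhammer a m * ((-1) ^ k * real (n choose k) * (Gamma (c + real m + real k) / Gamma (c + real m + (- real m) + real k)))"
      unfolding g pc_def using poch_nz[of k] by simp
  qed simp
  also have "(\<Sum>k\<le>n. (-1) ^ k * real (n choose k) * (Gamma (c + real m + real k) / Gamma (c + real m + (- real m) + real k))) =
     pochhammer (- real m) n * Gamma (c + real m) / Gamma (c + real m + (- real m) + real n)"
    by (rule Gamma_Vandermonde) (use c in auto)
  finally show "(\<integral>z. pn n (ysq z) * rp be m (ysq z) \<partial>mu a b c) =
       nrm n * pochhammer a m * pochhammer (- real m) n * Gamma (c + real m) / Gamma (c + real n)" by simp
qed

lemma pn_be_expansion: "\<exists>q. q n = pc n n \<and> (\<forall>y. pn n y = (\<Sum>i\<le>n. q i * rp be i y))"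
  unfolding pn_def by (rule rp_rebase)

text \<open>The polynomial of smaller degree is expanded in the \<open>rp be\<close> basis. At most
  its leading term survives, and only if the degrees agree; its coefficient is
  \<open>pc n n\<close>, and (-n)_n = (-1)^n n! gives norm 1.\<close>

lemma pn_orthonormal:
  shows "integrable (mu a b c) (\<lambda>z. pn m (ysq z) * pn n (ysq z))"
    and "(\<integral>z. pn m (ysq z) * pn n (ysq z) \<partial>mu a b c) = (if m = n then 1 else 0)"
proof -
  have *: "integrable (mu a b c) (\<lambda>z. pn m (ysq z) * pn n (ysq z)) \<and>
     (\<integral>z. pn m (ysq z) * pn n (ysq z) \<partial>mu a b c) = (if m = n then 1 else 0)" if nm: "n \<le> m" for m n
  proof -
    obtain q where q: "q n = pc n n" "\<And>y. pn n y = (\<Sum>i\<le>n. q i * rp be i y)" using pn_be_expansion by blast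
    have e: "(\<lambda>z. pn m (ysq z) * pn n (ysq z)) = (\<lambda>z. \<Sum>i\<le>n. q i * (pn m (ysq z) * rp be i (ysq z)))"
      unfolding q(2)[of "ysq _"] sum_distrib_left by (simp only: mult_ac)
    have i: "integrable (mu a b c) (\<lambda>z. pn m (ysq z) * pn n (ysq z))"
      unfolding e by (intro Bochner_Integration.integrable_sum integrable_mult_right pn_rp_be)
    have "(\<integral>z. pn m (ysq z) * pn n (ysq z) \<partial>mu a b c) = (\<Sum>i\<le>n. q i * (nrm m * pochhammer a i * pochhammer (- real i) m * Gamma (c + real i) / Gamma (c + real m)))"
      unfolding e by (subst Bochner_Integration.integral_sum) (auto simp: pn_rp_be)
    also have "\<dots> = (\<Sum>i\<le>n. if i = m then q i * (nrm m * pochhammer a i * pochhammer (- real i) m * Gamma (c + real i) / Gamma (c + real m)) else 0)"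
      using nm by (intro sum.cong) (auto simp: pochhammer_of_nat_eq_0_iff)
    also have "\<dots> = (if m = n then 1 else 0)"
    proof (cases "m = n")
      case True
      have p: "pochhammer (- real n) n = (-1) ^ n * fact n" by (rule pochhammer_same)
      define s :: real where "s = (-1) ^ n"
      have ss: "s * s = 1" by (simp add: s_def power_mult_distrib[symmetric])
      have "q n * (nrm n * pochhammer a n * pochhammer (- real n) n * Gamma (c + real n) / Gamma (c + real n)) =
         (s * s) * (nrm n * nrm n) * (pochhammer a n * fact n) / (pochhammer b n * pochhammer c n)"
        unfolding q(1) pc_def p s_def[symmetric] using Gamma_real_nz[of "c + real n"] c by simp
      also have "\<dots> = 1" unfolding ss nrm_square using poch_nz[of n] by simp
      finally show ?thesis using True by simp
    qed (use nm in auto)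
    finally show ?thesis using i by simp
  qed
  show "integrable (mu a b c) (\<lambda>z. pn m (ysq z) * pn n (ysq z))"
    using *[of n m] *[of m n] by (cases "n \<le> m") (auto simp: mult.commute)
  show "(\<integral>z. pn m (ysq z) * pn n (ysq z) \<partial>mu a b c) = (if m = n then 1 else 0)"
    using *[of n m] *[of m n] by (cases "n \<le> m") (auto simp: mult.commute)
qed

text \<open>The double sum consists of two Vandermonde sums: the inner one, with t = a, returns a
  quotient of the same shape in k, which the outer one sums with t = a + l.\<close>

lemma pn_matrix_element: "(\<integral>z. hfun_re z * pn j (ysq z) * pn l (ysq z) \<partial>mu a b c) = Bmat a b c j l"
proof -
  let ?s = "b + c - a"
  have s: "?s > 0" using abc by simp
  have e: "(\<lambda>z. hfun_re z * pn j (ysq z) * pn l (ysq z)) =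
     (\<lambda>z. \<Sum>k\<le>j. \<Sum>m\<le>l. pc j k * pc l m * (hfun_re z * (rp al k (ysq z) * rp al m (ysq z))))"
  proof
    fix z
    have "hfun_re z * pn j (ysq z) * pn l (ysq z) = hfun_re z * (\<Sum>k\<le>j. \<Sum>m\<le>l. (pc j k * rp al k (ysq z)) * (pc l m * rp al m (ysq z)))"
      by (simp only: pn_def sum_product mult.assoc)
    thus "hfun_re z * pn j (ysq z) * pn l (ysq z) = (\<Sum>k\<le>j. \<Sum>m\<le>l. pc j k * pc l m * (hfun_re z * (rp al k (ysq z) * rp al m (ysq z))))"
      by (simp only: sum_distrib_left mult_ac)
  qed
  have "(\<integral>z. hfun_re z * pn j (ysq z) * pn l (ysq z) \<partial>mu a b c) =
     (\<Sum>k\<le>j. \<Sum>m\<le>l. pc j k * pc l m * (\<integral>z. hfun_re z * (rp al k (ysq z) * rp al m (ysq z)) \<partial>mu a b c))"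
    unfolding e
    by (subst Bochner_Integration.integral_sum, intro Bochner_Integration.integrable_sum integrable_mult_right moment4)
       (subst Bochner_Integration.integral_sum, auto intro!: integrable_mult_right moment4)
  also have "\<dots> = (\<Sum>k\<le>j. \<Sum>m\<le>l. (nrm j * nrm l * (Gamma b * Gamma c / Gamma ?s)) * ((-1) ^ k * real (j choose k)) *
      ((-1) ^ m * real (l choose m) * (Gamma (?s + real k + real m) / Gamma (?s + real k + a + real m))))"
  proof (intro sum.cong refl)
    fix k m
    have "(u * (x / (p * p'))) * (v * (y / (r * r'))) * (t * (p * p') * (r * r') * w) = (u * v * t) * x * (y * w)"
      if "p \<noteq> 0" "p' \<noteq> 0" "r \<noteq> 0" "r' \<noteq> 0" for u x p p' v y r r' t w :: real
      using that by simp
    from this[OF poch_nz(2,3) poch_nz(2,3)]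
    show "pc j k * pc l m * (\<integral>z. hfun_re z * (rp al k (ysq z) * rp al m (ysq z)) \<partial>mu a b c) =
       (nrm j * nrm l * (Gamma b * Gamma c / Gamma ?s)) * ((-1) ^ k * real (j choose k)) *
      ((-1) ^ m * real (l choose m) * (Gamma (?s + real k + real m) / Gamma (?s + real k + a + real m)))"
      unfolding moment4 pc_def by blast
  qed
  also have "\<dots> = (nrm j * nrm l * (Gamma b * Gamma c / Gamma ?s)) * (\<Sum>k\<le>j. (-1) ^ k * real (j choose k) *
      (\<Sum>m\<le>l. (-1) ^ m * real (l choose m) * (Gamma (?s + real k + real m) / Gamma (?s + real k + a + real m))))"
    by (simp only: sum_distrib_left mult.assoc)
  also have "(\<Sum>k\<le>j. (-1) ^ k * real (j choose k) *
      (\<Sum>m\<le>l. (-1) ^ m * real (l choose m) * (Gamma (?s + real k + real m) / Gamma (?s + real k + a + real m)))) =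
     pochhammer a l * (\<Sum>k\<le>j. (-1) ^ k * real (j choose k) * (Gamma (?s + real k) / Gamma (?s + (a + real l) + real k)))"
    unfolding sum_distrib_left
  proof (intro sum.cong refl)
    fix k
    have e: "?s + real k + a + real l = ?s + (a + real l) + real k" by simp
    have "(\<Sum>m\<le>l. (-1) ^ m * real (l choose m) * (Gamma (?s + real k + real m) / Gamma (?s + real k + a + real m))) =
       pochhammer a l * Gamma (?s + real k) / Gamma (?s + (a + real l) + real k)"
      unfolding e[symmetric] by (rule Gamma_Vandermonde) (use s a in auto)
    thus "(\<Sum>m\<le>l. (-1) ^ k * real (j choose k) * ((-1) ^ m * real (l choose m) * (Gamma (?s + real k + real m) / Gamma (?s + real k + a + real m)))) =
       pochhammer a l * ((-1) ^ k * real (j choose k) * (Gamma (?s + real k) / Gamma (?s + (a + real l) + real k)))"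
      unfolding sum_distrib_left[symmetric] by simp
  qed
  also have "(\<Sum>k\<le>j. (-1) ^ k * real (j choose k) * (Gamma (?s + real k) / Gamma (?s + (a + real l) + real k))) =
     pochhammer (a + real l) j * Gamma ?s / Gamma (?s + (a + real l) + real j)"
    by (rule Gamma_Vandermonde) (use s a in auto)
  also have "?s + (a + real l) + real j = real (j + l) + b + c" by simp
  also have "(nrm j * nrm l * (Gamma b * Gamma c / Gamma ?s)) * (pochhammer a l * (pochhammer (a + real l) j * Gamma ?s / Gamma (real (j + l) + b + c))) =
      nrm j * nrm l * (Gamma b * Gamma c / Gamma a) * (pochhammer a l * pochhammer (a + real l) j * Gamma a / Gamma (real (j + l) + b + c))"
    using Gamma_real_nz[OF s] Gamma_real_nz[OF a] by simp
  also have "pochhammer a l * pochhammer (a + real l) j * Gamma a = Gamma (real (j + l) + a)"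
    unfolding pochhammer_product'[symmetric] using Gamma_shift_up[OF a, of "l + j"] by (simp add: add_ac)
  also have "nrm j * nrm l * (Gamma b * Gamma c / Gamma a) = sqrt (Gamma (real j + b) * Gamma (real j + c) * Gamma (real l + b) * Gamma (real l + c) /
           (Gamma (real j + a) * fact j * Gamma (real l + a) * fact l))"
  proof -
    have g: "Gamma (real n + t) = pochhammer t n * Gamma t" if "t > 0" for n t
      using Gamma_shift_up[OF that, of n] by (simp add: add_ac)
    define X where "X = Gamma b * Gamma c / Gamma a"
    have X: "X \<ge> 0" using Gamma_real_pos[OF a] Gamma_real_pos[OF b] Gamma_real_pos[OF c] unfolding X_def by (simp del: Gamma_real_pos)
    have E: "Gamma (real j + b) * Gamma (real j + c) * Gamma (real l + b) * Gamma (real l + c) /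
           (Gamma (real j + a) * fact j * Gamma (real l + a) * fact l) =
      (pochhammer b j * pochhammer c j / (pochhammer a j * fact j)) * (pochhammer b l * pochhammer c l / (pochhammer a l * fact l)) * (X * X)"
      unfolding g[OF a] g[OF b] g[OF c] X_def by (simp add: mult_ac)
    show ?thesis unfolding E real_sqrt_mult real_sqrt_mult_self nrm_def X_def[symmetric] using X by simp
  qed
  finally show ?thesis unfolding Bmat_def by simp
qed

end

section \<open>Completeness\<close>

lemma abs_mult_le_squares: "\<bar>u * v\<bar> \<le> u\<^sup>2 + (v::real)\<^sup>2"
  using sum_squares_bound[of "\<bar>u\<bar>" "\<bar>v\<bar>"] mult_nonneg_nonneg[OF abs_ge_zero[of u] abs_ge_zero[of v]]
  by (simp only: abs_mult power2_abs)

lemma sq_le_exp_scaled: "d > 0 \<Longrightarrow> x \<ge> 0 \<Longrightarrow> x\<^sup>2 \<le> (2 / d\<^sup>2) * exp (d * x :: real)"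
  using sq_le_exp[of "d * x"] by (simp add: power_mult_distrib field_simps)

lemma exp_partial_sum_le: "y \<ge> 0 \<Longrightarrow> (\<Sum>k<N. y ^ k / fact k) \<le> exp (y :: real)"
proof -
  assume y: "y \<ge> 0"
  have "(\<lambda>k. y ^ k / fact k) sums exp y"
    using exp_converges[of y] by (simp add: divide_inverse mult.commute)
  thus ?thesis using y sum_le_suminf[of "\<lambda>k. y ^ k / fact k" "{..<N}"] by (simp add: sums_iff)
qed

text \<open>Half of the rate pays for the power: one term of the exponential series gives |x|^m <=
  m! (2/d)^m exp(d|x|/2).\<close>

lemma exp_moment_integrable:
  fixes g :: "real \<Rightarrow> real"
  assumes [measurable]: "g \<in> borel_measurable borel" and d: "d > 0"
    and int: "integrable lborel (\<lambda>x. exp (d * \<bar>x\<bar>) * g x)"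
  shows "integrable lborel (\<lambda>x. \<bar>x\<bar> ^ m * exp (d/2 * \<bar>x\<bar>) * \<bar>g x\<bar>)"
proof (rule Bochner_Integration.integrable_bound)
  show "integrable lborel (\<lambda>x. (fact m * (2/d) ^ m) * \<bar>exp (d * \<bar>x\<bar>) * g x\<bar>)"
    using int by (intro integrable_mult_right integrable_abs)
  have "\<bar>x\<bar> ^ m * exp (d/2 * \<bar>x\<bar>) * \<bar>g x\<bar> \<le> (fact m * (2/d) ^ m) * \<bar>exp (d * \<bar>x\<bar>) * g x\<bar>" for x
  proof -
    have "(d/2 * \<bar>x\<bar>) ^ m / fact m \<le> exp (d/2 * \<bar>x\<bar>)"
    proof -
      have "(d/2 * \<bar>x\<bar>) ^ m / fact m \<le> (\<Sum>k\<in>{..<Suc m}. (d/2 * \<bar>x\<bar>) ^ k / fact k)"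
        by (rule member_le_sum) (use d in auto)
      also have "\<dots> \<le> exp (d/2 * \<bar>x\<bar>)" by (rule exp_partial_sum_le) (use d in simp)
      finally show ?thesis .
    qed
    hence "\<bar>x\<bar> ^ m \<le> fact m * (2/d) ^ m * exp (d/2 * \<bar>x\<bar>)"
      using d by (simp add: power_mult_distrib power_divide field_simps)
    hence "\<bar>x\<bar> ^ m * (exp (d/2 * \<bar>x\<bar>) * \<bar>g x\<bar>) \<le> fact m * (2/d) ^ m * exp (d/2 * \<bar>x\<bar>) * (exp (d/2 * \<bar>x\<bar>) * \<bar>g x\<bar>)"
      by (intro mult_right_mono) auto
    also have "\<dots> = fact m * (2/d) ^ m * ((exp (d/2 * \<bar>x\<bar>) * exp (d/2 * \<bar>x\<bar>)) * \<bar>g x\<bar>)" by simp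
    also have "exp (d/2 * \<bar>x\<bar>) * exp (d/2 * \<bar>x\<bar>) = exp (d * \<bar>x\<bar>)" by (simp add: exp_add[symmetric])
    finally show ?thesis by (simp add: abs_mult mult.assoc)
  qed
  thus "AE x in lborel. norm (\<bar>x\<bar> ^ m * exp (d/2 * \<bar>x\<bar>) * \<bar>g x\<bar>) \<le> norm ((fact m * (2/d) ^ m) * \<bar>exp (d * \<bar>x\<bar>) * g x\<bar>)"
    using d by (auto simp: abs_mult)
qed measurable

text \<open>Exponential decay makes the Fourier transform locally the sum of its Taylor series, with a radius
  that does not depend on the centre; hence it vanishes identically if all moments do.\<close>

lemma moments_zero_imp_Fourier_zero:
  fixes g :: "real \<Rightarrow> real"
  assumes gm [measurable]: "g \<in> borel_measurable borel" and d: "d > 0"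
    and int: "integrable lborel (\<lambda>x. exp (d * \<bar>x\<bar>) * g x)"
    and mom: "\<And>m. (\<integral>x. x ^ m * g x \<partial>lborel) = 0"
  shows "(\<integral>x. iexp (t * x) * complex_of_real (g x) \<partial>lborel) = 0"
proof -
  \<comment> \<open>Up to powers of i these integrals are the Fourier transform at u and all its
    derivatives there.\<close>
  define P where "P u \<longleftrightarrow> (\<forall>m. (\<integral>x. iexp (u * x) * complex_of_real (x ^ m * g x) \<partial>lborel) = 0)" for u
  have P0: "P 0"
  proof -
    have "(\<integral>x. complex_of_real (x ^ m * g x) \<partial>lborel) = 0" for m
      unfolding integral_complex_of_real mom by simp
    thus ?thesis by (simp add: P_def)
  qed
  \<comment> \<open>The Taylor series around u is integrated termwise; exp(d|x|/2) dominates its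
    partial sums for |s| <= d/2, whatever u is.\<close>
  have step: "P (u + s)" if u: "P u" and s: "\<bar>s\<bar> \<le> d/2" for u s
    unfolding P_def
  proof
    fix m
    let ?f = "\<lambda>N x. (\<Sum>k<N. (\<i> * of_real (s * x)) ^ k / fact k) * (iexp (u * x) * complex_of_real (x ^ m * g x))"
    have i: "integrable lborel (\<lambda>x. \<bar>x\<bar> ^ m * exp (d/2 * \<bar>x\<bar>) * \<bar>g x\<bar>)" for m
      by (rule exp_moment_integrable[OF gm d int])
    have term_int: "integrable lborel (\<lambda>x. iexp (u * x) * complex_of_real (x ^ m * g x))" for m
    proof (rule Bochner_Integration.integrable_bound[OF i[of m]])
      have "\<bar>x\<bar> ^ m * \<bar>g x\<bar> * 1 \<le> \<bar>x\<bar> ^ m * \<bar>g x\<bar> * exp (d/2 * \<bar>x\<bar>)" for x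
        using d by (intro mult_left_mono) auto
      thus "AE x in lborel. norm (iexp (u * x) * complex_of_real (x ^ m * g x)) \<le> norm (\<bar>x\<bar> ^ m * exp (d/2 * \<bar>x\<bar>) * \<bar>g x\<bar>)"
        by (auto simp: norm_mult norm_power abs_mult power_abs mult_ac)
    qed measurable
    have zero: "(\<integral>x. ?f N x \<partial>lborel) = 0" for N
    proof -
      have "(\<integral>x. ?f N x \<partial>lborel) = (\<integral>x. (\<Sum>k<N. ((\<i> * of_real s) ^ k / fact k) * (iexp (u * x) * complex_of_real (x ^ (k + m) * g x))) \<partial>lborel)"
        unfolding sum_distrib_right by (intro Bochner_Integration.integral_cong sum.cong refl) (simp add: power_mult_distrib power_add mult_ac)
      also have "\<dots> = (\<Sum>k<N. ((\<i> * of_real s) ^ k / fact k) * (\<integral>x. iexp (u * x) * complex_of_real (x ^ (k + m) * g x) \<partial>lborel))"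
        by (subst Bochner_Integration.integral_sum) (auto intro!: integrable_mult_right term_int simp del: of_real_mult of_real_power)
      also have "\<dots> = 0" using u by (simp add: P_def)
      finally show ?thesis .
    qed
    have "(\<lambda>N. \<integral>x. ?f N x \<partial>lborel) \<longlonglongrightarrow> (\<integral>x. iexp ((u + s) * x) * complex_of_real (x ^ m * g x) \<partial>lborel)"
    proof (rule integral_dominated_convergence[OF _ _ i[of m]])
      show "AE x in lborel. (\<lambda>N. ?f N x) \<longlonglongrightarrow> iexp ((u + s) * x) * complex_of_real (x ^ m * g x)"
      proof (rule AE_I2)
        fix x
        have "(\<lambda>k. (\<i> * of_real (s * x)) ^ k / fact k) sums iexp (s * x)"
          using exp_converges[of "\<i> * of_real (s * x)"] by (simp add: scaleR_conv_of_real divide_inverse mult_ac)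
        hence "(\<lambda>N. ?f N x) \<longlonglongrightarrow> iexp (s * x) * (iexp (u * x) * complex_of_real (x ^ m * g x))"
          unfolding sums_def by (intro tendsto_mult tendsto_const)
        also have "iexp (s * x) * (iexp (u * x) * complex_of_real (x ^ m * g x)) = iexp ((u + s) * x) * complex_of_real (x ^ m * g x)"
          unfolding mult.assoc[symmetric] exp_add[symmetric] by (simp add: algebra_simps)
        finally show "(\<lambda>N. ?f N x) \<longlonglongrightarrow> iexp ((u + s) * x) * complex_of_real (x ^ m * g x)" .
      qed
      fix N
      have "norm (?f N x) \<le> \<bar>x\<bar> ^ m * exp (d/2 * \<bar>x\<bar>) * \<bar>g x\<bar>" for x
      proof -
        have "norm (\<Sum>k<N. (\<i> * of_real (s * x)) ^ k / fact k) \<le> (\<Sum>k<N. \<bar>s * x\<bar> ^ k / fact k)"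
          by (rule order_trans[OF norm_sum]) (simp add: norm_divide norm_power norm_mult abs_mult)
        also have "\<dots> \<le> exp \<bar>s * x\<bar>" by (rule exp_partial_sum_le) simp
        also have "\<dots> \<le> exp (d/2 * \<bar>x\<bar>)" unfolding exp_le_cancel_iff abs_mult using s by (intro mult_right_mono) auto
        finally have "norm (?f N x) \<le> exp (d/2 * \<bar>x\<bar>) * norm (iexp (u * x) * complex_of_real (x ^ m * g x))"
          unfolding norm_mult by (intro mult_right_mono) auto
        thus ?thesis by (simp add: norm_mult norm_power abs_mult power_abs mult_ac)
      qed
      thus "AE x in lborel. norm (?f N x) \<le> \<bar>x\<bar> ^ m * exp (d/2 * \<bar>x\<bar>) * \<bar>g x\<bar>" by simp
    qed measurable
    thus "(\<integral>x. iexp ((u + s) * x) * complex_of_real (x ^ m * g x) \<partial>lborel) = 0"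
      unfolding zero by (simp add: LIMSEQ_const_iff)
  qed
  \<comment> \<open>The way from 0 to t is covered in N steps of length at most d/2.\<close>
  obtain N :: nat where N: "N > 0" "\<bar>t\<bar> / real N \<le> d/2"
  proof -
    obtain n :: nat where n: "2 * \<bar>t\<bar> / d \<le> real n" using real_arch_simple by blast
    have "\<bar>t\<bar> / real (Suc n) \<le> d/2"
    proof -
      have "2 * \<bar>t\<bar> \<le> d * real (Suc n)" using n d by (simp add: field_simps)
      thus ?thesis by (simp add: field_simps)
    qed
    thus ?thesis using that[of "Suc n"] by simp
  qed
  have "P (real k * (t / real N))" for k
  proof (induction k)
    case (Suc k)
    have "\<bar>t / real N\<bar> \<le> d/2" using N by simp
    from step[OF Suc this] show ?case by (simp add: algebra_simps add_divide_distrib)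
  qed (use P0 in simp)
  from this[of N] have "P t" using N(1) by simp
  from this[unfolded P_def, rule_format, of 0] show ?thesis by simp
qed

text \<open>The positive and negative parts have the same integral M (take t = 0). If M > 0,
  dividing by it gives two probability densities with equal characteristic functions, and Levy
  uniqueness applies; if M = 0, both parts vanish almost everywhere.\<close>

lemma Fourier_zero_imp_AE_zero:
  fixes g :: "real \<Rightarrow> real"
  assumes gi: "integrable lborel g"
    and F: "\<And>t. (\<integral>x. iexp (t * x) * complex_of_real (g x) \<partial>lborel) = 0"
  shows "AE x in lborel. g x = 0"
proof -
  have [measurable]: "g \<in> borel_measurable borel" using gi by (auto dest: borel_measurable_integrable)
  define p where "p x = max 0 (g x)" for x
  define n where "n x = max 0 (- g x)" for x
  have p_meas [measurable]: "p \<in> borel_measurable borel" and n_meas [measurable]: "n \<in> borel_measurable borel"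
    unfolding p_def[abs_def] n_def[abs_def] by measurable
  have pn: "p x - n x = g x" "p x \<ge> 0" "n x \<ge> 0" for x by (auto simp: p_def n_def)
  have ip: "integrable lborel p" and i_n: "integrable lborel n"
    by (rule Bochner_Integration.integrable_bound[OF gi]; auto simp: p_def n_def)+
  define M where "M = (\<integral>x. p x \<partial>lborel)"
  have ie: "integrable lborel (\<lambda>x. iexp (t * x) * complex_of_real (f x))" if "integrable lborel f" for f :: "real \<Rightarrow> real" and t
    by (rule Bochner_Integration.integrable_bound[OF that]) (use that in \<open>auto simp: norm_mult dest: borel_measurable_integrable\<close>)
  have eqF: "(\<integral>x. iexp (t * x) * complex_of_real (p x) \<partial>lborel) = (\<integral>x. iexp (t * x) * complex_of_real (n x) \<partial>lborel)" for t
  proof -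
    have "(\<integral>x. iexp (t * x) * complex_of_real (p x) \<partial>lborel) - (\<integral>x. iexp (t * x) * complex_of_real (n x) \<partial>lborel)
      = (\<integral>x. iexp (t * x) * complex_of_real (p x) - iexp (t * x) * complex_of_real (n x) \<partial>lborel)"
      by (rule Bochner_Integration.integral_diff[symmetric]) (intro ie ip i_n)+
    also have "\<dots> = (\<integral>x. iexp (t * x) * complex_of_real (g x) \<partial>lborel)"
      by (simp only: right_diff_distrib[symmetric] of_real_diff[symmetric] pn)
    finally show ?thesis using F by simp
  qed
  have Mn: "(\<integral>x. n x \<partial>lborel) = M"
  proof -
    have "complex_of_real (\<integral>x. p x \<partial>lborel) = complex_of_real (\<integral>x. n x \<partial>lborel)"
      using eqF[of 0] by simp
    thus ?thesis unfolding M_def of_real_eq_iff by simp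
  qed
  have M0: "M \<ge> 0" unfolding M_def using pn by (simp add: Bochner_Integration.integral_nonneg)
  have "AE x in lborel. p x = n x"
  proof (cases "M = 0")
    case True
    have "AE x in lborel. p x = 0" "AE x in lborel. n x = 0"
      using integral_nonneg_eq_0_iff_AE[OF ip] integral_nonneg_eq_0_iff_AE[OF i_n] True Mn pn by (auto simp: M_def)
    thus ?thesis by eventually_elim simp
  next
    case False
    hence M: "M > 0" using M0 by simp
    have rd: "real_distribution (density lborel (\<lambda>x. ennreal (f x / M)))"
      if f: "integrable lborel f" "\<And>x. f x \<ge> 0" "(\<integral>x. f x \<partial>lborel) = M" for f
    proof (rule real_distribution.intro)
      have [measurable]: "f \<in> borel_measurable borel" using f(1) by (auto dest: borel_measurable_integrable)
      show "prob_space (density lborel (\<lambda>x. ennreal (f x / M)))"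
      proof
        have "emeasure (density lborel (\<lambda>x. ennreal (f x / M))) UNIV = (\<integral>\<^sup>+x. ennreal (f x / M) \<partial>lborel)"
          by (subst emeasure_density) auto
        also have "\<dots> = ennreal (\<integral>x. f x / M \<partial>lborel)"
          by (rule nn_integral_eq_integral) (use f M in auto)
        also have "(\<integral>x. f x / M \<partial>lborel) = 1" using f(3) M by simp
        finally show "emeasure (density lborel (\<lambda>x. ennreal (f x / M))) (space (density lborel (\<lambda>x. ennreal (f x / M)))) = 1" by simp
      qed
    qed (simp add: real_distribution_axioms_def)
    have ch: "char (density lborel (\<lambda>x. ennreal (f x / M))) t = (\<integral>x. iexp (t * x) * complex_of_real (f x) \<partial>lborel) / of_real M"
      if [measurable]: "f \<in> borel_measurable borel" and "\<And>x. f x \<ge> 0" for f t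
      unfolding char_def using that M
      by (subst integral_density) (auto simp: scaleR_conv_of_real mult_ac)
    have "density lborel (\<lambda>x. ennreal (p x / M)) = density lborel (\<lambda>x. ennreal (n x / M))"
    proof (rule Levy_uniqueness)
      show "char (density lborel (\<lambda>x. ennreal (p x / M))) = char (density lborel (\<lambda>x. ennreal (n x / M)))"
        by (rule ext, subst (1 2) ch) (simp_all only: eqF pn p_meas n_meas)
    qed (intro rd ip i_n pn Mn M_def[symmetric])+
    hence "AE x in lborel. ennreal (p x / M) = ennreal (n x / M)"
      by (intro sigma_finite_measure.density_unique[OF lborel.sigma_finite_measure_axioms]) auto
    thus ?thesis using M pn by (auto simp: divide_nonneg_pos)
  qed
  thus ?thesis
  proof eventually_elim
    fix x assume "p x = n x"
    thus "g x = 0" using pn(1)[of x] by simp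
  qed
qed

text \<open>G is extended to an even function on the line: the odd moments vanish by symmetry, the
  even ones by hypothesis.\<close>

lemma even_moments_zero:
  fixes G :: "real \<Rightarrow> real"
  assumes [measurable]: "G \<in> borel_measurable borel" and d: "d > 0"
    and int: "set_integrable lborel {0<..} (\<lambda>x. exp (d * x) * G x)"
    and mom: "\<And>n. (LINT x:{0<..}|lborel. (x\<^sup>2) ^ n * G x) = 0"
  shows "AE x in lborel. x > 0 \<longrightarrow> G x = 0"
proof -
  define H where "H x = indicator {0<..} x * G x" for x
  have Hm [measurable]: "H \<in> borel_measurable borel" unfolding H_def[abs_def] by measurable
  define g where "g x = H x + H (- x)" for x
  have gm [measurable]: "g \<in> borel_measurable borel" unfolding g_def[abs_def] by measurable
  have iH: "integrable lborel (\<lambda>x. exp (d * \<bar>x\<bar>) * H x)"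
    by (rule Bochner_Integration.integrable_cong[THEN iffD1, OF refl _ int[unfolded set_integrable_def]])
       (auto simp: H_def indicator_def)
  have reflect_integrable: "integrable lborel (\<lambda>x. f (- x))" if "integrable lborel f" for f :: "real \<Rightarrow> real"
    using lborel_integrable_real_affine[OF that, of "-1" 0] by simp
  have reflect_integral: "(\<integral>x. f (- x) \<partial>lborel) = (\<integral>x. f x \<partial>lborel)" for f :: "real \<Rightarrow> real"
    using lborel_integral_real_affine[of "-1" f 0] by simp
  have ig: "integrable lborel (\<lambda>x. exp (d * \<bar>x\<bar>) * g x)"
    using Bochner_Integration.integrable_add[OF iH reflect_integrable[OF iH]] by (simp add: g_def distrib_left)
  have iM: "integrable lborel (\<lambda>x. x ^ m * H x)" for m
  proof (rule Bochner_Integration.integrable_bound[OF exp_moment_integrable[OF Hm d iH, of m]])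
    have "\<bar>x\<bar> ^ m * \<bar>H x\<bar> * 1 \<le> \<bar>x\<bar> ^ m * \<bar>H x\<bar> * exp (d/2 * \<bar>x\<bar>)" for x
      using d by (intro mult_left_mono) auto
    thus "AE x in lborel. norm (x ^ m * H x) \<le> norm (\<bar>x\<bar> ^ m * exp (d/2 * \<bar>x\<bar>) * \<bar>H x\<bar>)"
      by (auto simp: abs_mult power_abs mult_ac)
  qed measurable
  have "(\<integral>x. x ^ m * g x \<partial>lborel) = 0" for m
  proof -
    have "(\<integral>x. x ^ m * g x \<partial>lborel) = (\<integral>x. x ^ m * H x + (-1) ^ m * ((- x) ^ m * H (- x)) \<partial>lborel)"
      by (rule Bochner_Integration.integral_cong) (auto simp: g_def distrib_left power_mult_distrib[symmetric] mult.assoc[symmetric])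
    also have "\<dots> = (\<integral>x. x ^ m * H x \<partial>lborel) + (-1) ^ m * (\<integral>x. (- x) ^ m * H (- x) \<partial>lborel)"
      by (subst Bochner_Integration.integral_add) (auto intro!: iM integrable_mult_right reflect_integrable[OF iM])
    also have "(\<integral>x. (- x) ^ m * H (- x) \<partial>lborel) = (\<integral>x. x ^ m * H x \<partial>lborel)"
      by (rule reflect_integral[of "\<lambda>x. x ^ m * H x"])
    also have "(\<integral>x. x ^ m * H x \<partial>lborel) + (-1) ^ m * (\<integral>x. x ^ m * H x \<partial>lborel) = 0"
    proof (cases "even m")
      case True
      then obtain n where m: "m = 2 * n" by auto
      have "(\<integral>x. x ^ m * H x \<partial>lborel) = 0"
        using mom[of n] unfolding set_lebesgue_integral_def H_def m power_mult real_scaleR_def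
        by (simp only: mult.left_commute)
      thus ?thesis by simp
    qed simp
    finally show ?thesis .
  qed
  hence F: "(\<integral>x. iexp (t * x) * complex_of_real (g x) \<partial>lborel) = 0" for t
    by (rule moments_zero_imp_Fourier_zero[OF gm d ig])
  have "integrable lborel g"
    using Bochner_Integration.integrable_add[OF iM[of 0] reflect_integrable[OF iM[of 0]]] by (simp add: g_def[abs_def])
  from Fourier_zero_imp_AE_zero[OF this F] have "AE x in lborel. g x = 0" .
  thus ?thesis by eventually_elim (auto simp: g_def H_def)
qed

lemma prod_quadratic_bound:
  fixes t :: "nat \<Rightarrow> real"
  assumes "finite F"
  shows "\<And>e. e > 0 \<Longrightarrow> \<exists>M. \<forall>x\<ge>0. \<bar>\<Prod>k\<in>F. x\<^sup>2 + t k\<bar> \<le> M * exp (e * x)"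
  using assms
proof (induction F rule: finite_induct)
  case empty
  thus ?case by (intro exI[of _ 1]) auto
next
  case (insert j F)
  have e2: "e / 2 > 0" using insert.prems by simp
  from insert.IH[OF e2] obtain M where M: "\<And>x. x \<ge> 0 \<Longrightarrow> \<bar>\<Prod>k\<in>F. x\<^sup>2 + t k\<bar> \<le> M * exp (e/2 * x)" by blast
  define L where "L = 2 / (e/2)\<^sup>2 + \<bar>t j\<bar>"
  have L: "L \<ge> 0" by (simp add: L_def)
  have "\<bar>\<Prod>k\<in>insert j F. x\<^sup>2 + t k\<bar> \<le> (L * M) * exp (e * x)" if x: "x \<ge> 0" for x
  proof -
    have "\<bar>x\<^sup>2 + t j\<bar> \<le> x\<^sup>2 + \<bar>t j\<bar> * 1" by (simp add: abs_if)
    also have "\<dots> \<le> 2 / (e/2)\<^sup>2 * exp (e/2 * x) + \<bar>t j\<bar> * exp (e/2 * x)"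
      using sq_le_exp_scaled[OF e2 x] e2 x by (intro add_mono mult_left_mono) auto
    finally have 1: "\<bar>x\<^sup>2 + t j\<bar> \<le> L * exp (e/2 * x)" by (simp add: L_def distrib_right)
    have "\<bar>\<Prod>k\<in>insert j F. x\<^sup>2 + t k\<bar> = \<bar>x\<^sup>2 + t j\<bar> * \<bar>\<Prod>k\<in>F. x\<^sup>2 + t k\<bar>"
      using insert.hyps by (simp add: abs_mult)
    also have "\<dots> \<le> (L * exp (e/2 * x)) * (M * exp (e/2 * x))"
      using 1 M[OF x] L by (intro mult_mono) auto
    also have "\<dots> = (L * M) * (exp (e/2 * x) * exp (e/2 * x))" by simp
    also have "exp (e/2 * x) * exp (e/2 * x) = exp (e * x)" by (simp add: exp_add[symmetric])
    finally show ?thesis .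
  qed
  thus ?case by blast
qed

section \<open>Completeness of the polynomials for the orthogonality measure\<close>

context hahn_params
begin

lemma ysq_power_integrable: "integrable (mu a b c) (\<lambda>z. ysq z ^ m)"
proof -
  have fm: "(\<lambda>z. ysq z ^ m) \<in> borel_measurable (mu a b c)" by measurable
  have "\<exists>M. \<forall>x::real\<ge>0. \<bar>\<Prod>k\<in>{..<m}. x\<^sup>2 + 0\<bar> \<le> M * exp (1 * x)"
    by (rule prod_quadratic_bound) auto
  then obtain M where M: "\<forall>x::real\<ge>0. \<bar>\<Prod>k\<in>{..<m}. x\<^sup>2 + 0\<bar> \<le> M * exp (1 * x)" ..
  have "set_integrable lborel {0<..} (\<lambda>x. kap * ((x\<^sup>2) ^ m * om al be ga x))"
    by (intro set_integrable_mult_right om_integrable[of _ _ _ M] al_pos be_pos) (use M in \<open>auto simp: power_abs\<close>)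
  thus ?thesis unfolding mu_integral(1)[OF fm] by (simp add: rho_eq mult_ac)
qed

text \<open>The polynomial \<open>q\<close> vanishes at every atom, so the moments of g q see the
  half-line alone, and g = 0 there. Each atom is then isolated by the polynomial \<open>Q\<close>
  that vanishes at all the others, and its positive mass forces g = 0 at it.\<close>

lemma pn_complete:
  assumes gm [measurable]: "g \<in> borel_measurable (mu a b c)"
    and gsq: "integrable (mu a b c) (\<lambda>z. (g z)\<^sup>2)"
    and orth: "\<And>n. (\<integral>z. g z * pn n (ysq z) \<partial>mu a b c) = 0"
  shows "AE z in mu a b c. g z = (0::real)"
proof -
  have base_int: "integrable (mu a b c) (\<lambda>z. g z * ysq z ^ m)" for m
  proof (rule Bochner_Integration.integrable_bound)
    show "integrable (mu a b c) (\<lambda>z. (g z)\<^sup>2 + ysq z ^ (2 * m))"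
      by (intro Bochner_Integration.integrable_add gsq ysq_power_integrable)
    show "AE z in mu a b c. norm (g z * ysq z ^ m) \<le> norm ((g z)\<^sup>2 + ysq z ^ (2 * m))"
      using abs_mult_le_squares[of "g _" "ysq _ ^ m"] by (intro AE_I2) (simp add: power_mult mult.commute[of 2])
  qed measurable
  have rp_int: "integrable (mu a b c) (\<lambda>z. g z * (ysq z ^ m * rp al n (ysq z)))" for m n
  proof (induction n arbitrary: m)
    case 0
    show ?case using base_int[of m] by (simp add: rp_def)
  next
    case (Suc n)
    have "(\<lambda>z. g z * (ysq z ^ m * rp al (Suc n) (ysq z))) =
       (\<lambda>z. (al + real n)\<^sup>2 * (g z * (ysq z ^ m * rp al n (ysq z))) + g z * (ysq z ^ Suc m * rp al n (ysq z)))"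
      by (simp add: rp_def algebra_simps fun_eq_iff)
    thus ?case using Suc.IH[of m] Suc.IH[of "Suc m"] by simp
  qed
  \<comment> \<open>Triangularity: the leading coefficient \<open>pc n n\<close> is nonzero.\<close>
  have rp_zero: "(\<integral>z. g z * rp al n (ysq z) \<partial>mu a b c) = 0" for n
  proof (induction n rule: less_induct)
    case (less n)
    have pcn: "pc n n \<noteq> 0"
      unfolding pc_def nrm_def using poch_nz[of n] by simp
    have i: "integrable (mu a b c) (\<lambda>z. g z * rp al k (ysq z))" for k using rp_int[of 0 k] by simp
    have "0 = (\<integral>z. (\<Sum>k\<le>n. pc n k * (g z * rp al k (ysq z))) \<partial>mu a b c)"
      using orth[of n] by (simp add: pn_def sum_distrib_left mult_ac)
    also have "\<dots> = (\<Sum>k\<le>n. pc n k * (\<integral>z. g z * rp al k (ysq z) \<partial>mu a b c))"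
      using i by (subst Bochner_Integration.integral_sum) auto
    also have "\<dots> = (\<Sum>k\<in>{n}. pc n k * (\<integral>z. g z * rp al k (ysq z) \<partial>mu a b c))"
      by (rule sum.mono_neutral_right) (use less.IH in auto)
    finally show ?case using pcn by simp
  qed
  \<comment> \<open>y + (al+n)^2 is the next factor of \<open>rp al\<close>, so multiplication by y
    stays within the span of this basis.\<close>
  have mom: "(\<integral>z. g z * (ysq z ^ m * rp al n (ysq z)) \<partial>mu a b c) = 0" for m n
  proof (induction m arbitrary: n)
    case 0
    show ?case using rp_zero by simp
  next
    case (Suc m)
    have "(\<lambda>z. g z * (ysq z ^ Suc m * rp al n (ysq z))) =
       (\<lambda>z. g z * (ysq z ^ m * rp al (Suc n) (ysq z)) - (al + real n)\<^sup>2 * (g z * (ysq z ^ m * rp al n (ysq z))))"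
      by (simp add: rp_def algebra_simps fun_eq_iff)
    thus ?case using rp_int[of m "Suc n"] rp_int[of m n] Suc.IH by simp
  qed
  define Z where "Z Q \<longleftrightarrow> (\<forall>m. integrable (mu a b c) (\<lambda>z. g z * (ysq z ^ m * Q (ysq z))) \<and>
      (\<integral>z. g z * (ysq z ^ m * Q (ysq z)) \<partial>mu a b c) = 0)" for Q :: "real \<Rightarrow> real"
  have Zprod: "Z (\<lambda>y. \<Prod>k\<in>F. y + t k)" if "finite F" for F :: "nat set" and t
    using that
  proof (induction F rule: finite_induct)
    case empty
    show ?case using base_int mom[of _ 0] by (simp add: Z_def rp_def)
  next
    case (insert j F)
    have eq: "(\<lambda>z. g z * (ysq z ^ m * (\<Prod>k\<in>insert j F. ysq z + t k))) =
      (\<lambda>z. g z * (ysq z ^ Suc m * (\<Prod>k\<in>F. ysq z + t k)) + t j * (g z * (ysq z ^ m * (\<Prod>k\<in>F. ysq z + t k))))" for m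
      using insert.hyps by (simp add: algebra_simps fun_eq_iff)
    show ?case using insert.IH unfolding Z_def eq by (simp del: power_Suc)
  qed
  define t where "t k = (ga + real k)\<^sup>2" for k
  define q where "q y = (\<Prod>k\<in>atomset ga. y + t k)" for y
  have q_at: "q (ysq (lam a b c k)) = 0" if "k \<in> atomset ga" for k
    unfolding q_def using that by (intro prod_zero) (auto simp: ysq_lam t_def)
  have qm [measurable]: "q \<in> borel_measurable borel" unfolding q_def[abs_def] by measurable
  have gx [measurable]: "(\<lambda>x. indicator {0<..} x * g (complex_of_real x)) \<in> borel_measurable borel"
  proof -
    have "(\<lambda>x. indicator {0<..} x * g (line_map x)) \<in> borel_measurable borel"
      using line_map_compose[OF gm] by measurable
    moreover have "(\<lambda>x. indicator {0<..} x * g (line_map x)) = (\<lambda>x. indicator {0<..} x * g (complex_of_real x))"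
      by (auto simp: line_map_def indicator_def)
    ultimately show ?thesis by simp
  qed
  \<comment> \<open>The indicator is there because \<open>g\<close> is known to be measurable on the
    support only.\<close>
  define G where "G x = (indicator {0<..} x * g (complex_of_real x)) * (rho a b c x * q (x\<^sup>2))" for x
  have Gm [measurable]: "G \<in> borel_measurable borel" unfolding G_def[abs_def] by measurable
  have "AE x in lborel. x > 0 \<longrightarrow> G x = 0"
  \<comment> \<open>With 1/4 here and growth exp(x/4) allowed for q, the square of exp(x/4) q(x^2)
    grows at most like exp x, as \<open>om_integrable\<close> requires.\<close>
  proof (rule even_moments_zero[OF Gm, of "1/4"])
    obtain M where M: "\<And>x. x \<ge> 0 \<Longrightarrow> \<bar>q (x\<^sup>2)\<bar> \<le> M * exp (1/4 * x)"
      using prod_quadratic_bound[OF finite_atomset[of ga], of "1/4" t] unfolding q_def by auto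
    have i1: "set_integrable lborel {0<..} (\<lambda>x. rho a b c x * (g (complex_of_real x))\<^sup>2)"
      using mu_integral(1)[of "\<lambda>z. (g z)\<^sup>2"] gsq by simp
    have i2: "set_integrable lborel {0<..} (\<lambda>x. kap * ((exp (1/4 * x) * q (x\<^sup>2))\<^sup>2 * om al be ga x))"
    proof (intro set_integrable_mult_right om_integrable[of _ _ _ "M\<^sup>2"] al_pos be_pos)
      fix x :: real assume x: "x > 0"
      have "\<bar>exp (1/4 * x) * q (x\<^sup>2)\<bar> \<le> exp (1/4 * x) * (M * exp (1/4 * x))"
        using M[of x] x by (simp add: abs_mult)
      from power_mono[OF this, of 2] have "\<bar>(exp (1/4 * x) * q (x\<^sup>2))\<^sup>2\<bar> \<le> (exp (1/4 * x) * (M * exp (1/4 * x)))\<^sup>2" by simp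
      also have "\<dots> = M\<^sup>2 * (exp (1/4 * x) * exp (1/4 * x) * exp (1/4 * x) * exp (1/4 * x))"
        by (simp add: power2_eq_square mult_ac)
      also have "exp (1/4 * x) * exp (1/4 * x) * exp (1/4 * x) * exp (1/4 * x) = exp x" by (simp add: exp_add[symmetric])
      finally show "\<bar>(exp (1/4 * x) * q (x\<^sup>2))\<^sup>2\<bar> \<le> M\<^sup>2 * exp x" .
    qed measurable
    show "set_integrable lborel {0<..} (\<lambda>x. exp (1/4 * x) * G x)"
    proof (rule set_integrable_bound[OF set_integral_add(1)[OF i1 i2]])
      show "AE x in lborel. x \<in> {0<..} \<longrightarrow> norm (exp (1/4 * x) * G x) \<le> norm (rho a b c x * (g (complex_of_real x))\<^sup>2 + kap * ((exp (1/4 * x) * q (x\<^sup>2))\<^sup>2 * om al be ga x))"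
      proof (intro AE_I2 impI)
        fix x :: real assume "x \<in> {0<..}"
        hence x: "x > 0" by simp
        have r: "rho a b c x \<ge> 0" using rho_nonneg x by simp
        from mult_left_mono[OF abs_mult_le_squares[of "g (complex_of_real x)" "exp (1/4 * x) * q (x\<^sup>2)"] r]
        have "norm (exp (1/4 * x) * G x) \<le> rho a b c x * (g (complex_of_real x))\<^sup>2 + rho a b c x * (exp (1/4 * x) * q (x\<^sup>2))\<^sup>2"
          using x r by (simp add: G_def abs_mult mult_ac distrib_left)
        also have "rho a b c x * (exp (1/4 * x) * q (x\<^sup>2))\<^sup>2 = kap * ((exp (1/4 * x) * q (x\<^sup>2))\<^sup>2 * om al be ga x)"
          by (simp add: rho_eq mult_ac)
        finally show "norm (exp (1/4 * x) * G x) \<le> norm (rho a b c x * (g (complex_of_real x))\<^sup>2 + kap * ((exp (1/4 * x) * q (x\<^sup>2))\<^sup>2 * om al be ga x))"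
          by simp
      qed
    qed (simp add: set_borel_measurable_def)
    show "(LINT x:{0<..}|lborel. (x\<^sup>2) ^ n * G x) = 0" for n
    proof -
      let ?f = "\<lambda>z. g z * (ysq z ^ n * q (ysq z))"
      have fm: "?f \<in> borel_measurable (mu a b c)" by measurable
      have z: "integrable (mu a b c) ?f" "(\<integral>z. ?f z \<partial>mu a b c) = 0"
        using Zprod[of "atomset ga" t] by (simp_all add: Z_def q_def)
      have "(\<Sum>k\<in>atomset ga. wmass a b c k * ?f (lam a b c k)) = 0"
        by (rule sum.neutral) (auto simp: q_at)
      hence "(LINT x:{0<..}|lborel. rho a b c x * ?f (of_real x)) = 0"
        using mu_integral(2)[OF fm z(1)] z(2) by simp
      moreover have "(LINT x:{0<..}|lborel. rho a b c x * ?f (of_real x)) = (LINT x:{0<..}|lborel. (x\<^sup>2) ^ n * G x)"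
        by (rule set_lebesgue_integral_cong) (auto simp: G_def)
      ultimately show ?thesis by simp
    qed
  qed simp
  hence cont: "AE x in lborel. x > 0 \<longrightarrow> g (of_real x) = 0"
  proof eventually_elim
    fix x assume *: "x > 0 \<longrightarrow> G x = 0"
    show "x > 0 \<longrightarrow> g (of_real x) = 0"
    proof
      assume x: "x > 0"
      have "rho a b c x > 0" using x kap_pos om_pos by (simp add: rho_eq)
      moreover have "q (x\<^sup>2) > 0" unfolding q_def t_def using x by (intro prod_pos) (simp add: add_pos_nonneg)
      ultimately show "g (of_real x) = 0" using * x by (simp add: G_def)
    qed
  qed
  have atom: "g (lam a b c j) = 0" if j: "j \<in> atomset ga" for j
  proof -
    define Q where "Q y = (\<Prod>k\<in>atomset ga - {j}. y + t k)" for y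
    let ?f = "\<lambda>z. g z * Q (ysq z)"
    have z: "integrable (mu a b c) ?f" "(\<integral>z. ?f z \<partial>mu a b c) = 0"
    proof -
      have "Z Q" unfolding Q_def[abs_def] by (rule Zprod) simp
      from this[unfolded Z_def, rule_format, of 0]
      show "integrable (mu a b c) ?f" "(\<integral>z. ?f z \<partial>mu a b c) = 0" by simp_all
    qed
    have fm: "?f \<in> borel_measurable (mu a b c)" using z(1) by (rule borel_measurable_integrable)
    have "(LINT x:{0<..}|lborel. rho a b c x * ?f (of_real x)) = (LINT x:{0<..}|(lborel::real measure). (0::real))"
      unfolding set_lebesgue_integral_def
    proof (rule integral_cong_AE)
      have "set_integrable lborel {0<..} (\<lambda>x. rho a b c x * ?f (of_real x))" using mu_integral(1)[OF fm] z(1) by simp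
      thus "(\<lambda>x. indicator {0<..} x *\<^sub>R (rho a b c x * ?f (of_real x))) \<in> borel_measurable lborel"
        unfolding set_integrable_def by (rule borel_measurable_integrable)
      show "AE x in lborel. indicator {0<..} x *\<^sub>R (rho a b c x * ?f (of_real x)) = indicator {0<..} x *\<^sub>R 0"
        using cont by eventually_elim (auto simp: indicator_def)
    qed simp
    hence "0 = (\<Sum>k\<in>atomset ga. wmass a b c k * ?f (lam a b c k))"
      using mu_integral(2)[OF fm z(1)] z(2) by (simp add: set_lebesgue_integral_def)
    also have "\<dots> = (\<Sum>k\<in>{j}. wmass a b c k * ?f (lam a b c k))"
    proof (rule sum.mono_neutral_right)
      show "\<forall>k\<in>atomset ga - {j}. wmass a b c k * ?f (lam a b c k) = 0"
      proof
        fix k assume "k \<in> atomset ga - {j}"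
        hence "Q (ysq (lam a b c k)) = 0" unfolding Q_def by (intro prod_zero) (auto simp: ysq_lam t_def)
        thus "wmass a b c k * ?f (lam a b c k) = 0" by simp
      qed
    qed (use j in auto)
    finally have "wmass a b c j * (g (lam a b c j) * Q (ysq (lam a b c j))) = 0" by simp
    moreover have "Q (ysq (lam a b c j)) \<noteq> 0"
    proof -
      \<comment> \<open>All ga + k with k in \<open>atomset ga\<close> are negative, so distinct
        indices have distinct squares.\<close>
      have "t k \<noteq> t j" if "k \<in> atomset ga" "k \<noteq> j" for k
      proof
        assume "t k = t j"
        hence "ga + real k = ga + real j \<or> ga + real k = - (ga + real j)" unfolding t_def by (simp only: power2_eq_iff)
        thus False using that j by (auto simp: atomset_def)
      qed
      thus ?thesis unfolding Q_def by (auto simp: ysq_lam t_def)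
    qed
    ultimately show ?thesis using wmass_pos[OF j] by simp
  qed
  show ?thesis by (rule AE_mu_zero[OF gm cont atom])
qed

lemma pn_basis: "real_orthonormal_basis (mu a b c) (\<lambda>n z. pn n (ysq z))"
proof -
  have "integrable (mu a b c) (\<lambda>z. 1 :: real)" using ysq_power_integrable[of 0] by simp
  hence fin: "finite_measure (mu a b c)"
    by (intro finite_measureI) (auto simp: integrable_iff_bounded)
  show ?thesis
  proof (intro real_orthonormal_basis.intro fin real_orthonormal_basis_axioms.intro)
    show "(\<lambda>z. pn n (ysq z)) \<in> borel_measurable (mu a b c)" for n by measurable
    show "integrable (mu a b c) (\<lambda>z. (pn n (ysq z))\<^sup>2)" for n
      using pn_orthonormal(1)[of n n] by (simp add: power2_eq_square)
  qed (fact pn_orthonormal(2), rule pn_complete)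
qed

end

theorem mainTheorem3:
  fixes a b c :: real
  assumes "a > 0" and "b > 0" and "c > 0" and "a < b + c" and "b < a + c"
  shows "\<exists>U :: (nat \<Rightarrow> complex) \<Rightarrow> complex \<Rightarrow> complex.
     (\<forall>x. l2seq x \<longrightarrow> L2fun (mu a b c) (U x))
   \<and> (\<forall>x y. l2seq x \<longrightarrow> l2seq y \<longrightarrow> (AE z in mu a b c. U (\<lambda>n. x n + y n) z = U x z + U y z))
   \<and> (\<forall>x s. l2seq x \<longrightarrow> (AE z in mu a b c. U (\<lambda>n. s * x n) z = s * U x z))
   \<and> (\<forall>x. l2seq x \<longrightarrow> (\<integral>z. (norm (U x z))\<^sup>2 \<partial>mu a b c) = (\<Sum>n. (norm (x n))\<^sup>2))
   \<and> (\<forall>f. L2fun (mu a b c) f \<longrightarrow> (\<exists>x. l2seq x \<and> (AE z in mu a b c. U x z = f z)))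
   \<and> (\<forall>n. AE z in mu a b c. U (ebasis n) z = Phat a b c n z)
   \<and> (\<forall>x. l2seq x \<longrightarrow>
          (\<forall>j. summable (\<lambda>k. complex_of_real (Bmat a b c j k) * x k))
        \<and> l2seq (Bop a b c x)
        \<and> (AE z in mu a b c. U (Bop a b c x) z = hfun a b c z * U x z))"
proof -
  interpret hahn_params a b c using assms by unfold_locales
  interpret real_orthonormal_basis "mu a b c" "\<lambda>n z. pn n (ysq z)" by (rule pn_basis)
  obtain Q where Q: "\<And>z. z \<in> space (mu a b c) \<Longrightarrow> \<bar>hfun_re z\<bar> \<le> Q"
    using hfun_re_bounded unfolding space_mu by blast
  \<comment> \<open>The identifications with real functions hold on the support, hence the exchange
    under the almost-everywhere quantifier.\<close>
  have Phat_AE: "(AE z in mu a b c. V z = Phat a b c n z) \<longleftrightarrow> (AE z in mu a b c. V z = of_real (pn n (ysq z)))" for V n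
    by (rule AE_cong) (simp add: Phat_eq space_mu)
  have hfun_AE: "(AE z in mu a b c. V z = hfun a b c z * W z) \<longleftrightarrow> (AE z in mu a b c. V z = of_real (hfun_re z) * W z)" for V W
    by (rule AE_cong) (simp add: hfun_eq space_mu)
  have Bop_eq: "Bop a b c x = (\<lambda>j. \<Sum>k. complex_of_real (Bmat a b c j k) * x k)" for x
    by (simp add: Bop_def fun_eq_iff)
  show ?thesis unfolding Phat_AE hfun_AE Bop_eq
    by (rule diagonalisation[OF hfun_re_measurable_mu Q pn_matrix_element])
qed

end
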